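(* Let $u\in H^{1,a}(B_1^+)$ be the unique solution of the boundary value problem with datum $g$ described in the context, and assume that for every $n\in\mathbb{N}$ one has $u(z)=o(|z|^n)$ as $|z|\to0$, $z\in\overline{B_1^+}$. Then $u\equiv0$ on $B_1^+$.
   Context: Fix an integer $N\ge1$, $a\in(-1,1)$, $p\ge2$ and constants $\lambda_-,\lambda_+\ge0$. Write $t^+=\max\{t,0\}$, $t^-=\max\{-t,0\}$, $z=(x,y)\in\mathbb{R}^N\times\mathbb{R}$, $\mathbb{R}^{N+1}_+=\mathbb{R}^N\times(0,\infty)$, $B_r^+=\{z\in\mathbb{R}^{N+1}_+:|z|<r\}$, $S_r^+=\{z\in\mathbb{R}^{N+1}_+:|z|=r\}$, $B_r'=\{x\in\mathbb{R}^N:|x|<r\}$ (identified with $B_r'\times\{0\}$). $H^{1,a}(B_r^+)$ is the completion of $C^\infty(\overline{B_r^+})$ in the norm $\left(\int_{B_r^+}y^a(|\nabla u|^2+u^2)\,dx\,dy\right)^{1/2}$, and $H^{1,a}_{0,S_r^+}(B_r^+)$ is the closure of $C_c^\infty(\overline{B_r^+}\setminus\overline{S_r^+})$ in it. Given $g\in H^{1,a}(B_1^+)\cap C(\overline{B_1^+})$, a solution of $$-\mathrm{div}(y^a\nabla u)=0\text{ in }B_1^+,\quad u=g\text{ on }S_1^+,\quad -\lim_{y\to0^+}y^a\partial_yu=\lambda_-(u^-)^{p-1}-\lambda_+(u^+)^{p-1}\text{ on }B_1'$$ is a function $u\in H^{1,a}(B_1^+)\cap L^p(B_1')$ (in the sense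 of traces on $B_1'$) with $u-g\in H^{1,a}_{0,S_1^+}(B_1^+)$ and $\int_{B_1^+}y^a\nabla u\cdot\nabla\varphi\,dx\,dy=\int_{B_1'}(\lambda_-(u^-)^{p-1}-\lambda_+(u^+)^{p-1})\varphi\,dx$ for all $\varphi\in H^{1,a}_{0,S_1^+}(B_1^+)$. The solution exists, is unique, and is continuous on $B_1^+\cup B_1'$. *)

theory Defs
  imports "HOL-Analysis.Analysis" "HOL-Library.Landau_Symbols"
begin

definition half_ball :: "real \<Rightarrow> ((real ^ 'n) \<times> real) set"
  where "half_ball r = {z. 0 < snd z \<and> norm z < r}"

definition half_sphere :: "real \<Rightarrow> ((real ^ 'n) \<times> real) set"
  where "half_sphere r = {z. 0 < snd z \<and> norm z = r}"

definition flat_ball :: "real \<Rightarrow> (real ^ 'n) set"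
  where "flat_ball r = {x. norm x < r}"

primrec C_k :: "nat \<Rightarrow> ('a::euclidean_space \<Rightarrow> real) \<Rightarrow> bool" where
  "C_k 0 f \<longleftrightarrow> continuous_on UNIV f"
| "C_k (Suc k) f \<longleftrightarrow> (\<forall>x. f differentiable (at x)) \<and>
     (\<forall>b\<in>Basis. C_k k (\<lambda>x. frechet_derivative f (at x) b))"

text \<open>Smoothness on the closed half-ball is read as being the restriction of a function that is
  smooth on the whole space; only the values on the half-ball and its closure matter below.\<close>

definition smooth :: "('a::euclidean_space \<Rightarrow> real) \<Rightarrow> bool"
  where "smooth f \<longleftrightarrow> (\<forall>k. C_k k f)"

definition grad :: "('a::euclidean_space \<Rightarrow> real) \<Rightarrow> 'a \<Rightarrow> 'a"
  where "grad f x = (\<Sum>b\<in>Basis. frechet_derivative f (at x) b *\<^sub>R b)"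

lemma GDERIV_grad:
  assumes "f differentiable (at x)"
  shows "GDERIV f x :> grad f x"
proof -
  have d: "(f has_derivative frechet_derivative f (at x)) (at x)"
    using assms frechet_derivative_works by blast
  then interpret bounded_linear "frechet_derivative f (at x)"
    by (rule has_derivative_bounded_linear)
  have "frechet_derivative f (at x) h = h \<bullet> grad f x" for h
  proof -
    have "frechet_derivative f (at x) h = frechet_derivative f (at x) (\<Sum>b\<in>Basis. (h \<bullet> b) *\<^sub>R b)"
      by (simp add: euclidean_representation)
    also have "\<dots> = h \<bullet> grad f x"
      by (simp add: sum scale grad_def inner_sum_right mult.commute)
    finally show ?thesis .
  qed
  then have "frechet_derivative f (at x) = (\<lambda>h. h \<bullet> grad f x)" ..
  with d show ?thesis
    unfolding gderiv_def by metis
qed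

text \<open>Support, relative to the closed half-ball, compact and disjoint from the closed half-sphere.\<close>

definition smooth_off_sphere :: "real \<Rightarrow> ((real ^ 'n) \<times> real \<Rightarrow> real) \<Rightarrow> bool"
  where "smooth_off_sphere r f \<longleftrightarrow> smooth f \<and>
    compact (closure {z \<in> closure (half_ball r). f z \<noteq> 0}) \<and>
    closure {z \<in> closure (half_ball r). f z \<noteq> 0} \<subseteq> closure (half_ball r) - closure (half_sphere r)"

definition weighted :: "real \<Rightarrow> real \<Rightarrow> ((real ^ 'n) \<times> real) measure"
  where "weighted a r = density (lebesgue_on (half_ball r)) (\<lambda>z. ennreal (snd z powr a))"

text \<open>The squared distance in the weighted Sobolev norm between a smooth function and a pair
  (function, gradient). It is a nonnegative integral, so convergence to 0 forces square integrability
  of the limits.\<close>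

definition H1a_dist2 ::
  "real \<Rightarrow> real \<Rightarrow> ((real ^ 'n) \<times> real \<Rightarrow> real) \<Rightarrow> ((real ^ 'n) \<times> real \<Rightarrow> real) \<Rightarrow>
   ((real ^ 'n) \<times> real \<Rightarrow> (real ^ 'n) \<times> real) \<Rightarrow> ennreal"
  where "H1a_dist2 a r \<phi> u G =
    (\<integral>\<^sup>+ z. ennreal ((norm (grad \<phi> z - G z))\<^sup>2 + (\<phi> z - u z)\<^sup>2) \<partial>weighted a r)"

text \<open>The completion of a class X of smooth functions, realised inside the weighted square-integrable
  functions: a Cauchy sequence is represented by the limit u of the functions together with the
  limit G of their gradients. For a in (-1,1), G is determined by u almost everywhere (it is the weak
  gradient), so the pair carries no more information than u.\<close>

definition completion_grad ::
  "(((real ^ 'n) \<times> real \<Rightarrow> real) \<Rightarrow> bool) \<Rightarrow> real \<Rightarrow> real \<Rightarrow>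
   ((real ^ 'n) \<times> real \<Rightarrow> real) \<Rightarrow> ((real ^ 'n) \<times> real \<Rightarrow> (real ^ 'n) \<times> real) \<Rightarrow> bool"
  where "completion_grad X a r u G \<longleftrightarrow>
    u \<in> borel_measurable (weighted a r) \<and> G \<in> borel_measurable (weighted a r) \<and>
    (\<exists>\<phi> :: nat \<Rightarrow> (real ^ 'n) \<times> real \<Rightarrow> real.
      (\<forall>k. X (\<phi> k)) \<and> (\<lambda>k. H1a_dist2 a r (\<phi> k) u G) \<longlonglongrightarrow> 0)"

definition H1a :: "real \<Rightarrow> real \<Rightarrow> ((real ^ 'n) \<times> real \<Rightarrow> real) set"
  where "H1a a r = {u. \<exists>G. completion_grad smooth a r u G}"

definition H1a_0 :: "real \<Rightarrow> real \<Rightarrow> ((real ^ 'n) \<times> real \<Rightarrow> real) set"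
  where "H1a_0 a r = {u. \<exists>G. completion_grad (smooth_off_sphere r) a r u G}"

definition has_gradient ::
  "real \<Rightarrow> real \<Rightarrow> ((real ^ 'n) \<times> real \<Rightarrow> real) \<Rightarrow> ((real ^ 'n) \<times> real \<Rightarrow> (real ^ 'n) \<times> real) \<Rightarrow> bool"
  where "has_gradient a r u G \<longleftrightarrow> completion_grad smooth a r u G"

text \<open>The trace operator is the continuous extension, from the weighted Sobolev space to the
  square-integrable functions on the flat ball, of restriction to y = 0.\<close>

definition has_trace ::
  "real \<Rightarrow> real \<Rightarrow> ((real ^ 'n) \<times> real \<Rightarrow> real) \<Rightarrow> (real ^ 'n \<Rightarrow> real) \<Rightarrow> bool"
  where "has_trace a r u v \<longleftrightarrow>
    v \<in> borel_measurable (lebesgue_on (flat_ball r)) \<and>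
    (\<exists>G (\<phi> :: nat \<Rightarrow> (real ^ 'n) \<times> real \<Rightarrow> real). has_gradient a r u G \<and>
      (\<forall>k. smooth (\<phi> k)) \<and> (\<lambda>k. H1a_dist2 a r (\<phi> k) u G) \<longlonglongrightarrow> 0 \<and>
      (\<lambda>k. \<integral>\<^sup>+ x. ennreal ((\<phi> k (x, 0) - v x)\<^sup>2) \<partial>lebesgue_on (flat_ball r)) \<longlonglongrightarrow> 0)"

definition Lp :: "real \<Rightarrow> (real ^ 'n) set \<Rightarrow> (real ^ 'n \<Rightarrow> real) set"
  where "Lp p S = {v \<in> borel_measurable (lebesgue_on S). integrable (lebesgue_on S) (\<lambda>x. \<bar>v x\<bar> powr p)}"

definition flux :: "real \<Rightarrow> real \<Rightarrow> real \<Rightarrow> real \<Rightarrow> real"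
  where "flux p lm lp t = lm * (max (- t) 0) powr (p - 1) - lp * (max t 0) powr (p - 1)"

text \<open>Gradient and trace are unique almost everywhere, so the quantifiers over G, v, H, w below only
  pick representatives. Integrability of the boundary term is demanded explicitly because the
  Bochner integral of a non-integrable function is 0; for the bulk term it follows from square
  integrability.\<close>

definition solution ::
  "real \<Rightarrow> real \<Rightarrow> real \<Rightarrow> real \<Rightarrow> ((real ^ 'n) \<times> real \<Rightarrow> real) \<Rightarrow> ((real ^ 'n) \<times> real \<Rightarrow> real) \<Rightarrow> bool"
  where "solution a p lm lp g u \<longleftrightarrow>
    (\<lambda>z. u z - g z) \<in> H1a_0 a 1 \<and>
    (\<exists>G v. has_gradient a 1 u G \<and> has_trace a 1 u v \<and> v \<in> Lp p (flat_ball 1) \<and>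
      (\<forall>\<phi>\<in>H1a_0 a 1. \<forall>H w. has_gradient a 1 \<phi> H \<longrightarrow> has_trace a 1 \<phi> w \<longrightarrow>
        integrable (lebesgue_on (flat_ball 1)) (\<lambda>x. flux p lm lp (v x) * w x) \<and>
        (LINT z|weighted a 1. G z \<bullet> H z) =
          (LINT x|lebesgue_on (flat_ball 1). flux p lm lp (v x) * w x)))"

end

theory Submission
  imports Defs
begin

text \<open>Almgren's frequency function, with balls replaced by smooth radial cutoffs so that no boundary
  integrals occur. For \<open>0 < s < 1\<close> let \<open>\<theta>\<^sub>s(z) = exp (- 1 / (1 - |z|\<^sup>2 / s))\<close> inside the ball of radius
  \<open>\<surd>s\<close> and \<open>k\<^sub>s\<close> the corresponding value of minus the derivative of the profile, and let \<open>D\<close>, \<open>B\<close>,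
  \<open>H\<close> be the integrals of \<open>y\<^sup>a |\<nabla>u|\<^sup>2 \<theta>\<^sub>s\<close>, of \<open>(\<lambda>\<^sub>- (u\<^sup>-)\<^sup>p + \<lambda>\<^sub>+ (u\<^sup>+)\<^sup>p) \<theta>\<^sub>s\<close> on the flat ball, and of
  \<open>y\<^sup>a u\<^sup>2 k\<^sub>s\<close>. Testing the equation with \<open>\<theta>\<^sub>s u\<close> expresses \<open>D + B\<close> through \<open>u\<close> and its radial derivative,
  which gives \<open>H' = (D + B) / 2 + Q H / (2 s)\<close> with \<open>Q = N + 1 + a\<close>.

  The Pohozaev inequality needs no regularity of \<open>u\<close>: one tests with \<open>\<theta>\<^sub>s (u(t \<cdot>) - u)\<close> for \<open>t > 1\<close>, uses
  the convexity of the energy and the potential and the homogeneity of \<open>y\<^sup>a\<close>, and lets \<open>t\<close> decrease to 1.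
  Together with the Cauchy-Schwarz inequality and \<open>p \<ge> 2\<close> it makes \<open>s (D + 2 B / p) / H\<close> nondecreasing, so
  that \<open>H\<close> is either zero or bounded below by a power of \<open>s\<close>. Infinite order of vanishing excludes the latter.\<close>

section \<open>Smooth cutoffs and the calculus of smooth functions\<close>

text \<open>The classical Pohozaev identity tests the equation with the radial derivative z . grad
  u, which is not an admissible test function for a u with only one weak derivative. Quotients of
  dilations are admissible, and one-sided information suffices because the convexity of the energy
  and that of the potential give estimates in the direction that monotonicity requires.

  The weight 2/p in D + 2 B / p is dictated by the Pohozaev inequality, where B' carries exactly
  this factor. For p >= 2 the weighted sum is at most D + B, so the square of D + B supplied by
  Cauchy-Schwarz dominates the product that arises when the quotient is differentiated. The bulk
  measure is homogeneous of degree N + 1 + a and the flat one of degree N; a < 1 gives the mismatch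
  the favourable sign.

  The contradiction is available at every s in (0, 1), so H vanishes on the whole interval and u on
  the whole half-ball at once, rather than only near the origin.\<close>

definition bump :: "nat \<Rightarrow> real \<Rightarrow> real"
  where "bump m t = (if 0 < t then exp (- inverse t) / t ^ m else 0)"

lemma bump_nonneg [simp]: "0 \<le> bump m t"
  by (simp add: bump_def)

lemma bump_pos: "0 < t \<Longrightarrow> 0 < bump m t"
  by (simp add: bump_def)

lemma bump_eq_0: "t \<le> 0 \<Longrightarrow> bump m t = 0"
  by (simp add: bump_def)

text \<open>With x = 1/t, the quantity x^m / m! is a single term of the exponential series and hence
  at most exp x.\<close>

lemma bump_le_fact: "bump m t \<le> fact m"
proof (cases "0 < t")
  case True
  define x where "x = inverse t"
  have x: "0 < x" using True by (simp add: x_def)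
  have "(\<Sum>n\<in>{m}. x ^ n /\<^sub>R fact n) \<le> (\<Sum>n. x ^ n /\<^sub>R fact n)"
    using x by (intro sum_le_suminf summable_exp_generic) auto
  then have "x ^ m \<le> fact m * exp x"
    by (simp add: exp_def field_simps)
  then show ?thesis
    using True by (simp add: bump_def x_def exp_minus field_simps power_inverse)
qed (simp add: bump_def)

lemma bump_eq_mult_Suc: "bump m t = t * bump (Suc m) t"
  by (simp add: bump_def)

text \<open>The functions t^(-m) exp(-1/t), extended by 0, are closed under differentiation up to
  linear combinations. This keeps all derivatives of the cutoffs among cutoffs of higher
  index.\<close>

lemma DERIV_bump: "(bump m has_real_derivative bump (m + 2) t - real m * bump (m + 1) t) (at t)"
proof -
  consider "0 < t" | "t < 0" | "t = 0" by linarith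
  then show ?thesis
  proof cases
    case 1
    have "((\<lambda>t. exp (- inverse t) / t ^ m) has_real_derivative
        bump (m + 2) t - real m * bump (m + 1) t) (at t)"
      using 1 by (auto intro!: derivative_eq_intros simp: bump_def field_simps power_eq_if[of t m] power2_eq_square)
    then show ?thesis
      by (rule has_field_derivative_transform_within_open[where S = "{0<..}"])
        (use 1 in \<open>auto simp: bump_def\<close>)
  next
    case 2
    have "((\<lambda>t. 0) has_real_derivative bump (m + 2) t - real m * bump (m + 1) t) (at t)"
      using 2 by (simp add: bump_def)
    then show ?thesis
      by (rule has_field_derivative_transform_within_open[where S = "{..<0}"])
        (use 2 in \<open>auto simp: bump_def\<close>)
  next
    case 3
    \<comment> \<open>At 0 the difference quotient equals h times \<open>bump (m + 2) h\<close>, and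
      the second factor is bounded.\<close>
    have "((\<lambda>h. bump m h / h) \<longlongrightarrow> 0) (at 0)"
    proof (rule Lim_null_comparison)
      show "\<forall>\<^sub>F h in at 0. norm (bump m h / h) \<le> fact (m + 2) * \<bar>h\<bar>"
      proof (rule always_eventually, rule allI)
        fix h :: real
        have "bump m h / h = (if h = 0 then 0 else h * bump (m + 2) h)"
          using bump_eq_mult_Suc[of m h] bump_eq_mult_Suc[of "Suc m" h] by simp
        then show "norm (bump m h / h) \<le> fact (m + 2) * \<bar>h\<bar>"
          using bump_le_fact[of "m + 2" h] by (auto simp: abs_mult mult.commute[of "\<bar>h\<bar>"] intro: mult_right_mono)
      qed
      show "((\<lambda>h. fact (m + 2) * \<bar>h\<bar>) \<longlongrightarrow> 0) (at (0::real))"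
        by (auto intro!: tendsto_eq_intros)
    qed
    then show ?thesis
      using 3 by (simp add: DERIV_def bump_def)
  qed
qed

section \<open>Functions of class C^k and their gradients\<close>

lemma frechet_derivative_eqI:
  "(f has_derivative f') (at x) \<Longrightarrow> frechet_derivative f (at x) = f'"
  using frechet_derivative_at by metis

lemma has_derivative_frechet:
  "f differentiable (at x) \<Longrightarrow> (f has_derivative frechet_derivative f (at x)) (at x)"
  using frechet_derivative_works by blast

lemma C_k_SucD: "C_k (Suc k) f \<Longrightarrow> C_k k f"
proof (induction k arbitrary: f)
  case 0
  then have "f differentiable (at x)" for x by simp
  then show ?case
    by (simp add: continuous_at_imp_continuous_on differentiable_imp_continuous_within)
qed (metis C_k.simps(2))

lemma C_k_SucI:
  assumes "\<And>x. (f has_derivative f' x) (at x)" "\<And>b. b \<in> Basis \<Longrightarrow> C_k k (\<lambda>x. f' x b)"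
  shows "C_k (Suc k) f"
proof -
  have "frechet_derivative f (at x) = f' x" for x
    using assms(1) by (rule frechet_derivative_eqI)
  moreover have "f differentiable (at x)" for x
    using assms(1) by (auto simp: differentiable_def)
  ultimately show ?thesis using assms(2) by simp
qed

lemma C_k_const: "C_k k (\<lambda>x::'a::euclidean_space. c)"
proof (induction k arbitrary: c)
  case (Suc k)
  show ?case by (rule C_k_SucI[where f' = "\<lambda>_ _. 0"]) (auto intro: Suc)
qed simp

lemma C_k_inner: "C_k k (\<lambda>x::'a::euclidean_space. x \<bullet> c)"
proof (cases k)
  case (Suc k)
  show ?thesis unfolding Suc
    by (rule C_k_SucI[where f' = "\<lambda>_ h. h \<bullet> c"]) (auto intro!: derivative_eq_intros C_k_const)
qed (auto intro!: continuous_intros)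

lemma C_k_add: "C_k k f \<Longrightarrow> C_k k g \<Longrightarrow> C_k k (\<lambda>x. f x + g x)"
proof (induction k arbitrary: f g)
  case (Suc k)
  then show ?case
    by (intro C_k_SucI[where f' = "\<lambda>x h. frechet_derivative f (at x) h + frechet_derivative g (at x) h"]
        has_derivative_add has_derivative_frechet Suc.IH) auto
qed (auto intro: continuous_intros)

lemma C_k_mult: "C_k k f \<Longrightarrow> C_k k g \<Longrightarrow> C_k k (\<lambda>x. f x * g x)"
proof (induction k arbitrary: f g)
  case (Suc k)
  then show ?case
    by (intro C_k_SucI[where f' = "\<lambda>x h. f x * frechet_derivative g (at x) h + frechet_derivative f (at x) h * g x"]
        has_derivative_mult has_derivative_frechet C_k_add Suc.IH)
      (auto dest: C_k_SucD simp del: C_k.simps, auto)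
qed (auto intro: continuous_intros)

lemma C_k_cmult: "C_k k f \<Longrightarrow> C_k k (\<lambda>x. c * f x)"
  by (intro C_k_mult C_k_const)

lemma C_k_scale: "C_k k f \<Longrightarrow> C_k k (\<lambda>x. f (c *\<^sub>R x))"
proof (induction k arbitrary: f)
  case 0
  then show ?case
    by (auto intro!: continuous_on_compose2[of UNIV f] continuous_intros)
next
  case (Suc k)
  have d: "((\<lambda>x. f (c *\<^sub>R x)) has_derivative
      (\<lambda>h. c * frechet_derivative f (at (c *\<^sub>R x)) h)) (at x)" for x
  proof -
    have f: "(f has_derivative frechet_derivative f (at (c *\<^sub>R x))) (at (c *\<^sub>R x))"
      using Suc.prems by (auto intro: has_derivative_frechet)
    have "((\<lambda>x. f (c *\<^sub>R x)) has_derivative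
        (\<lambda>h. frechet_derivative f (at (c *\<^sub>R x)) (c *\<^sub>R h))) (at x)"
      by (rule has_derivative_compose[rotated], rule f) (auto intro!: derivative_eq_intros)
    moreover have "frechet_derivative f (at (c *\<^sub>R x)) (c *\<^sub>R h)
        = c * frechet_derivative f (at (c *\<^sub>R x)) h" for h
      using linear_scale[OF has_derivative_linear[OF f]] by simp
    ultimately show ?thesis by simp
  qed
  show ?case
    using Suc.prems Suc.IH by (intro C_k_SucI[OF d] C_k_cmult) auto
qed

text \<open>The induction on k leaves m arbitrary, since one derivative raises the index by one and
  by two.\<close>

lemma C_k_bump: "C_k k g \<Longrightarrow> C_k k (\<lambda>x. bump m (g x))"
proof (induction k arbitrary: m)
  case 0
  have "continuous_on UNIV (bump m)"
    by (rule DERIV_continuous_on) (rule has_field_derivative_at_within[OF DERIV_bump])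
  with 0 show ?case
    by (auto intro: continuous_on_compose2)
next
  case (Suc k)
  have d: "((\<lambda>x. bump m (g x)) has_derivative
      (\<lambda>h. (bump (m + 2) (g x) + (- real m) * bump (m + 1) (g x)) * frechet_derivative g (at x) h)) (at x)" for x
    using has_derivative_compose[OF has_derivative_frechet DERIV_bump[of m, unfolded has_field_derivative_def], of g x]
      Suc.prems by simp
  show ?case
    using Suc by (intro C_k_SucI[OF d] C_k_mult C_k_add C_k_cmult Suc.IH)
      (auto dest: C_k_SucD simp del: C_k.simps, auto)
qed

lemma smooth_mult: "smooth f \<Longrightarrow> smooth g \<Longrightarrow> smooth (\<lambda>x. f x * g x)"
  by (simp add: smooth_def C_k_mult)

lemma smooth_diff: "smooth f \<Longrightarrow> smooth g \<Longrightarrow> smooth (\<lambda>x. f x - g x)"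
  using C_k_add[OF _ C_k_cmult[of _ g "-1"]] by (simp add: smooth_def)

lemma smooth_scale: "smooth f \<Longrightarrow> smooth (\<lambda>x. f (c *\<^sub>R x))"
  by (simp add: smooth_def C_k_scale)

lemma smooth_GDERIV: "smooth f \<Longrightarrow> GDERIV f x :> grad f x"
  unfolding smooth_def by (intro GDERIV_grad) (metis C_k.simps(2))

lemma smooth_continuous: "smooth f \<Longrightarrow> continuous_on A f"
  unfolding smooth_def by (metis C_k.simps(1) continuous_on_subset subset_UNIV)

lemma smooth_continuous_grad:
  assumes "smooth f" shows "continuous_on A (grad f)"
proof -
  have "continuous_on UNIV (\<lambda>x. frechet_derivative f (at x) b)" if "b \<in> Basis" for b
    using assms that unfolding smooth_def by (metis C_k.simps)
  then have "continuous_on UNIV (grad f)"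
    unfolding grad_def by (intro continuous_intros)
  then show ?thesis
    using continuous_on_subset by blast
qed

lemma GDERIV_imp_grad:
  assumes "GDERIV f x :> d" shows "grad f x = d"
proof -
  have "frechet_derivative f (at x) = (\<lambda>h. h \<bullet> d)"
    using assms unfolding gderiv_def by (rule frechet_derivative_eqI)
  then show ?thesis
    using euclidean_representation[of d] by (simp add: grad_def inner_commute)
qed

lemma GDERIV_scale:
  assumes "smooth f" shows "GDERIV (\<lambda>x. f (c *\<^sub>R x)) x :> c *\<^sub>R grad f (c *\<^sub>R x)"
proof -
  have "((\<lambda>x. f (c *\<^sub>R x)) has_derivative (\<lambda>h. (c *\<^sub>R h) \<bullet> grad f (c *\<^sub>R x))) (at x)"
    using smooth_GDERIV[OF assms, of "c *\<^sub>R x"] unfolding gderiv_def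
    by (rule has_derivative_compose[rotated]) (auto intro!: derivative_eq_intros)
  then show ?thesis by (simp add: gderiv_def)
qed

lemma DERIV_ray:
  assumes "smooth f"
  shows "((\<lambda>t. f (t *\<^sub>R x)) has_real_derivative grad f (t *\<^sub>R x) \<bullet> x) (at t)"
proof -
  have "((\<lambda>t. f (t *\<^sub>R x)) has_derivative (\<lambda>h. (h *\<^sub>R x) \<bullet> grad f (t *\<^sub>R x))) (at t)"
    using smooth_GDERIV[OF assms, of "t *\<^sub>R x"] unfolding gderiv_def
    by (rule has_derivative_compose[rotated]) (auto intro!: derivative_eq_intros)
  then show ?thesis
    by (simp add: has_field_derivative_def inner_commute mult.commute[of _ "x \<bullet> _"])
qed

text \<open>The parameter s is a squared radius, so that the argument of the profile is a polynomial
  in z. The overview's \<theta>_s is \<open>cutoff 0 s\<close>, and its k_s is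
  \<open>cutoff 2 s\<close>, because the derivative of \<open>bump 0\<close> is
  \<open>bump 2\<close>.\<close>

definition cutoff :: "nat \<Rightarrow> real \<Rightarrow> 'a::real_inner \<Rightarrow> real"
  where "cutoff m s z = bump m (1 - z \<bullet> z / s)"

lemma cutoff_nonneg [simp]: "0 \<le> cutoff m s z"
  by (simp add: cutoff_def)

lemma cutoff_le_fact: "cutoff m s z \<le> fact m"
  by (simp add: cutoff_def bump_le_fact)

lemma cutoff_pos: "0 < s \<Longrightarrow> z \<bullet> z < s \<Longrightarrow> 0 < cutoff m s z"
  by (simp add: cutoff_def bump_pos)

lemma cutoff_eq_0: "0 < s \<Longrightarrow> s \<le> z \<bullet> z \<Longrightarrow> cutoff m s z = 0"
  by (simp add: cutoff_def bump_eq_0)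

lemma smooth_cutoff: "smooth (cutoff m s :: 'a::euclidean_space \<Rightarrow> real)"
proof -
  have *: "C_k k (\<lambda>z::'a. 1 + (- 1 / s) * (\<Sum>b\<in>Basis. (z \<bullet> b) * (z \<bullet> b)))" for k
  proof (intro C_k_add C_k_cmult C_k_const)
    have "finite B \<Longrightarrow> C_k k (\<lambda>z::'a. (\<Sum>b\<in>B. (z \<bullet> b) * (z \<bullet> b)))" for B
      by (induction B rule: finite_induct) (auto intro!: C_k_const C_k_add C_k_mult C_k_inner)
    then show "C_k k (\<lambda>z::'a. (\<Sum>b\<in>Basis. (z \<bullet> b) * (z \<bullet> b)))" by simp
  qed
  have "(\<lambda>z::'a. bump m (1 + (- 1 / s) * (\<Sum>b\<in>Basis. (z \<bullet> b) * (z \<bullet> b)))) = cutoff m s"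
    by (auto simp: cutoff_def fun_eq_iff euclidean_inner[symmetric])
  with C_k_bump[OF *, of _ m] show ?thesis
    by (simp add: smooth_def)
qed

lemma continuous_on_cutoff [continuous_intros]: "continuous_on A (cutoff m s :: 'a::euclidean_space \<Rightarrow> real)"
  by (rule smooth_continuous[OF smooth_cutoff])

lemma borel_measurable_cutoff [measurable]: "(cutoff m s :: 'a::euclidean_space \<Rightarrow> real) \<in> borel_measurable borel"
  by (intro borel_measurable_continuous_onI continuous_on_cutoff)

text \<open>The derivative of the profile \<open>bump m\<close>, taken at the point where
  \<open>cutoff m s\<close> evaluates it. Both the gradient in z and the derivative in s are
  multiples of it, so differentiating H and integrating by parts radially lead to the same
  integral.\<close>

definition cutoff' :: "nat \<Rightarrow> real \<Rightarrow> 'a::real_inner \<Rightarrow> real"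
  where "cutoff' m s z = cutoff (m + 2) s z - real m * cutoff (m + 1) s z"

lemma grad_cutoff:
  "0 < s \<Longrightarrow> grad (cutoff m s) z = (- (2 / s) * cutoff' m s z) *\<^sub>R (z :: 'a::euclidean_space)"
proof (rule GDERIV_imp_grad)
  assume "0 < s"
  then have "GDERIV (\<lambda>z. 1 - z \<bullet> z / s) z :> (- (2 / s)) *\<^sub>R z"
    unfolding gderiv_def by (auto intro!: derivative_eq_intros simp: inner_commute)
  from GDERIV_DERIV_compose[OF this DERIV_bump[of m]]
  show "GDERIV (cutoff m s) z :> (- (2 / s) * cutoff' m s z) *\<^sub>R z"
    by (simp add: cutoff_def[abs_def] cutoff'_def mult.commute)
qed

lemma cutoff'_0 [simp]: "cutoff' 0 s z = cutoff 2 s z"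
  by (simp add: cutoff'_def numeral_2_eq_2)

lemma DERIV_cutoff_param:
  "0 < s \<Longrightarrow> ((\<lambda>s. cutoff m s z) has_real_derivative cutoff' m s z * ((z \<bullet> z) / s\<^sup>2)) (at s)"
  unfolding cutoff_def cutoff'_def
  by (rule DERIV_chain2[OF DERIV_bump]) (auto intro!: derivative_eq_intros simp: power2_eq_square)

lemma abs_cutoff'_le: "\<bar>cutoff' m s z\<bar> \<le> fact (m + 2) + real m * fact (m + 1)"
proof -
  have "\<bar>cutoff' m s z\<bar> \<le> cutoff (m + 2) s z + real m * cutoff (m + 1) s z"
    using cutoff_nonneg[of "m+2" s z] mult_nonneg_nonneg[OF of_nat_0_le_iff[of m] cutoff_nonneg[of "m+1" s z]]
    unfolding cutoff'_def by linarith
  also have "\<dots> \<le> fact (m + 2) + real m * fact (m + 1)"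
    by (intro add_mono mult_left_mono cutoff_le_fact) auto
  finally show ?thesis .
qed

text \<open>Dilations act on the family of cutoffs through the squared radius; this is how dilated
  energies become D and B at the parameter t^2 s.\<close>

lemma cutoff_rescale: "c \<noteq> 0 \<Longrightarrow> cutoff m s z = cutoff m (c\<^sup>2 * s) (c *\<^sub>R z)"
  by (simp add: cutoff_def power2_eq_square)

lemma borel_measurable_cutoff' [measurable]: "(cutoff' m s :: 'a::euclidean_space \<Rightarrow> real) \<in> borel_measurable borel"
  unfolding cutoff'_def by measurable

section \<open>Differentiation under the integral and mean square convergence\<close>

text \<open>Dominated convergence along sequences: by the mean value inequality, the bound on the
  derivative also dominates the difference quotients.\<close>

lemma has_real_derivative_integral:
  fixes f f' :: "real \<Rightarrow> 'a \<Rightarrow> real"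
  assumes e: "0 < e"
    and int: "\<And>t. \<bar>t - s\<bar> < e \<Longrightarrow> integrable M (f t)"
    and d: "\<And>t x. \<bar>t - s\<bar> < e \<Longrightarrow> x \<in> space M \<Longrightarrow> ((\<lambda>t. f t x) has_real_derivative f' t x) (at t)"
    and b: "\<And>t x. \<bar>t - s\<bar> < e \<Longrightarrow> x \<in> space M \<Longrightarrow> \<bar>f' t x\<bar> \<le> g x"
    and g: "integrable M g"
  shows "((\<lambda>t. \<integral>x. f t x \<partial>M) has_real_derivative (\<integral>x. f' s x \<partial>M)) (at s)"
    and "integrable M (f' s)"
proof -
  have q: "\<bar>(f t x - f s x) / (t - s)\<bar> \<le> g x" if "\<bar>t - s\<bar> < e" "x \<in> space M" for t x
  proof -
    have "norm (f t x - f s x) \<le> g x * norm (t - s)"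
    proof (rule field_differentiable_bound[where S = "ball s e" and f' = "\<lambda>t. f' t x"])
      fix r assume "r \<in> ball s e"
      then have r: "\<bar>r - s\<bar> < e" by (simp add: dist_real_def)
      show "((\<lambda>t. f t x) has_real_derivative f' r x) (at r within ball s e)"
        using d[OF r that(2)] by (rule has_field_derivative_at_within)
      show "norm (f' r x) \<le> g x" using b[OF r that(2)] by simp
    qed (use that e in \<open>auto simp: dist_real_def\<close>)
    then show ?thesis
      using that b[of s x] e by (cases "t = s") (auto simp: field_simps)
  qed
  have seq: "(\<lambda>i. ((\<integral>x. f (X i) x \<partial>M) - (\<integral>x. f s x \<partial>M)) / (X i - s)) \<longlonglongrightarrow> (\<integral>x. f' s x \<partial>M) \<and> integrable M (f' s)"
    if X: "\<And>i. X i \<noteq> s" "\<And>i. \<bar>X i - s\<bar> < e" "X \<longlonglongrightarrow> s" for X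
  proof -
    have lim: "(\<lambda>i. (f (X i) x - f s x) / (X i - s)) \<longlonglongrightarrow> f' s x" if "x \<in> space M" for x
    proof -
      have "((\<lambda>t. (f t x - f s x) / (t - s)) \<longlongrightarrow> f' s x) (at s)"
        using d[of s x] that e by (simp add: has_field_derivative_iff)
      moreover have "filterlim X (at s) sequentially"
        using X by (auto simp: filterlim_at)
      ultimately show ?thesis by (rule filterlim_compose)
    qed
    have m: "(\<lambda>x. (f (X i) x - f s x) / (X i - s)) \<in> borel_measurable M" for i
      using int[OF X(2)[of i]] int[of s] e by auto
    have m': "f' s \<in> borel_measurable M"
      by (rule borel_measurable_LIMSEQ_real[OF lim m])
    have bd: "AE x in M. norm ((f (X i) x - f s x) / (X i - s)) \<le> g x" for i
      using q[OF X(2)[of i]] by (auto simp del: abs_divide)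
    have l: "AE x in M. (\<lambda>i. (f (X i) x - f s x) / (X i - s)) \<longlonglongrightarrow> f' s x"
      using lim by auto
    have eq: "(\<integral>x. (f (X i) x - f s x) / (X i - s) \<partial>M) = ((\<integral>x. f (X i) x \<partial>M) - (\<integral>x. f s x \<partial>M)) / (X i - s)" for i
      using int[OF X(2)[of i]] int[of s] e by simp
    show ?thesis
      using integral_dominated_convergence[OF m' m g l bd] integrable_dominated_convergence[OF m' m g l bd]
      unfolding eq by blast
  qed
  \<comment> \<open>One concrete admissible sequence, from which the integrability of
    \<open>f' s\<close> is read off.\<close>
  have "(\<lambda>i. s + e / 2 / real (Suc i)) \<longlonglongrightarrow> s + 0"
    by (rule tendsto_add[OF tendsto_const real_tendsto_divide_at_top[OF tendsto_const
        filterlim_compose[OF filterlim_real_sequentially filterlim_Suc]]])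
  moreover have "\<bar>e / 2 / real (Suc i)\<bar> < e" for i
    using e by (auto simp: divide_simps)
  ultimately show "integrable M (f' s)"
    using seq[of "\<lambda>i. s + e / 2 / real (Suc i)"] e by auto
  show "((\<lambda>t. \<integral>x. f t x \<partial>M) has_real_derivative (\<integral>x. f' s x \<partial>M)) (at s)"
    unfolding has_field_derivative_iff tendsto_at_iff_sequentially
  proof (intro allI impI)
    fix X assume X: "\<forall>i. X i \<in> UNIV - {s}" "X \<longlonglongrightarrow> s"
    \<comment> \<open>\<open>seq\<close> asks for the bound e at every index, while X satisfies it
      only eventually; the early terms are replaced by the admissible value s + e/2.\<close>
    define Y where "Y i = (if \<bar>X i - s\<bar> < e then X i else s + e / 2)" for i
    have ev: "\<forall>\<^sub>F i in sequentially. \<bar>X i - s\<bar> < e"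
      using tendstoD[OF X(2) e] by (simp add: dist_real_def)
    then have XY: "\<forall>\<^sub>F i in sequentially. X i = Y i"
      by eventually_elim (simp add: Y_def)
    have "Y \<longlonglongrightarrow> s"
      using X(2) XY by (simp add: tendsto_cong)
    then have "(\<lambda>i. ((\<integral>x. f (Y i) x \<partial>M) - (\<integral>x. f s x \<partial>M)) / (Y i - s)) \<longlonglongrightarrow> (\<integral>x. f' s x \<partial>M)"
      using X(1) e seq[of Y] by (auto simp: Y_def)
    moreover have "\<forall>\<^sub>F i in sequentially. ((\<integral>x. f (Y i) x \<partial>M) - (\<integral>x. f s x \<partial>M)) / (Y i - s) =
        ((\<lambda>t. ((\<integral>x. f t x \<partial>M) - (\<integral>x. f s x \<partial>M)) / (t - s)) \<circ> X) i"
      using XY by eventually_elim simp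
    ultimately show "((\<lambda>t. ((\<integral>x. f t x \<partial>M) - (\<integral>x. f s x \<partial>M)) / (t - s)) \<circ> X) \<longlonglongrightarrow> (\<integral>x. f' s x \<partial>M)"
      by (rule Lim_transform_eventually)
  qed
qed

section \<open>Square integrable functions and mean square convergence\<close>

definition square_integrable :: "'a measure \<Rightarrow> ('a \<Rightarrow> 'b::euclidean_space) \<Rightarrow> bool"
  where "square_integrable M f \<longleftrightarrow> f \<in> borel_measurable M \<and> integrable M (\<lambda>x. (norm (f x))\<^sup>2)"

lemma square_integrable_inner:
  assumes "square_integrable M f" "square_integrable M g"
  shows "integrable M (\<lambda>x. f x \<bullet> g x)"
proof (rule Bochner_Integration.integrable_bound)
  show "integrable M (\<lambda>x. (norm (f x))\<^sup>2 + (norm (g x))\<^sup>2)"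
    using assms by (auto simp: square_integrable_def)
  show "(\<lambda>x. f x \<bullet> g x) \<in> borel_measurable M"
    using assms by (auto simp: square_integrable_def)
  have "\<bar>f x \<bullet> g x\<bar> \<le> (norm (f x))\<^sup>2 + (norm (g x))\<^sup>2" for x
    using Cauchy_Schwarz_ineq2[of "f x" "g x"] sum_squares_bound[of "norm (f x)" "norm (g x)"]
      mult_nonneg_nonneg[OF norm_ge_zero[of "f x"] norm_ge_zero[of "g x"]] by linarith
  then show "AE x in M. norm (f x \<bullet> g x) \<le> norm ((norm (f x))\<^sup>2 + (norm (g x))\<^sup>2)"
    by simp
qed

lemma square_integrable_add:
  assumes "square_integrable M f" "square_integrable M g"
  shows "square_integrable M (\<lambda>x. f x + g x)"
proof -
  have "(norm (f x + g x))\<^sup>2 = (norm (f x))\<^sup>2 + (norm (g x))\<^sup>2 + 2 * (f x \<bullet> g x)" for x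
    by (simp add: power2_norm_eq_inner inner_add inner_commute)
  then show ?thesis
    using assms square_integrable_inner[OF assms] by (auto simp: square_integrable_def)
qed

lemma square_integrable_pointwise:
  assumes f: "square_integrable M f" and Tf: "(\<lambda>x. T x (f x)) \<in> borel_measurable M"
    and bound: "\<And>x v. x \<in> space M \<Longrightarrow> norm (T x v) \<le> C * norm v"
  shows "square_integrable M (\<lambda>x. T x (f x))"
    and "(\<integral>x. (norm (T x (f x)))\<^sup>2 \<partial>M) \<le> C\<^sup>2 * (\<integral>x. (norm (f x))\<^sup>2 \<partial>M)"
proof -
  have le: "(norm (T x (f x)))\<^sup>2 \<le> C\<^sup>2 * (norm (f x))\<^sup>2" if "x \<in> space M" for x
    using power_mono[OF bound[OF that, of "f x"], of 2] by (simp add: power_mult_distrib)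
  show i: "square_integrable M (\<lambda>x. T x (f x))"
    unfolding square_integrable_def
  proof (rule conjI[OF Tf], rule Bochner_Integration.integrable_bound)
    show "integrable M (\<lambda>x. C\<^sup>2 * (norm (f x))\<^sup>2)" using f by (auto simp: square_integrable_def)
    show "AE x in M. norm ((norm (T x (f x)))\<^sup>2) \<le> norm (C\<^sup>2 * (norm (f x))\<^sup>2)"
      using le by (intro AE_I2) simp
  qed (use Tf in measurable)
  have "(\<integral>x. (norm (T x (f x)))\<^sup>2 \<partial>M) \<le> (\<integral>x. C\<^sup>2 * (norm (f x))\<^sup>2 \<partial>M)"
    using i f le by (intro integral_mono) (auto simp: square_integrable_def)
  then show "(\<integral>x. (norm (T x (f x)))\<^sup>2 \<partial>M) \<le> C\<^sup>2 * (\<integral>x. (norm (f x))\<^sup>2 \<partial>M)"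
    by simp
qed

lemma square_integrable_mult:
  assumes "square_integrable M f" "b \<in> borel_measurable M" "\<And>x. x \<in> space M \<Longrightarrow> \<bar>b x\<bar> \<le> C"
  shows "square_integrable M (\<lambda>x. b x *\<^sub>R f x)"
  using assms(1)
proof (rule square_integrable_pointwise(1)[where C = C])
  show "(\<lambda>x. b x *\<^sub>R f x) \<in> borel_measurable M"
    using assms by (auto simp: square_integrable_def)
qed (use assms(3) in \<open>simp add: mult_right_mono\<close>)

lemma square_integrable_cmult:
  "square_integrable M f \<Longrightarrow> square_integrable M (\<lambda>x. c *\<^sub>R f x)"
  by (rule square_integrable_mult[where C = "\<bar>c\<bar>"]) auto

lemma square_integrable_diff:
  "square_integrable M f \<Longrightarrow> square_integrable M g \<Longrightarrow> square_integrable M (\<lambda>x. f x - g x)"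
  using square_integrable_add[OF _ square_integrable_cmult[of M g "-1"]] by simp

lemma integral_inner_Cauchy_Schwarz:
  assumes f: "square_integrable M f" and g: "square_integrable M g"
  shows "(\<integral>x. f x \<bullet> g x \<partial>M)\<^sup>2 \<le> (\<integral>x. (norm (f x))\<^sup>2 \<partial>M) * (\<integral>x. (norm (g x))\<^sup>2 \<partial>M)"
proof -
  define A B C where "A = (\<integral>x. (norm (f x))\<^sup>2 \<partial>M)" "B = (\<integral>x. f x \<bullet> g x \<partial>M)" "C = (\<integral>x. (norm (g x))\<^sup>2 \<partial>M)"
  have fg: "integrable M (\<lambda>x. (norm (f x))\<^sup>2)" "integrable M (\<lambda>x. (norm (g x))\<^sup>2)" "integrable M (\<lambda>x. f x \<bullet> g x)"
    using f g square_integrable_inner[OF f g] by (auto simp: square_integrable_def)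
  have q: "0 \<le> A + 2 * t * B + t\<^sup>2 * C" for t
  proof -
    have "(norm (f x + t *\<^sub>R g x))\<^sup>2 = (norm (f x))\<^sup>2 + 2 * t * (f x \<bullet> g x) + t\<^sup>2 * (norm (g x))\<^sup>2" for x
      by (simp only: power2_norm_eq_inner)
        (simp add: inner_add inner_commute power2_eq_square algebra_simps)
    then have "(\<integral>x. (norm (f x + t *\<^sub>R g x))\<^sup>2 \<partial>M) = A + 2 * t * B + t\<^sup>2 * C"
      using fg by (simp add: A_B_C_def)
    moreover have "0 \<le> (\<integral>x. (norm (f x + t *\<^sub>R g x))\<^sup>2 \<partial>M)" by simp
    ultimately show ?thesis by simp
  qed
  have "0 \<le> C" by (simp add: A_B_C_def)
  show "B\<^sup>2 \<le> A * C"
  proof (cases "C = 0")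
    case True
    have "B = 0"
    proof (rule ccontr)
      assume "B \<noteq> 0"
      \<comment> \<open>At this t the quadratic, which is affine because C = 0, takes the value
        -1.\<close>
      then show False using q[of "- (A + 1) / (2 * B)"] True by (simp add: field_simps)
    qed
    then show ?thesis using True by simp
  next
    case False
    \<comment> \<open>The minimiser of the quadratic; nonnegativity there is the discriminant
      condition.\<close>
    with \<open>0 \<le> C\<close> q[of "- B / C"] show ?thesis
      by (simp add: field_simps power2_eq_square)
  qed
qed

lemma integral_norm2_add_le:
  assumes f: "square_integrable M f" and g: "square_integrable M g"
  shows "(\<integral>x. (norm (f x + g x))\<^sup>2 \<partial>M) \<le> 2 * (\<integral>x. (norm (f x))\<^sup>2 \<partial>M) + 2 * (\<integral>x. (norm (g x))\<^sup>2 \<partial>M)"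
proof -
  have "(norm (f x + g x))\<^sup>2 \<le> 2 * (norm (f x))\<^sup>2 + 2 * (norm (g x))\<^sup>2" for x
  proof -
    have "(norm (f x + g x))\<^sup>2 \<le> (norm (f x) + norm (g x))\<^sup>2"
      by (intro power_mono norm_triangle_ineq) simp
    then show ?thesis
      using sum_squares_bound[of "norm (f x)" "norm (g x)"] by (simp add: power2_sum)
  qed
  then have "(\<integral>x. (norm (f x + g x))\<^sup>2 \<partial>M) \<le> (\<integral>x. 2 * (norm (f x))\<^sup>2 + 2 * (norm (g x))\<^sup>2 \<partial>M)"
    using f g square_integrable_add[OF f g] by (intro integral_mono) (auto simp: square_integrable_def)
  then show ?thesis
    using f g by (simp add: square_integrable_def)
qed

text \<open>Square integrability of every member and of the limit is built in: the Bochner integral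
  of a non-integrable function is 0, so the convergence of the integrals alone would say
  nothing.\<close>

definition L2_tendsto :: "'a measure \<Rightarrow> (nat \<Rightarrow> 'a \<Rightarrow> 'b::euclidean_space) \<Rightarrow> ('a \<Rightarrow> 'b) \<Rightarrow> bool"
  where "L2_tendsto M fs f \<longleftrightarrow> (\<forall>k. square_integrable M (fs k)) \<and> square_integrable M f \<and>
    (\<lambda>k. \<integral>x. (norm (fs k x - f x))\<^sup>2 \<partial>M) \<longlonglongrightarrow> 0"

lemma integral_inner_tendsto_0:
  assumes "\<And>k. square_integrable M (f k)" "\<And>k. square_integrable M (g k)"
    and "(\<lambda>k. (\<integral>x. (norm (f k x))\<^sup>2 \<partial>M) * (\<integral>x. (norm (g k x))\<^sup>2 \<partial>M)) \<longlonglongrightarrow> 0"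
  shows "(\<lambda>k. \<integral>x. f k x \<bullet> g k x \<partial>M) \<longlonglongrightarrow> 0"
proof (rule Lim_null_comparison)
  show "\<forall>\<^sub>F k in sequentially. norm (\<integral>x. f k x \<bullet> g k x \<partial>M) \<le>
      sqrt ((\<integral>x. (norm (f k x))\<^sup>2 \<partial>M) * (\<integral>x. (norm (g k x))\<^sup>2 \<partial>M))"
    using integral_inner_Cauchy_Schwarz[OF assms(1,2)]
    by (intro always_eventually) (auto intro: real_le_rsqrt)
  show "(\<lambda>k. sqrt ((\<integral>x. (norm (f k x))\<^sup>2 \<partial>M) * (\<integral>x. (norm (g k x))\<^sup>2 \<partial>M))) \<longlonglongrightarrow> 0"
    using tendsto_real_sqrt[OF assms(3)] by simp
qed

lemma L2_tendsto_integral_inner: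
  assumes f: "L2_tendsto M fs f" and g: "L2_tendsto M gs g"
  shows "(\<lambda>k. \<integral>x. fs k x \<bullet> gs k x \<partial>M) \<longlonglongrightarrow> (\<integral>x. f x \<bullet> g x \<partial>M)"
proof -
  have i: "square_integrable M (fs k)" "square_integrable M f" "square_integrable M (gs k)" "square_integrable M g" for k
    using f g by (auto simp: L2_tendsto_def)
  note d = square_integrable_diff[OF i(1,2)] square_integrable_diff[OF i(3,4)]
  have f0: "(\<lambda>k. \<integral>x. (norm (fs k x - f x))\<^sup>2 \<partial>M) \<longlonglongrightarrow> 0" and g0: "(\<lambda>k. \<integral>x. (norm (gs k x - g x))\<^sup>2 \<partial>M) \<longlonglongrightarrow> 0"
    using f g by (auto simp: L2_tendsto_def)
  have "(\<integral>x. fs k x \<bullet> gs k x \<partial>M) = (\<integral>x. (fs k x - f x) \<bullet> (gs k x - g x) \<partial>M) +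
      (\<integral>x. (fs k x - f x) \<bullet> g x \<partial>M) + (\<integral>x. f x \<bullet> (gs k x - g x) \<partial>M) + (\<integral>x. f x \<bullet> g x \<partial>M)" for k
    using i d by (simp add: square_integrable_inner flip: Bochner_Integration.integral_add)
      (simp add: inner_diff algebra_simps)
  moreover have "(\<lambda>k. \<integral>x. (fs k x - f x) \<bullet> (gs k x - g x) \<partial>M) \<longlonglongrightarrow> 0"
    using tendsto_mult[OF f0 g0] by (intro integral_inner_tendsto_0 d) simp
  moreover have "(\<lambda>k. \<integral>x. (fs k x - f x) \<bullet> g x \<partial>M) \<longlonglongrightarrow> 0"
    using tendsto_mult[OF f0 tendsto_const[of "\<integral>x. (norm (g x))\<^sup>2 \<partial>M"]] by (intro integral_inner_tendsto_0 d i) simp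
  moreover have "(\<lambda>k. \<integral>x. f x \<bullet> (gs k x - g x) \<partial>M) \<longlonglongrightarrow> 0"
    using tendsto_mult[OF tendsto_const[of "\<integral>x. (norm (f x))\<^sup>2 \<partial>M"] g0] by (intro integral_inner_tendsto_0 d i) simp
  ultimately show ?thesis
    by (auto intro!: tendsto_eq_intros)
qed

text \<open>Covers at once the three fibrewise linear maps applied later: multiplication by a
  bounded function, scaling of a bounded field, and pairing with a bounded field.\<close>

lemma L2_tendsto_pointwise:
  assumes f: "L2_tendsto M fs f"
    and linear: "\<And>x v w. x \<in> space M \<Longrightarrow> T x (v - w) = T x v - T x w"
    and bound: "\<And>x v. x \<in> space M \<Longrightarrow> norm (T x v) \<le> C * norm v"
    and meas: "\<And>g. g \<in> borel_measurable M \<Longrightarrow> (\<lambda>x. T x (g x)) \<in> borel_measurable M"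
  shows "L2_tendsto M (\<lambda>k x. T x (fs k x)) (\<lambda>x. T x (f x))"
  unfolding L2_tendsto_def
proof (intro conjI allI)
  have i: "square_integrable M (fs k)" "square_integrable M f" for k
    using f by (auto simp: L2_tendsto_def)
  show "square_integrable M (\<lambda>x. T x (fs k x))" "square_integrable M (\<lambda>x. T x (f x))" for k
    by (rule square_integrable_pointwise(1)[OF _ meas bound]; use i in \<open>auto simp: square_integrable_def\<close>)+
  have le: "(\<integral>x. (norm (T x (fs k x) - T x (f x)))\<^sup>2 \<partial>M) \<le> C\<^sup>2 * (\<integral>x. (norm (fs k x - f x))\<^sup>2 \<partial>M)" for k
  proof -
    have d: "square_integrable M (\<lambda>x. fs k x - f x)" by (intro square_integrable_diff i)
    then have "(\<integral>x. (norm (T x (fs k x - f x)))\<^sup>2 \<partial>M) \<le> C\<^sup>2 * (\<integral>x. (norm (fs k x - f x))\<^sup>2 \<partial>M)"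
      using bound by (intro square_integrable_pointwise(2) meas) (auto simp: square_integrable_def)
    also have "(\<integral>x. (norm (T x (fs k x - f x)))\<^sup>2 \<partial>M) = (\<integral>x. (norm (T x (fs k x) - T x (f x)))\<^sup>2 \<partial>M)"
      using linear by (intro Bochner_Integration.integral_cong) auto
    finally show ?thesis .
  qed
  show "(\<lambda>k. \<integral>x. (norm (T x (fs k x) - T x (f x)))\<^sup>2 \<partial>M) \<longlonglongrightarrow> 0"
  proof (rule Lim_null_comparison)
    show "\<forall>\<^sub>F k in sequentially. norm (\<integral>x. (norm (T x (fs k x) - T x (f x)))\<^sup>2 \<partial>M) \<le>
        C\<^sup>2 * (\<integral>x. (norm (fs k x - f x))\<^sup>2 \<partial>M)"
      using le by (intro always_eventually) simp
    show "(\<lambda>k. C\<^sup>2 * (\<integral>x. (norm (fs k x - f x))\<^sup>2 \<partial>M)) \<longlonglongrightarrow> 0"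
      using f by (auto simp: L2_tendsto_def intro: tendsto_mult_right_zero)
  qed
qed

lemma L2_tendsto_mult:
  assumes "L2_tendsto M fs f" "b \<in> borel_measurable M" "\<And>x. x \<in> space M \<Longrightarrow> \<bar>b x\<bar> \<le> C"
  shows "L2_tendsto M (\<lambda>k x. b x *\<^sub>R fs k x) (\<lambda>x. b x *\<^sub>R f x)"
  using assms(1) by (rule L2_tendsto_pointwise[where C = C])
    (use assms in \<open>auto simp: scaleR_diff_right intro: mult_right_mono\<close>)

lemma L2_tendsto_scaleR:
  fixes f :: "'a \<Rightarrow> real" and b :: "'a \<Rightarrow> 'b::euclidean_space"
  assumes "L2_tendsto M fs f" "b \<in> borel_measurable M" "\<And>x. x \<in> space M \<Longrightarrow> norm (b x) \<le> C"
  shows "L2_tendsto M (\<lambda>k x. fs k x *\<^sub>R b x) (\<lambda>x. f x *\<^sub>R b x)"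
  using assms(1) by (rule L2_tendsto_pointwise[where C = C])
    (use assms in \<open>auto simp: scaleR_diff_left mult.commute[of C] intro: mult_left_mono\<close>)

lemma L2_tendsto_inner:
  fixes f :: "'a \<Rightarrow> 'b::euclidean_space"
  assumes "L2_tendsto M fs f" "b \<in> borel_measurable M" "\<And>x. x \<in> space M \<Longrightarrow> norm (b x) \<le> C"
  shows "L2_tendsto M (\<lambda>k x. fs k x \<bullet> b x) (\<lambda>x. f x \<bullet> b x)"
  using assms(1)
proof (rule L2_tendsto_pointwise[where C = C])
  show "norm (v \<bullet> b x) \<le> C * norm v" if "x \<in> space M" for x v
    using Cauchy_Schwarz_ineq2[of v "b x"] mult_left_mono[OF assms(3)[OF that] norm_ge_zero[of v]]
    by (simp add: mult.commute)
qed (use assms(2) in \<open>auto simp: inner_diff\<close>)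

lemma L2_tendsto_add:
  assumes f: "L2_tendsto M fs f" and g: "L2_tendsto M gs g"
  shows "L2_tendsto M (\<lambda>k x. fs k x + gs k x) (\<lambda>x. f x + g x)"
  unfolding L2_tendsto_def
proof (intro conjI allI)
  have i: "square_integrable M (fs k)" "square_integrable M f" "square_integrable M (gs k)" "square_integrable M g" for k
    using f g by (auto simp: L2_tendsto_def)
  show "square_integrable M (\<lambda>x. fs k x + gs k x)" "square_integrable M (\<lambda>x. f x + g x)" for k
    by (intro square_integrable_add i)+
  show "(\<lambda>k. \<integral>x. (norm (fs k x + gs k x - (f x + g x)))\<^sup>2 \<partial>M) \<longlonglongrightarrow> 0"
  proof (rule Lim_null_comparison)
    show "\<forall>\<^sub>F k in sequentially. norm (\<integral>x. (norm (fs k x + gs k x - (f x + g x)))\<^sup>2 \<partial>M) \<le>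
        2 * (\<integral>x. (norm (fs k x - f x))\<^sup>2 \<partial>M) + 2 * (\<integral>x. (norm (gs k x - g x))\<^sup>2 \<partial>M)"
      using integral_norm2_add_le[OF square_integrable_diff[OF i(1,2)] square_integrable_diff[OF i(3,4)]]
      by (intro always_eventually) (simp add: algebra_simps)
    show "(\<lambda>k. 2 * (\<integral>x. (norm (fs k x - f x))\<^sup>2 \<partial>M) + 2 * (\<integral>x. (norm (gs k x - g x))\<^sup>2 \<partial>M)) \<longlonglongrightarrow> 0"
      using f g by (auto simp: L2_tendsto_def intro!: tendsto_add_zero tendsto_mult_right_zero)
  qed
qed

lemma L2_tendsto_diff:
  assumes f: "L2_tendsto M fs f" and g: "L2_tendsto M gs g"
  shows "L2_tendsto M (\<lambda>k x. fs k x - gs k x) (\<lambda>x. f x - g x)"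
  using L2_tendsto_add[OF f L2_tendsto_mult[OF g, where b = "\<lambda>_. - 1" and C = 1]] by simp

lemma square_integrable_iff_nn_integral:
  "square_integrable M f \<longleftrightarrow> f \<in> borel_measurable M \<and> (\<integral>\<^sup>+x. ennreal ((norm (f x))\<^sup>2) \<partial>M) < \<infinity>"
  by (auto simp: square_integrable_def integrable_iff_bounded)

text \<open>The bridge to the Sobolev distance, which is a nonnegative integral. If these integrals
  tend to 0, some member lies at squared distance below 1 from f, so f is the difference of two
  square integrable functions.\<close>

lemma L2_tendsto_iff_nn_integral:
  assumes fs: "\<And>k. square_integrable M (fs k)"
  shows "L2_tendsto M fs f \<longleftrightarrow>
    f \<in> borel_measurable M \<and> (\<lambda>k. \<integral>\<^sup>+x. ennreal ((norm (fs k x - f x))\<^sup>2) \<partial>M) \<longlonglongrightarrow> 0"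
proof -
  have eq: "(\<lambda>k. \<integral>\<^sup>+x. ennreal ((norm (fs k x - f x))\<^sup>2) \<partial>M) \<longlonglongrightarrow> 0 \<longleftrightarrow>
      (\<lambda>k. \<integral>x. (norm (fs k x - f x))\<^sup>2 \<partial>M) \<longlonglongrightarrow> 0" if "square_integrable M f"
  proof -
    have "(\<integral>\<^sup>+x. ennreal ((norm (fs k x - f x))\<^sup>2) \<partial>M) = ennreal (\<integral>x. (norm (fs k x - f x))\<^sup>2 \<partial>M)" for k
      using square_integrable_diff[OF fs[of k] that]
      by (intro nn_integral_eq_integral) (auto simp: square_integrable_def)
    then show ?thesis
      by (simp add: ennreal_tendsto_0_iff)
  qed
  have "square_integrable M f"
    if f: "f \<in> borel_measurable M" and lim: "(\<lambda>k. \<integral>\<^sup>+x. ennreal ((norm (fs k x - f x))\<^sup>2) \<partial>M) \<longlonglongrightarrow> 0"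
  proof -
    have "\<forall>\<^sub>F k in sequentially. (\<integral>\<^sup>+x. ennreal ((norm (fs k x - f x))\<^sup>2) \<partial>M) < 1"
      using order_tendstoD(2)[OF lim, of 1] by simp
    then obtain k where "(\<integral>\<^sup>+x. ennreal ((norm (fs k x - f x))\<^sup>2) \<partial>M) < 1"
      using eventually_happens by force
    then have "square_integrable M (\<lambda>x. fs k x - f x)"
      using f fs[of k] order.strict_trans[OF _ ennreal_one_less_top]
      by (auto simp: square_integrable_iff_nn_integral)
    from square_integrable_diff[OF fs[of k] this] show ?thesis by simp
  qed
  then show ?thesis
    using eq fs by (auto simp: L2_tendsto_def square_integrable_def[of M f])
qed

lemma square_integrable_bounded:
  fixes f :: "'a \<Rightarrow> 'b::euclidean_space"
  assumes "finite_measure M" "f \<in> borel_measurable M" "\<And>x. x \<in> space M \<Longrightarrow> norm (f x) \<le> C"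
  shows "square_integrable M f"
proof -
  interpret finite_measure M by fact
  have "\<bar>(norm (f x))\<^sup>2\<bar> \<le> C\<^sup>2" if "x \<in> space M" for x
    using assms(3)[OF that] by (simp add: power_mono)
  then have "integrable M (\<lambda>x. (norm (f x))\<^sup>2)"
    using assms(2) by (intro integrable_const_bound[where B = "C\<^sup>2"]) auto
  then show ?thesis using assms(2) by (simp add: square_integrable_def)
qed

section \<open>Homogeneous measures on cones\<close>

lemma nn_integral_lebesgue_scale:
  fixes f :: "'a::euclidean_space \<Rightarrow> ennreal"
  assumes f [measurable]: "f \<in> borel_measurable lebesgue" and c: "0 < c"
  shows "(\<integral>\<^sup>+x. f x \<partial>lebesgue) = ennreal (c ^ DIM('a)) * (\<integral>\<^sup>+x. f (c *\<^sub>R x) \<partial>lebesgue)"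
proof -
  define T :: "'a \<Rightarrow> 'a" where "T x = 0 + (\<Sum>j\<in>Basis. (c * (x \<bullet> j)) *\<^sub>R j)" for x
  have T: "T x = c *\<^sub>R x" for x
    using euclidean_representation[of x] by (simp add: T_def flip: scaleR_scaleR scaleR_sum_right)
  have leb: "lebesgue = density (distr lebesgue lebesgue T) (\<lambda>_. (\<Prod>j\<in>(Basis :: 'a set). \<bar>c\<bar>))"
    unfolding T_def using c lebesgue_affine_euclidean[of "\<lambda>_. c" "0::'a"] by simp
  have Tm [measurable]: "T \<in> lebesgue \<rightarrow>\<^sub>M lebesgue"
    unfolding T_def using c lebesgue_affine_measurable[of "\<lambda>_. c" "0::'a"] by simp
  have "(\<integral>\<^sup>+x. f x \<partial>lebesgue) = (\<integral>\<^sup>+x. f x \<partial>density (distr lebesgue lebesgue T) (\<lambda>_. (\<Prod>j\<in>(Basis :: 'a set). \<bar>c\<bar>)))"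
    using leb by simp
  also have "\<dots> = (\<integral>\<^sup>+x. ennreal (c ^ DIM('a)) * f (T x) \<partial>lebesgue)"
    using c by (simp add: nn_integral_density nn_integral_distr)
  also have "\<dots> = ennreal (c ^ DIM('a)) * (\<integral>\<^sup>+x. f (T x) \<partial>lebesgue)"
    by (intro nn_integral_cmult) measurable
  finally show ?thesis by (simp add: T)
qed

text \<open>Substituting c x contributes c^dim from Lebesgue measure and c^\<alpha> from the weight;
  the exponent becomes negative because the measure is pushed forward.\<close>

lemma distr_scale_homogeneous:
  fixes w :: "'a::euclidean_space \<Rightarrow> real"
    and \<alpha> :: real
  assumes w [measurable]: "w \<in> borel_measurable borel" and hom: "\<And>x. w (c *\<^sub>R x) = c powr \<alpha> * w x"
    and nonneg: "\<And>x. 0 \<le> w x" and c: "0 < c"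
  defines "M \<equiv> density lebesgue (\<lambda>x. ennreal (w x))"
  shows "distr M lebesgue ((*\<^sub>R) c) = density M (\<lambda>_. ennreal (c powr - (real DIM('a) + \<alpha>)))"
proof (rule measure_eqI)
  fix A assume "A \<in> sets (distr M lebesgue ((*\<^sub>R) c))"
  then have A [measurable]: "A \<in> sets lebesgue" by simp
  have sM [measurable_cong]: "sets M = sets lebesgue" by (simp add: M_def)
  have wl [measurable]: "w \<in> borel_measurable lebesgue"
    using w by (intro measurable_completion) simp
  have "emeasure (density M (\<lambda>_. ennreal (c powr - (real DIM('a) + \<alpha>)))) A =
      ennreal (c powr - (real DIM('a) + \<alpha>)) * (\<integral>\<^sup>+x. ennreal (w x) * indicator A x \<partial>lebesgue)"
    by (simp add: emeasure_density nn_integral_cmult M_def nn_integral_density mult.assoc mult.left_commute flip: nn_integral_cmult)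
  also have "(\<integral>\<^sup>+x. ennreal (w x) * indicator A x \<partial>lebesgue) =
      ennreal (c ^ DIM('a)) * (\<integral>\<^sup>+x. ennreal (w (c *\<^sub>R x)) * indicator A (c *\<^sub>R x) \<partial>lebesgue)"
    using c by (intro nn_integral_lebesgue_scale) auto
  also have "(\<integral>\<^sup>+x. ennreal (w (c *\<^sub>R x)) * indicator A (c *\<^sub>R x) \<partial>lebesgue) =
      (\<integral>\<^sup>+x. ennreal (c powr \<alpha>) * (ennreal (w x) * indicator A (c *\<^sub>R x)) \<partial>lebesgue)"
    by (simp add: hom ennreal_mult nonneg mult.assoc)
  also have "\<dots> = ennreal (c powr \<alpha>) * (\<integral>\<^sup>+x. ennreal (w x) * indicator A (c *\<^sub>R x) \<partial>lebesgue)"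
    by (intro nn_integral_cmult) measurable
  also have "ennreal (c powr - (real DIM('a) + \<alpha>)) * (ennreal (c ^ DIM('a)) * (ennreal (c powr \<alpha>) *
      (\<integral>\<^sup>+x. ennreal (w x) * indicator A (c *\<^sub>R x) \<partial>lebesgue))) =
      (\<integral>\<^sup>+x. ennreal (w x) * indicator A (c *\<^sub>R x) \<partial>lebesgue)"
  proof -
    have "c powr - (real DIM('a) + \<alpha>) * (c ^ DIM('a) * c powr \<alpha>) = 1"
      using c by (simp add: powr_realpow[symmetric] flip: powr_add)
    then have "ennreal (c powr - (real DIM('a) + \<alpha>)) * (ennreal (c ^ DIM('a)) * ennreal (c powr \<alpha>)) = 1"
      using c by (simp flip: ennreal_mult)
    then show ?thesis by (simp flip: mult.assoc)
  qed
  also have "\<dots> = emeasure M ((*\<^sub>R) c -` A)"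
    using measurable_sets[OF lebesgue_measurable_scaling[of c] A]
    by (simp add: M_def emeasure_density indicator_vimage)
  also have "\<dots> = emeasure (distr M lebesgue ((*\<^sub>R) c)) A"
    using A by (subst emeasure_distr) (auto simp: M_def)
  finally show "emeasure (distr M lebesgue ((*\<^sub>R) c)) A =
      emeasure (density M (\<lambda>_. ennreal (c powr - (real DIM('a) + \<alpha>)))) A" by simp
qed (simp add: M_def)

text \<open>The truncation at squared radius s keeps t x inside the unit ball, where f is
  controlled, as long as t^2 s is at most 1. Integrands that vanish beyond s, in particular those
  carrying a cutoff, do not see it.\<close>

definition dilate :: "real \<Rightarrow> real \<Rightarrow> ('a::real_inner \<Rightarrow> 'b) \<Rightarrow> 'a \<Rightarrow> 'b::euclidean_space"
  where "dilate s t f x = (if x \<bullet> x < s then f (t *\<^sub>R x) else 0)"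

text \<open>Treats together the two measures that scale: y^a dx dy on the half-ball with q = N + 1 +
  a, and Lebesgue measure on the flat ball with q = N. The set S is a cone truncated by the unit
  ball, so membership is compared along a ray only while the farther point t x stays in the
  ball.\<close>

locale conic_measure =
  fixes M :: "'a::euclidean_space measure" and S :: "'a set" and q :: real
  assumes sets_M: "sets M = sets lebesgue"
    and distr_scale: "\<And>c. 0 < c \<Longrightarrow> distr M lebesgue ((*\<^sub>R) c) = density M (\<lambda>_. ennreal (c powr - q))"
    and S: "S \<in> sets lebesgue" "S \<subseteq> ball 0 1"
    and cone: "\<And>t x. 1 \<le> t \<Longrightarrow> norm (t *\<^sub>R x) < 1 \<Longrightarrow> t *\<^sub>R x \<in> S \<longleftrightarrow> x \<in> S"
    and emeasure_cball_finite: "\<And>r. emeasure M (cball 0 r) < \<infinity>"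
    and q_nonneg: "0 \<le> q"
begin

abbreviation R :: "'a measure"
  where "R \<equiv> restrict_space M S"

lemma space_M [simp]: "space M = UNIV"
  using sets_eq_imp_space_eq[OF sets_M] by simp

lemma measurable_M: "measurable M N = measurable lebesgue N"
  by (rule measurable_cong_sets) (simp_all add: sets_M)

lemma space_R [simp]: "space R = S"
  by (simp add: space_restrict_space)

lemma norm_less_1: "x \<in> S \<Longrightarrow> norm x < 1"
  using S(2) by auto

lemma borel_measurable_M: "f \<in> borel_measurable borel \<Longrightarrow> f \<in> borel_measurable M"
  unfolding measurable_M by (intro measurable_completion) simp

lemma borel_measurable_R: "f \<in> borel_measurable borel \<Longrightarrow> f \<in> borel_measurable R"
  by (intro measurable_restrict_space1 borel_measurable_M)

lemma finite_measure_R: "finite_measure R"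
proof
  have "emeasure R S = emeasure M S"
    using S by (subst emeasure_restrict_space) (auto simp: sets_M)
  also have "\<dots> \<le> emeasure M (cball 0 1)"
    using S(2) by (intro emeasure_mono) (auto simp: sets_M)
  finally show "emeasure R (space R) \<noteq> \<infinity>"
    using emeasure_cball_finite[of 1] by (auto simp: top_unique)
qed

lemma square_integrable_continuous:
  fixes f :: "'a \<Rightarrow> 'b::euclidean_space"
  assumes "continuous_on UNIV f"
  shows "square_integrable R f"
proof -
  have "compact (f ` cball 0 1)"
    using assms by (intro compact_continuous_image) (auto intro: continuous_on_subset)
  then obtain C where C: "\<And>x. x \<in> cball 0 1 \<Longrightarrow> norm (f x) \<le> C"
    by (meson bounded_iff compact_imp_bounded imageI)
  show ?thesis
  proof (rule square_integrable_bounded[OF finite_measure_R])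
    show "f \<in> borel_measurable R"
      using assms by (intro borel_measurable_R borel_measurable_continuous_onI)
    show "norm (f x) \<le> C" if "x \<in> space R" for x
      using C[of x] S(2) that by auto
  qed
qed

lemma
  fixes f :: "'a \<Rightarrow> real"
  assumes f: "f \<in> borel_measurable M" and c: "0 < c"
  shows integral_scale: "(\<integral>z. f (c *\<^sub>R z) \<partial>M) = c powr - q * (\<integral>z. f z \<partial>M)"
    and integrable_scale: "integrable M f \<Longrightarrow> integrable M (\<lambda>z. f (c *\<^sub>R z))"
proof -
  have m: "(*\<^sub>R) c \<in> M \<rightarrow>\<^sub>M lebesgue" and f': "f \<in> borel_measurable lebesgue"
    using f by (auto simp: measurable_M)
  have "(\<integral>z. f (c *\<^sub>R z) \<partial>M) = (\<integral>z. f z \<partial>distr M lebesgue ((*\<^sub>R) c))"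
    using integral_distr[OF m f'] by simp
  also have "\<dots> = c powr - q * (\<integral>z. f z \<partial>M)"
    unfolding distr_scale[OF c] using f by (subst integral_density) auto
  finally show "(\<integral>z. f (c *\<^sub>R z) \<partial>M) = c powr - q * (\<integral>z. f z \<partial>M)" .
  assume i: "integrable M f"
  have "integrable (distr M lebesgue ((*\<^sub>R) c)) f"
    unfolding distr_scale[OF c] using f i by (subst integrable_density) auto
  then show "integrable M (\<lambda>z. f (c *\<^sub>R z))"
    using integrable_distr_eq[OF m f'] by simp
qed

lemma borel_measurable_R_iff:
  fixes f :: "'a \<Rightarrow> 'b::real_normed_vector"
  shows "f \<in> borel_measurable R \<longleftrightarrow> (\<lambda>x. indicator S x *\<^sub>R f x) \<in> borel_measurable M"
  using S by (intro borel_measurable_restrict_space_iff) (auto simp: sets_M)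

text \<open>The factor b vanishes wherever t x leaves the unit ball; elsewhere x and t x belong to S
  simultaneously, and h may be extended by 0 before it is dilated.\<close>

lemma measurable_scaled:
  fixes h :: "'a \<Rightarrow> 'b::euclidean_space"
  assumes h: "h \<in> borel_measurable R" and b: "b \<in> borel_measurable borel"
    and vanish: "\<And>x. 1 \<le> norm (t *\<^sub>R x) \<Longrightarrow> b x = 0" and t: "1 \<le> t"
  shows "(\<lambda>x. b x *\<^sub>R h (t *\<^sub>R x)) \<in> borel_measurable R"
proof -
  have "(\<lambda>x. indicator S x *\<^sub>R h x) \<in> borel_measurable lebesgue"
    using h by (simp add: borel_measurable_R_iff measurable_M)
  from measurable_compose[OF lebesgue_measurable_scaling[of t] this]
  have m: "(\<lambda>x. indicator S (t *\<^sub>R x) *\<^sub>R h (t *\<^sub>R x)) \<in> borel_measurable M"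
    by (simp add: measurable_M)
  have eq: "indicator S x *\<^sub>R b x *\<^sub>R h (t *\<^sub>R x) = b x *\<^sub>R (indicator S (t *\<^sub>R x) *\<^sub>R h (t *\<^sub>R x))" for x
    using cone[OF t, of x] vanish[of x] by (cases "norm (t *\<^sub>R x) < 1") (auto simp: indicator_def)
  show ?thesis
    unfolding borel_measurable_R_iff eq using m borel_measurable_M[OF b] by measurable
qed

lemma
  fixes f :: "'a \<Rightarrow> real"
  assumes f: "integrable R f" and vanish: "\<And>x. 1 \<le> norm x \<Longrightarrow> f x = 0" and t: "1 \<le> t"
  shows integrable_scaled: "integrable R (\<lambda>x. f (t *\<^sub>R x))"
    and integral_scaled: "(\<integral>x. f (t *\<^sub>R x) \<partial>R) = t powr - q * (\<integral>x. f x \<partial>R)"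
proof -
  have SM: "S \<inter> space M \<in> sets M" using S by (simp add: sets_M)
  have eq: "indicator S x *\<^sub>R f (t *\<^sub>R x) = indicator S (t *\<^sub>R x) *\<^sub>R f (t *\<^sub>R x)" for x
    using cone[OF t, of x] vanish[of "t *\<^sub>R x"] by (cases "norm (t *\<^sub>R x) < 1") (auto simp: indicator_def)
  have i: "integrable M (\<lambda>x. indicator S x *\<^sub>R f x)"
    using f SM by (simp add: integrable_restrict_space)
  then have m: "(\<lambda>x. indicator S x *\<^sub>R f x) \<in> borel_measurable M" by auto
  show "integrable R (\<lambda>x. f (t *\<^sub>R x))"
    unfolding integrable_restrict_space[OF SM] eq using integrable_scale[OF m _ i, of t] t by simp
  show "(\<integral>x. f (t *\<^sub>R x) \<partial>R) = t powr - q * (\<integral>x. f x \<partial>R)"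
    unfolding integral_restrict_space[OF SM] eq using integral_scale[OF m, of t] t by simp
qed

text \<open>Scaling multiplies the integral by t^(-q), which is at most 1 for t >= 1 and q >= 0.
  Dilations are therefore contractions in mean square, with a bound independent of t.\<close>

lemma square_integrable_dilate:
  assumes g: "square_integrable R g" and t: "1 \<le> t" and s: "t\<^sup>2 * s \<le> 1"
  shows "square_integrable R (dilate s t g)"
    and "(\<integral>x. (norm (dilate s t g x))\<^sup>2 \<partial>R) \<le> (\<integral>x. (norm (g x))\<^sup>2 \<partial>R)"
proof -
  have small: "norm (t *\<^sub>R x) < 1" if "x \<bullet> x < s" for x
  proof -
    have "(norm (t *\<^sub>R x))\<^sup>2 = t\<^sup>2 * (x \<bullet> x)"
      by (simp add: power_mult_distrib power2_norm_eq_inner)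
    also have "\<dots> < t\<^sup>2 * s" using that t by simp
    finally show ?thesis using s by (smt (verit) one_power2 power_mono)
  qed
  have "(\<lambda>x. (if x \<bullet> x < s then 1 else 0) *\<^sub>R g (t *\<^sub>R x)) \<in> borel_measurable R"
    by (rule measurable_scaled) (use g t small in \<open>force simp: square_integrable_def\<close>)+
  then have m: "dilate s t g \<in> borel_measurable R"
    by (rule measurable_cong[THEN iffD1, rotated]) (simp add: dilate_def)
  \<comment> \<open>The threshold t^2 s is chosen so that f (t x) is the squared norm of the
    dilation truncated at s.\<close>
  define f where "f x = (if x \<bullet> x < t\<^sup>2 * s then (norm (g x))\<^sup>2 else 0)" for x
  have gi: "integrable R (\<lambda>x. (norm (g x))\<^sup>2)" "g \<in> borel_measurable R" using g by (auto simp: square_integrable_def)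
  have fm: "f \<in> borel_measurable R"
  proof -
    have "(\<lambda>x. (if x \<bullet> x < t\<^sup>2 * s then 1 else 0) * (norm (g x))\<^sup>2) \<in> borel_measurable R"
    proof (rule borel_measurable_times)
      show "(\<lambda>x. if x \<bullet> x < t\<^sup>2 * s then 1 else (0::real)) \<in> borel_measurable R"
        by (rule borel_measurable_R) measurable
    qed (use gi(2) in measurable)
    then show ?thesis
      by (rule measurable_cong[THEN iffD1, rotated]) (simp add: f_def)
  qed
  have fi: "integrable R f"
    by (rule Bochner_Integration.integrable_bound[OF gi(1) fm]) (auto simp: f_def)
  have fv: "f x = 0" if "1 \<le> norm x" for x
  proof -
    have "1 \<le> x \<bullet> x" using that by (simp add: norm_eq_sqrt_inner)
    then show ?thesis using s by (simp add: f_def)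
  qed
  have f: "f (t *\<^sub>R x) = (norm (dilate s t g x))\<^sup>2" for x
    using t by (simp add: f_def dilate_def power2_eq_square mult.assoc[symmetric])
  show "square_integrable R (dilate s t g)"
    using m integrable_scaled[OF fi fv t] by (simp add: square_integrable_def f)
  have "(\<integral>x. (norm (dilate s t g x))\<^sup>2 \<partial>R) = t powr - q * (\<integral>x. f x \<partial>R)"
    using integral_scaled[OF fi fv t] by (simp add: f)
  also have "\<dots> \<le> 1 * (\<integral>x. f x \<partial>R)"
    using t q_nonneg by (intro mult_right_mono) (auto simp: f_def powr_minus_divide ge_one_powr_ge_zero divide_le_eq_1)
  also have "\<dots> \<le> (\<integral>x. (norm (g x))\<^sup>2 \<partial>R)"
    using fi gi by (simp, intro integral_mono) (auto simp: f_def)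
  finally show "(\<integral>x. (norm (dilate s t g x))\<^sup>2 \<partial>R) \<le> (\<integral>x. (norm (g x))\<^sup>2 \<partial>R)" .
qed

lemma L2_tendsto_dilate:
  assumes g: "L2_tendsto R gs g" and t: "1 \<le> t" and s: "t\<^sup>2 * s \<le> 1"
  shows "L2_tendsto R (\<lambda>k. dilate s t (gs k)) (dilate s t g)"
  unfolding L2_tendsto_def
proof (intro conjI allI)
  have i: "square_integrable R (gs k)" "square_integrable R g" for k
    using g by (auto simp: L2_tendsto_def)
  show "square_integrable R (dilate s t (gs k))" "square_integrable R (dilate s t g)" for k
    using square_integrable_dilate(1)[OF i(1) t s] square_integrable_dilate(1)[OF i(2) t s] .
  show "(\<lambda>k. \<integral>x. (norm (dilate s t (gs k) x - dilate s t g x))\<^sup>2 \<partial>R) \<longlonglongrightarrow> 0"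
  proof (rule Lim_null_comparison)
    have "dilate s t (gs k) x - dilate s t g x = dilate s t (\<lambda>x. gs k x - g x) x" for k x
      by (simp add: dilate_def)
    then show "\<forall>\<^sub>F k in sequentially. norm (\<integral>x. (norm (dilate s t (gs k) x - dilate s t g x))\<^sup>2 \<partial>R) \<le>
        (\<integral>x. (norm (gs k x - g x))\<^sup>2 \<partial>R)"
      using square_integrable_dilate(2)[OF square_integrable_diff[OF i] t s]
      by (intro always_eventually) simp
    show "(\<lambda>k. \<integral>x. (norm (gs k x - g x))\<^sup>2 \<partial>R) \<longlonglongrightarrow> 0"
      using g by (simp add: L2_tendsto_def)
  qed
qed

lemma integrable_mult_cutoff:
  assumes f: "integrable R f"
  shows "integrable R (\<lambda>x. f x * cutoff m t x)"
proof (rule Bochner_Integration.integrable_bound)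
  show "integrable R (\<lambda>x. fact m * f x)" using f by simp
  have "cutoff m t \<in> borel_measurable R" by (intro borel_measurable_R) simp
  then show "(\<lambda>x. f x * cutoff m t x) \<in> borel_measurable R"
    using f by (intro borel_measurable_times) auto
  show "AE x in R. norm (f x * cutoff m t x) \<le> norm (fact m * f x)"
    by (auto simp: abs_mult cutoff_le_fact mult.commute[of "fact m"] intro!: mult_left_mono)
qed

lemma DERIV_integral_cutoff:
  assumes f: "integrable R f" and s: "0 < s"
  shows "((\<lambda>s. \<integral>x. f x * cutoff m s x \<partial>R) has_real_derivative
    (\<integral>x. f x * (cutoff' m s x * ((x \<bullet> x) / s\<^sup>2)) \<partial>R)) (at s)"
proof (rule has_real_derivative_integral(1)[where e = "s / 2"])
  define C where "C = fact (m + 2) + real m * fact (m + 1)"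
  show "integrable R (\<lambda>x. f x * cutoff m t x)" for t
    using f by (rule integrable_mult_cutoff)
  \<comment> \<open>The radius s/2 keeps t above s/2, so that the factor 1/t^2 in the derivative
    stays bounded.\<close>
  fix t x assume t: "\<bar>t - s\<bar> < s / 2"
  then have t0: "s / 2 < t" "0 < t" using s by (auto simp: abs_if split: if_splits)
  show "((\<lambda>t. f x * cutoff m t x) has_real_derivative f x * (cutoff' m t x * ((x \<bullet> x) / t\<^sup>2))) (at t)"
    by (rule DERIV_cmult[OF DERIV_cutoff_param[OF t0(2)]])
  assume x: "x \<in> space R"
  then have "x \<bullet> x \<le> 1"
    using norm_less_1[of x] by (simp add: norm_eq_sqrt_inner)
  moreover have "(s / 2)\<^sup>2 \<le> t\<^sup>2" using t0 s by (intro power_mono) auto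
  ultimately have "(x \<bullet> x) / t\<^sup>2 \<le> 1 / (s / 2)\<^sup>2"
    using s by (intro frac_le) auto
  then have "\<bar>cutoff' m t x\<bar> * ((x \<bullet> x) / t\<^sup>2) \<le> C * (1 / (s / 2)\<^sup>2)"
    unfolding C_def by (intro mult_mono abs_cutoff'_le) auto
  then have "\<bar>f x\<bar> * (\<bar>cutoff' m t x\<bar> * ((x \<bullet> x) / t\<^sup>2)) \<le> \<bar>f x\<bar> * (C * (1 / (s / 2)\<^sup>2))"
    by (rule mult_left_mono) simp
  then show "\<bar>f x * (cutoff' m t x * ((x \<bullet> x) / t\<^sup>2))\<bar> \<le> \<bar>f x\<bar> * (C * (1 / (s / 2)\<^sup>2))"
    by (simp add: abs_mult)
next
  show "integrable R (\<lambda>x. \<bar>f x\<bar> * ((fact (m + 2) + real m * fact (m + 1)) * (1 / (s / 2)\<^sup>2)))"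
    using f by simp
qed (use s in simp)

end

text \<open>Extending the weight by 0 to y \<le> 0 gives a weight that is homogeneous on the whole
  space, so the weighted half-ball becomes a restriction of a measure with an exact scaling
  law.\<close>

definition half_space_measure :: "real \<Rightarrow> ((real ^ 'n) \<times> real) measure"
  where "half_space_measure a = density lebesgue (\<lambda>z. ennreal (if 0 < snd z then snd z powr a else 0))"

lemma sets_half_space_measure [simp, measurable_cong]: "sets (half_space_measure a) = sets lebesgue"
  by (simp add: half_space_measure_def)

lemma measurable_snd_borel: "snd \<in> borel_measurable (borel :: ((real ^ 'n) \<times> real) measure)"
  by (intro borel_measurable_continuous_onI continuous_on_snd continuous_on_id)

lemma half_space_weight_measurable:
  "(\<lambda>z::(real ^ 'n) \<times> real. if 0 < snd z then snd z powr a else 0) \<in> borel_measurable borel"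
  using measurable_snd_borel by measurable

lemma distr_half_space_measure_scale:
  assumes c: "0 < c"
  shows "distr (half_space_measure a) lebesgue ((*\<^sub>R) c) =
    density (half_space_measure a :: ((real ^ 'n) \<times> real) measure) (\<lambda>_. ennreal (c powr - (real CARD('n) + 1 + a)))"
proof -
  have "distr (half_space_measure a) lebesgue ((*\<^sub>R) c) =
    density (half_space_measure a :: ((real ^ 'n) \<times> real) measure)
      (\<lambda>_. ennreal (c powr - (real DIM((real ^ 'n) \<times> real) + a)))"
    unfolding half_space_measure_def
    by (rule distr_scale_homogeneous[OF half_space_weight_measurable _ _ c])
      (use c in \<open>auto simp: powr_mult zero_less_mult_iff\<close>)
  then show ?thesis by (simp add: add_ac)
qed

lemma sets_half_ball [measurable]: "(half_ball r :: ((real ^ 'n) \<times> real) set) \<in> sets lebesgue"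
proof -
  have "open (half_ball r :: ((real ^ 'n) \<times> real) set)"
    unfolding half_ball_def by (intro open_Collect_conj open_Collect_less continuous_intros)
  then show ?thesis by (intro sets_completionI_sets) simp
qed

lemma weighted_eq_restrict_space:
  "weighted a r = restrict_space (half_space_measure a :: ((real ^ 'n) \<times> real) measure) (half_ball r)"
proof (rule measure_eqI)
  show "sets (weighted a r) = sets (restrict_space (half_space_measure a :: ((real ^ 'n) \<times> real) measure) (half_ball r))"
    by (simp add: weighted_def sets_restrict_space)
  fix A assume "A \<in> sets (weighted a r :: ((real ^ 'n) \<times> real) measure)"
  then have A: "A \<in> sets (lebesgue_on (half_ball r))" by (simp add: weighted_def)
  then have A': "A \<in> sets lebesgue" "A \<subseteq> half_ball r"
    by (auto simp: sets_restrict_space_iff)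
  have m: "(\<lambda>z::(real ^ 'n) \<times> real. ennreal (snd z powr a)) \<in> borel_measurable lebesgue"
  proof -
    have "(\<lambda>z::(real ^ 'n) \<times> real. ennreal (snd z powr a)) \<in> borel_measurable borel"
      using measurable_snd_borel by measurable
    then show ?thesis by (intro measurable_completion) simp
  qed
  have m2: "(\<lambda>z::(real ^ 'n) \<times> real. if 0 < snd z then snd z powr a else 0) \<in> borel_measurable lebesgue"
    by (intro measurable_completion) (simp add: half_space_weight_measurable)
  have "emeasure (weighted a r) A = (\<integral>\<^sup>+z. ennreal (snd z powr a) * indicator A z \<partial>lebesgue_on (half_ball r))"
    unfolding weighted_def using A m by (subst emeasure_density) (auto intro: measurable_restrict_space1)
  also have "\<dots> = (\<integral>\<^sup>+z. ennreal (snd z powr a) * indicator A z * indicator (half_ball r) z \<partial>lebesgue)"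
    by (subst nn_integral_restrict_space) auto
  also have "\<dots> = (\<integral>\<^sup>+z. ennreal (if 0 < snd z then snd z powr a else 0) * indicator A z \<partial>lebesgue)"
    using A'(2) by (intro nn_integral_cong) (auto simp: indicator_def half_ball_def)
  also have "\<dots> = emeasure (half_space_measure a) A"
    unfolding half_space_measure_def using A' m2 by (subst emeasure_density) auto
  also have "\<dots> = emeasure (restrict_space (half_space_measure a) (half_ball r)) A"
    using A' by (subst emeasure_restrict_space) auto
  finally show "emeasure (weighted a r) A = emeasure (restrict_space (half_space_measure a) (half_ball r)) A" .
qed

text \<open>Here a > -1 enters: it makes y^a integrable near 0. The ball lies in a ball in x times
  an interval in y, and Tonelli's theorem separates the variables.\<close>

lemma emeasure_half_space_cball_finite:
  assumes a: "-1 < a"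
  shows "emeasure (half_space_measure a :: ((real ^ 'n) \<times> real) measure) (cball 0 R) < \<infinity>"
proof -
  \<comment> \<open>The one-dimensional integral of y^a runs over an interval from 0 to a
    nonnegative endpoint; for negative R the ball is empty.\<close>
  define R' where "R' = max R 0"
  have m1: "(indicator (cball 0 R) :: real ^ 'n \<Rightarrow> ennreal) \<in> borel_measurable lborel"
    by (simp add: borel_measurable_indicator borel_closed)
  have m2: "(\<lambda>y::real. ennreal (y powr a) * indicator {0..R'} y) \<in> borel_measurable lborel"
    by measurable
  have w: "(\<lambda>z::(real ^ 'n) \<times> real. if 0 < snd z then snd z powr a else 0) \<in> borel_measurable lebesgue"
    by (intro measurable_completion) (simp add: half_space_weight_measurable)
  have "emeasure (half_space_measure a :: ((real ^ 'n) \<times> real) measure) (cball 0 R) =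
      (\<integral>\<^sup>+z. ennreal (if 0 < snd z then snd z powr a else 0) * indicator (cball 0 R) z \<partial>(lebesgue :: ((real ^ 'n) \<times> real) measure))"
    unfolding half_space_measure_def using w by (subst emeasure_density) auto
  also have "\<dots> = (\<integral>\<^sup>+z. ennreal (if 0 < snd z then snd z powr a else 0) * indicator (cball 0 R) z \<partial>(lborel :: ((real ^ 'n) \<times> real) measure))"
    by (rule nn_integral_completion)
  also have "\<dots> \<le> (\<integral>\<^sup>+z. indicator (cball 0 R) (fst z) * (ennreal (snd z powr a) * indicator {0..R'} (snd z)) \<partial>(lborel :: ((real ^ 'n) \<times> real) measure))"
  proof (intro nn_integral_mono)
    fix z :: "(real ^ 'n) \<times> real"
    show "ennreal (if 0 < snd z then snd z powr a else 0) * indicator (cball 0 R) z \<le>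
        indicator (cball 0 R) (fst z) * (ennreal (snd z powr a) * indicator {0..R'} (snd z))"
      using norm_fst_le[of "fst z" "snd z"] norm_snd_le[of "snd z" "fst z"]
      by (auto simp: indicator_def R'_def)
  qed
  also have "\<dots> = (\<integral>\<^sup>+x. \<integral>\<^sup>+y. indicator (cball 0 R) x * (ennreal (y powr a) * indicator {0..R'} y) \<partial>(lborel::real measure) \<partial>(lborel :: (real ^ 'n) measure))"
    unfolding lborel_prod[symmetric]
    using borel_measurable_times_ennreal[OF measurable_compose[OF measurable_fst m1] measurable_compose[OF measurable_snd m2]]
    by (subst lborel.nn_integral_fst[symmetric]) simp_all
  also have "\<dots> = (\<integral>\<^sup>+y. ennreal (y powr a) * indicator {0..R'} y \<partial>lborel) * emeasure lborel (cball 0 R :: (real ^ 'n) set)"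
  proof -
    have "(\<integral>\<^sup>+x. indicator (cball 0 R) x * C \<partial>(lborel :: (real ^ 'n) measure)) =
        C * emeasure lborel (cball 0 R :: (real ^ 'n) set)" for C
      by (subst nn_integral_multc[OF m1]) (simp add: borel_closed mult.commute)
    then show ?thesis
      by (simp add: nn_integral_cmult)
  qed
  also have "(\<integral>\<^sup>+y. ennreal (y powr a) * indicator {0..R'} y \<partial>lborel) = ennreal (R' powr (a + 1) / (a + 1))"
    using nn_integral_has_integral_lebesgue[OF _ has_integral_powr_from_0[OF a, of R']]
    by (subst nn_integral_cong[where v = "\<lambda>y. ennreal (indicator {0..R'} y * y powr a)"])
      (auto simp: indicator_def R'_def)
  also have "\<dots> * emeasure lborel (cball 0 R :: (real ^ 'n) set) < \<infinity>"
    using emeasure_lborel_cball_finite[of "0 :: real ^ 'n" R] by (simp add: ennreal_mult_less_top)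
  finally show ?thesis .
qed

lemma conic_measure_half_space:
  assumes "-1 < a"
  shows "conic_measure (half_space_measure a :: ((real ^ 'n) \<times> real) measure) (half_ball 1) ((real CARD('n) + 1 + a))"
proof
  show "0 < c \<Longrightarrow> distr (half_space_measure a) lebesgue ((*\<^sub>R) c) =
      density (half_space_measure a :: ((real ^ 'n) \<times> real) measure) (\<lambda>_. ennreal (c powr - (real CARD('n) + 1 + a)))" for c
    by (rule distr_half_space_measure_scale)
  show "1 \<le> t \<Longrightarrow> norm (t *\<^sub>R x) < 1 \<Longrightarrow> t *\<^sub>R x \<in> half_ball 1 \<longleftrightarrow> x \<in> half_ball 1" for t and x :: "(real ^ 'n) \<times> real"
    using mult_right_mono[of 1 t "norm x"] by (auto simp: half_ball_def zero_less_mult_iff)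
  show "emeasure (half_space_measure a :: ((real ^ 'n) \<times> real) measure) (cball 0 r) < \<infinity>" for r
    using assms by (rule emeasure_half_space_cball_finite)
qed (use assms sets_half_ball in \<open>auto simp: half_ball_def\<close>)

lemma conic_measure_flat:
  "conic_measure (lebesgue :: (real ^ 'n) measure) (flat_ball 1) (real CARD('n))"
proof
  show "0 < c \<Longrightarrow> distr lebesgue lebesgue ((*\<^sub>R) c) =
      density (lebesgue :: (real ^ 'n) measure) (\<lambda>_. ennreal (c powr - real CARD('n)))" for c
    using distr_scale_homogeneous[of "\<lambda>_::real ^ 'n. 1" c 0] by (simp add: density_1)
  show "1 \<le> t \<Longrightarrow> norm (t *\<^sub>R x) < 1 \<Longrightarrow> t *\<^sub>R x \<in> flat_ball 1 \<longleftrightarrow> x \<in> flat_ball 1" for t and x :: "real ^ 'n"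
    using mult_right_mono[of 1 t "norm x"] by (auto simp: flat_ball_def)
  have "flat_ball 1 = (ball 0 1 :: (real ^ 'n) set)" by (auto simp: flat_ball_def)
  then show "flat_ball 1 \<in> sets (lebesgue :: (real ^ 'n) measure)" by simp
  show "emeasure (lebesgue :: (real ^ 'n) measure) (cball 0 r) < \<infinity>" for r
    using emeasure_lborel_cball_finite[of "0 :: real ^ 'n" r] by (simp add: less_top)
qed (auto simp: flat_ball_def)

section \<open>Approximation and test functions\<close>

lemma grad_diff: "smooth f \<Longrightarrow> smooth g \<Longrightarrow> grad (\<lambda>z. f z - g z) z = grad f z - grad g z"
  by (intro GDERIV_imp_grad GDERIV_diff smooth_GDERIV)

lemma smooth_cutoff_scale: "smooth \<phi> \<Longrightarrow> smooth (\<lambda>z. cutoff m s z * \<phi> (t *\<^sub>R z))"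
  by (intro smooth_mult smooth_cutoff smooth_scale)

lemma grad_cutoff_scale:
  assumes "smooth \<phi>" "0 < s"
  shows "grad (\<lambda>z. cutoff 0 s z * \<phi> (t *\<^sub>R z)) z =
    (t * cutoff 0 s z) *\<^sub>R grad \<phi> (t *\<^sub>R z) + (- (2 / s) * cutoff 2 s z * \<phi> (t *\<^sub>R z)) *\<^sub>R z"
proof -
  have "grad (\<lambda>z. cutoff 0 s z * \<phi> (t *\<^sub>R z)) z =
      cutoff 0 s z *\<^sub>R (t *\<^sub>R grad \<phi> (t *\<^sub>R z)) + \<phi> (t *\<^sub>R z) *\<^sub>R grad (cutoff 0 s) z"
    using assms by (intro GDERIV_imp_grad GDERIV_mult smooth_GDERIV smooth_cutoff GDERIV_scale)
  then show ?thesis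
    using assms by (simp add: grad_cutoff mult_ac)
qed

lemma cutoff_dilate: "0 < s \<Longrightarrow> cutoff m s z *\<^sub>R dilate s t f z = cutoff m s z *\<^sub>R f (t *\<^sub>R z)"
  by (auto simp: dilate_def cutoff_eq_0)

text \<open>The support lies in the closed ball of radius sqrt s, which is disjoint from the unit
  sphere, and the closure of the half-sphere is contained in that sphere.\<close>

lemma smooth_off_sphereI:
  fixes f :: "(real ^ 'n) \<times> real \<Rightarrow> real"
  assumes f: "smooth f" and s: "0 < s" "s < 1" and vanish: "\<And>z. s \<le> z \<bullet> z \<Longrightarrow> f z = 0"
  shows "smooth_off_sphere 1 f"
proof -
  define A where "A = {z \<in> closure (half_ball 1). f z \<noteq> 0}"
  have "z \<in> cball 0 (sqrt s)" if "z \<in> A" for z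
  proof -
    have "z \<bullet> z < s" using vanish[of z] that by (force simp: A_def)
    then show ?thesis using s by (simp add: norm_eq_sqrt_inner)
  qed
  then have A: "closure A \<subseteq> closure (half_ball 1) \<inter> cball 0 (sqrt s)"
    by (intro closure_minimal) (auto simp: A_def)
  have "half_sphere 1 \<subseteq> (sphere 0 1 :: ((real ^ 'n) \<times> real) set)"
    by (auto simp: half_sphere_def)
  then have "closure (half_sphere 1) \<subseteq> (sphere 0 1 :: ((real ^ 'n) \<times> real) set)"
    by (intro closure_minimal) auto
  moreover have "cball 0 (sqrt s) \<inter> (sphere 0 1 :: ((real ^ 'n) \<times> real) set) = {}"
    using s by auto
  ultimately have "closure A \<subseteq> closure (half_ball 1) - closure (half_sphere 1)"
    using A by blast
  moreover have "compact (closure A)"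
    using A bounded_subset[of "cball 0 (sqrt s)" "closure A"] by (auto simp: compact_eq_bounded_closed)
  ultimately show ?thesis using f by (simp add: smooth_off_sphere_def A_def)
qed

section \<open>Approximating sequences and admissible test functions\<close>

locale degenerate_weight =
  fixes a :: real and dim :: "'n::finite itself"
  assumes a: "-1 < a"
begin

sublocale bulk: conic_measure "half_space_measure a :: ((real ^ 'n) \<times> real) measure" "half_ball 1" "real CARD('n) + 1 + a"
  using a by (rule conic_measure_half_space)

sublocale flat: conic_measure "lebesgue :: (real ^ 'n) measure" "flat_ball 1" "real CARD('n)"
  by (rule conic_measure_flat)

lemma square_integrable_smooth:
  assumes "smooth f"
  shows "square_integrable bulk.R f" "square_integrable bulk.R (grad f)"
    "square_integrable flat.R (\<lambda>x. f (x, 0))"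
proof -
  show "square_integrable bulk.R f" "square_integrable bulk.R (grad f)"
    by (rule bulk.square_integrable_continuous[OF smooth_continuous[OF assms]]
        bulk.square_integrable_continuous[OF smooth_continuous_grad[OF assms]])+
  show "square_integrable flat.R (\<lambda>x. f (x, 0))"
    by (intro flat.square_integrable_continuous continuous_on_compose2[OF smooth_continuous[OF assms, of UNIV]])
      (auto intro!: continuous_intros)
qed

text \<open>The squared Sobolev distance is a sum of two nonnegative integrals, so it tends to 0
  exactly when both of them do.\<close>

lemma H1a_dist2_tendsto_0_iff:
  fixes \<phi> :: "nat \<Rightarrow> (real ^ 'n) \<times> real \<Rightarrow> real"
  assumes smooth: "\<And>k. smooth (\<phi> k)"
  shows "u \<in> borel_measurable bulk.R \<and> G \<in> borel_measurable bulk.R \<and> (\<lambda>k. H1a_dist2 a 1 (\<phi> k) u G) \<longlonglongrightarrow> 0 \<longleftrightarrow>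
    L2_tendsto bulk.R \<phi> u \<and> L2_tendsto bulk.R (\<lambda>k. grad (\<phi> k)) G"
proof (cases "u \<in> borel_measurable bulk.R \<and> G \<in> borel_measurable bulk.R")
  case True
  define U V where "U k = (\<integral>\<^sup>+z. ennreal ((norm (\<phi> k z - u z))\<^sup>2) \<partial>bulk.R)"
    and "V k = (\<integral>\<^sup>+z. ennreal ((norm (grad (\<phi> k) z - G z))\<^sup>2) \<partial>bulk.R)" for k
  have meas: "\<phi> k \<in> borel_measurable bulk.R" "grad (\<phi> k) \<in> borel_measurable bulk.R" for k
    using square_integrable_smooth[OF smooth[of k]] by (auto simp: square_integrable_def)
  have "H1a_dist2 a 1 (\<phi> k) u G = V k + U k" for k
    unfolding H1a_dist2_def weighted_eq_restrict_space U_def V_def using True meas[of k]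
    by (subst nn_integral_add[symmetric]) auto
  moreover have "(\<lambda>k. V k + U k) \<longlonglongrightarrow> 0 \<longleftrightarrow> U \<longlonglongrightarrow> 0 \<and> V \<longlonglongrightarrow> 0"
  proof (intro iffI conjI)
    assume *: "(\<lambda>k. V k + U k) \<longlonglongrightarrow> 0"
    show "U \<longlonglongrightarrow> 0" "V \<longlonglongrightarrow> 0"
      by (rule tendsto_sandwich[OF _ _ tendsto_const *]; simp)+
  next
    assume "U \<longlonglongrightarrow> 0 \<and> V \<longlonglongrightarrow> 0"
    then show "(\<lambda>k. V k + U k) \<longlonglongrightarrow> 0"
      using tendsto_add[of V 0 sequentially U 0] by simp
  qed
  ultimately show ?thesis
    using True square_integrable_smooth[OF smooth]
    by (simp add: L2_tendsto_iff_nn_integral U_def[abs_def] V_def[abs_def])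
qed (auto simp: L2_tendsto_def square_integrable_def)

lemma completion_grad_iff:
  assumes "\<And>f. X f \<Longrightarrow> smooth f"
  shows "completion_grad X a 1 u G \<longleftrightarrow> (\<exists>\<phi> :: nat \<Rightarrow> (real ^ 'n) \<times> real \<Rightarrow> real.
    (\<forall>k. X (\<phi> k)) \<and> L2_tendsto bulk.R \<phi> u \<and> L2_tendsto bulk.R (\<lambda>k. grad (\<phi> k)) G)"
  unfolding completion_grad_def weighted_eq_restrict_space
  using H1a_dist2_tendsto_0_iff[of _ u G] assms by metis

lemma has_trace_iff:
  "has_trace a 1 u v \<longleftrightarrow> (\<exists>G (\<phi> :: nat \<Rightarrow> (real ^ 'n) \<times> real \<Rightarrow> real). (\<forall>k. smooth (\<phi> k)) \<and>
    L2_tendsto bulk.R \<phi> u \<and> L2_tendsto bulk.R (\<lambda>k. grad (\<phi> k)) G \<and> L2_tendsto flat.R (\<lambda>k x. \<phi> k (x, 0)) v)"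
proof -
  have "has_trace a 1 u v \<longleftrightarrow> (\<exists>G (\<phi> :: nat \<Rightarrow> (real ^ 'n) \<times> real \<Rightarrow> real). (\<forall>k. smooth (\<phi> k)) \<and>
    (u \<in> borel_measurable bulk.R \<and> G \<in> borel_measurable bulk.R \<and> (\<lambda>k. H1a_dist2 a 1 (\<phi> k) u G) \<longlonglongrightarrow> 0) \<and>
    v \<in> borel_measurable flat.R \<and>
    (\<lambda>k. \<integral>\<^sup>+ x. ennreal ((norm (\<phi> k (x, 0) - v x))\<^sup>2) \<partial>flat.R) \<longlonglongrightarrow> 0)"
    unfolding has_trace_def has_gradient_def completion_grad_def weighted_eq_restrict_space
    by simp blast
  moreover have "(\<forall>k. smooth (\<phi> k)) \<and>
      (u \<in> borel_measurable bulk.R \<and> G \<in> borel_measurable bulk.R \<and> (\<lambda>k. H1a_dist2 a 1 (\<phi> k) u G) \<longlonglongrightarrow> 0) \<and>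
      v \<in> borel_measurable flat.R \<and>
      (\<lambda>k. \<integral>\<^sup>+ x. ennreal ((norm (\<phi> k (x, 0) - v x))\<^sup>2) \<partial>flat.R) \<longlonglongrightarrow> 0 \<longleftrightarrow>
    (\<forall>k. smooth (\<phi> k)) \<and> L2_tendsto bulk.R \<phi> u \<and> L2_tendsto bulk.R (\<lambda>k. grad (\<phi> k)) G \<and>
      L2_tendsto flat.R (\<lambda>k x. \<phi> k (x, 0)) v" for G \<phi>
  proof (cases "\<forall>k. smooth (\<phi> k)")
    case True
    then show ?thesis
      using H1a_dist2_tendsto_0_iff[of \<phi> u G]
        L2_tendsto_iff_nn_integral[of flat.R "\<lambda>k x. \<phi> k (x, 0)" v, OF square_integrable_smooth(3)] by blast
  qed blast
  ultimately show ?thesis by (simp only:)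
qed

text \<open>Where the cutoff is positive, f (t z) agrees with a truncated dilation, and truncated
  dilations are continuous in mean square.\<close>

lemma L2_tendsto_cutoff_scale:
  assumes s: "0 < s" and t: "1 \<le> t" "t\<^sup>2 * s < 1"
  shows "L2_tendsto bulk.R fs f \<Longrightarrow>
      L2_tendsto bulk.R (\<lambda>k z. cutoff m s z *\<^sub>R fs k (t *\<^sub>R z)) (\<lambda>z. cutoff m s z *\<^sub>R f (t *\<^sub>R z))"
    and "L2_tendsto flat.R gs g \<Longrightarrow>
      L2_tendsto flat.R (\<lambda>k x. cutoff m s x *\<^sub>R gs k (t *\<^sub>R x)) (\<lambda>x. cutoff m s x *\<^sub>R g (t *\<^sub>R x))"
proof -
  have t': "t\<^sup>2 * s \<le> 1" using t by simp
  show "L2_tendsto bulk.R (\<lambda>k z. cutoff m s z *\<^sub>R fs k (t *\<^sub>R z)) (\<lambda>z. cutoff m s z *\<^sub>R f (t *\<^sub>R z))"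
    if "L2_tendsto bulk.R fs f"
    using L2_tendsto_mult[OF bulk.L2_tendsto_dilate[OF that t(1) t'], of "cutoff m s" "fact m"]
    by (simp add: cutoff_dilate s bulk.borel_measurable_R cutoff_le_fact)
  show "L2_tendsto flat.R (\<lambda>k x. cutoff m s x *\<^sub>R gs k (t *\<^sub>R x)) (\<lambda>x. cutoff m s x *\<^sub>R g (t *\<^sub>R x))"
    if "L2_tendsto flat.R gs g"
    using L2_tendsto_mult[OF flat.L2_tendsto_dilate[OF that t(1) t'], of "cutoff m s" "fact m"]
    by (simp add: cutoff_dilate s flat.borel_measurable_R cutoff_le_fact)
qed

lemma borel_measurable_bulk_id: "(\<lambda>z. z) \<in> borel_measurable bulk.R"
  by (rule bulk.borel_measurable_R) simp

text \<open>The gradient that the product and chain rules predict for \<theta>_s(z) u(t z). As u is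
  only a mean square limit of smooth functions, it is given by this formula, with G in place of the
  gradient of u, and is justified by passing to the limit.\<close>

definition cutoff_grad where
  "cutoff_grad s t u G z = (t * cutoff 0 s z) *\<^sub>R G (t *\<^sub>R z) + (- (2 / s) * cutoff 2 s z * u (t *\<^sub>R z)) *\<^sub>R z"
    for z :: "(real ^ 'n) \<times> real"

lemma L2_tendsto_cutoff_grad:
  assumes s: "0 < s" and t: "1 \<le> t" "t\<^sup>2 * s < 1" and smooth: "\<And>k. smooth (\<phi> k)"
    and u: "L2_tendsto bulk.R \<phi> u" and G: "L2_tendsto bulk.R (\<lambda>k. grad (\<phi> k)) G"
  shows "L2_tendsto bulk.R (\<lambda>k. grad (\<lambda>z. cutoff 0 s z * \<phi> k (t *\<^sub>R z))) (cutoff_grad s t u G)"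
proof -
  have "L2_tendsto bulk.R (\<lambda>k z. t *\<^sub>R (cutoff 0 s z *\<^sub>R grad (\<phi> k) (t *\<^sub>R z)) +
      (- (2 / s) *\<^sub>R (cutoff 2 s z *\<^sub>R \<phi> k (t *\<^sub>R z))) *\<^sub>R z)
    (\<lambda>z. t *\<^sub>R (cutoff 0 s z *\<^sub>R G (t *\<^sub>R z)) + (- (2 / s) *\<^sub>R (cutoff 2 s z *\<^sub>R u (t *\<^sub>R z))) *\<^sub>R z)"
  proof (intro L2_tendsto_add)
    show "L2_tendsto bulk.R (\<lambda>k z. t *\<^sub>R (cutoff 0 s z *\<^sub>R grad (\<phi> k) (t *\<^sub>R z)))
        (\<lambda>z. t *\<^sub>R (cutoff 0 s z *\<^sub>R G (t *\<^sub>R z)))"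
      by (rule L2_tendsto_mult[where C = "\<bar>t\<bar>", OF L2_tendsto_cutoff_scale(1)[OF s t G]]) auto
    have "L2_tendsto bulk.R (\<lambda>k z. - (2 / s) *\<^sub>R (cutoff 2 s z *\<^sub>R \<phi> k (t *\<^sub>R z)))
        (\<lambda>z. - (2 / s) *\<^sub>R (cutoff 2 s z *\<^sub>R u (t *\<^sub>R z)))"
      by (rule L2_tendsto_mult[where C = "\<bar>2 / s\<bar>", OF L2_tendsto_cutoff_scale(1)[OF s t u]]) auto
    then show "L2_tendsto bulk.R (\<lambda>k z. (- (2 / s) *\<^sub>R (cutoff 2 s z *\<^sub>R \<phi> k (t *\<^sub>R z))) *\<^sub>R z)
        (\<lambda>z. (- (2 / s) *\<^sub>R (cutoff 2 s z *\<^sub>R u (t *\<^sub>R z))) *\<^sub>R z)"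
      by (rule L2_tendsto_scaleR[where C = 1]) (auto simp: borel_measurable_bulk_id dest: bulk.norm_less_1)
  qed
  moreover have "t *\<^sub>R (cutoff 0 s z *\<^sub>R G (t *\<^sub>R z)) + (- (2 / s) *\<^sub>R (cutoff 2 s z *\<^sub>R u (t *\<^sub>R z))) *\<^sub>R z =
      cutoff_grad s t u G z" for z
    by (simp add: cutoff_grad_def mult_ac)
  moreover have "t *\<^sub>R (cutoff 0 s z *\<^sub>R grad (\<phi> k) (t *\<^sub>R z)) + (- (2 / s) *\<^sub>R (cutoff 2 s z *\<^sub>R \<phi> k (t *\<^sub>R z))) *\<^sub>R z =
      grad (\<lambda>z. cutoff 0 s z * \<phi> k (t *\<^sub>R z)) z" for k z
    by (simp add: grad_cutoff_scale[OF smooth s] mult_ac)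
  ultimately show ?thesis by simp
qed

definition approximates ::
  "(nat \<Rightarrow> (real ^ 'n) \<times> real \<Rightarrow> real) \<Rightarrow> ((real ^ 'n) \<times> real \<Rightarrow> real) \<Rightarrow> ((real ^ 'n) \<times> real \<Rightarrow> (real ^ 'n) \<times> real) \<Rightarrow> bool"
  where "approximates \<phi> u G \<longleftrightarrow> (\<forall>k. smooth (\<phi> k)) \<and> L2_tendsto bulk.R \<phi> u \<and> L2_tendsto bulk.R (\<lambda>k. grad (\<phi> k)) G"

lemma approximates_cutoff:
  assumes s: "0 < s" and t: "1 \<le> t" "t\<^sup>2 * s < 1" and u: "approximates \<phi> u G"
  shows "approximates (\<lambda>k z. cutoff 0 s z * \<phi> k (t *\<^sub>R z)) (\<lambda>z. cutoff 0 s z * u (t *\<^sub>R z)) (cutoff_grad s t u G)"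
  using u L2_tendsto_cutoff_grad[OF s t, of \<phi> u G] L2_tendsto_cutoff_scale(1)[OF s t, of \<phi> u 0]
  by (simp add: approximates_def smooth_cutoff_scale)

lemma approximates_diff:
  assumes "approximates \<phi> u G" "approximates \<psi> w H"
  shows "approximates (\<lambda>k z. \<phi> k z - \<psi> k z) (\<lambda>z. u z - w z) (\<lambda>z. G z - H z)"
proof -
  have "grad (\<lambda>z. \<phi> k z - \<psi> k z) = (\<lambda>z. grad (\<phi> k) z - grad (\<psi> k) z)" for k
    using assms by (intro ext grad_diff) (auto simp: approximates_def)
  then show ?thesis
    using assms by (simp add: approximates_def smooth_diff L2_tendsto_diff)
qed

text \<open>The sequences approximating the gradient and the trace of \<open>u\<close> may differ, and so may their limit
  gradients; the test functions are built from both, so that the gradient need not be unique.\<close>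

lemma weak_formulation_test:
  assumes u: "has_gradient a 1 u G" "has_trace a 1 u v"
    and weak: "\<forall>\<phi>\<in>H1a_0 a 1. \<forall>H w. has_gradient a 1 \<phi> H \<longrightarrow> has_trace a 1 \<phi> w \<longrightarrow>
        integrable (lebesgue_on (flat_ball 1)) (\<lambda>x. flux p lm lp (v x) * w x) \<and>
        (LINT z|weighted a 1. G z \<bullet> H z) =
          (LINT x|lebesgue_on (flat_ball 1). flux p lm lp (v x) * w x)"
    and s: "0 < s" and t: "1 \<le> t" "t\<^sup>2 * s < 1"
  shows "integrable flat.R (\<lambda>x. flux p lm lp (v x) * (cutoff 0 s x * v x))"
    and "(LINT z|bulk.R. G z \<bullet> cutoff_grad s 1 u G z) = (LINT x|flat.R. flux p lm lp (v x) * (cutoff 0 s x * v x))"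
    and "integrable flat.R (\<lambda>x. flux p lm lp (v x) * (cutoff 0 s x * v (t *\<^sub>R x) - cutoff 0 s x * v x))"
    and "(LINT z|bulk.R. G z \<bullet> (cutoff_grad s t u G z - cutoff_grad s 1 u G z)) =
      (LINT x|flat.R. flux p lm lp (v x) * (cutoff 0 s x * v (t *\<^sub>R x) - cutoff 0 s x * v x))"
proof -
  have s1: "s < 1" "(1::real)\<^sup>2 * s < 1"
    using t s by (auto intro: order.strict_trans1[OF mult_right_mono[of 1 "t\<^sup>2" s, simplified]] simp: one_le_power)
  obtain \<phi> where \<phi>: "approximates \<phi> u G"
    using u(1) unfolding has_gradient_def approximates_def by (auto simp: completion_grad_iff)
  obtain H \<psi> where \<psi>: "approximates \<psi> u H" "L2_tendsto flat.R (\<lambda>k x. \<psi> k (x, 0)) v"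
    using u(2) unfolding has_trace_iff approximates_def by auto
  have vanish: "cutoff 0 s z * r = 0" if "s \<le> z \<bullet> z" for z :: "(real ^ 'n) \<times> real" and r
    using cutoff_eq_0[OF s that] by simp
  \<comment> \<open>\<open>\<alpha>\<close> provides membership in the test space and the gradient
    \<open>K\<close>, while \<open>\<beta>\<close> provides the trace. They share the limit f, and
    the vanishing near the sphere is asked of \<open>\<alpha>\<close> alone.\<close>
  have test: "integrable flat.R (\<lambda>x. flux p lm lp (v x) * w x) \<and>
      (LINT z|bulk.R. G z \<bullet> K z) = (LINT x|flat.R. flux p lm lp (v x) * w x)"
    if "approximates \<alpha> f K" "\<And>k z. s \<le> z \<bullet> z \<Longrightarrow> \<alpha> k z = 0" "approximates \<beta> f L" "L2_tendsto flat.R (\<lambda>k x. \<beta> k (x, 0)) w"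
    for \<alpha> f K \<beta> L w
  proof -
    have "smooth_off_sphere 1 (\<alpha> k)" for k
      using that s s1 by (intro smooth_off_sphereI) (auto simp: approximates_def)
    then have "completion_grad (smooth_off_sphere 1) a 1 f K"
      using that(1) completion_grad_iff[of "smooth_off_sphere 1"] by (auto simp: approximates_def smooth_off_sphere_def)
    moreover have "has_gradient a 1 f K"
      using that(1) by (auto simp: approximates_def has_gradient_def completion_grad_iff)
    moreover have "has_trace a 1 f w"
      using that(3,4) by (auto simp: approximates_def has_trace_iff)
    ultimately show ?thesis
      using weak by (auto simp: H1a_0_def weighted_eq_restrict_space)
  qed
  have c: "cutoff 0 s ((x, 0) :: (real ^ 'n) \<times> real) = cutoff 0 s x" for x
    by (simp add: cutoff_def)
  have tr: "L2_tendsto flat.R (\<lambda>k x. cutoff 0 s ((x, 0) :: (real ^ 'n) \<times> real) * \<psi> k (r *\<^sub>R (x, 0))) (\<lambda>x. cutoff 0 s x * v (r *\<^sub>R x))"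
    if "1 \<le> r" "r\<^sup>2 * s < 1" for r
    using L2_tendsto_cutoff_scale(2)[OF s that \<psi>(2), of 0] by (simp add: c)
  note a1 = approximates_cutoff[OF s order_refl s1(2)]
  note t1 = test[OF a1[OF \<phi>] vanish a1[OF \<psi>(1)] tr[OF order_refl s1(2)]]
  then show "integrable flat.R (\<lambda>x. flux p lm lp (v x) * (cutoff 0 s x * v x))"
    "(LINT z|bulk.R. G z \<bullet> cutoff_grad s 1 u G z) = (LINT x|flat.R. flux p lm lp (v x) * (cutoff 0 s x * v x))"
    by simp_all
  note a2 = approximates_diff[OF approximates_cutoff[OF s t] a1]
  have t2: "integrable flat.R (\<lambda>x. flux p lm lp (v x) * (cutoff 0 s x * v (t *\<^sub>R x) - cutoff 0 s x * v (1 *\<^sub>R x))) \<and>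
    (LINT z|bulk.R. G z \<bullet> (cutoff_grad s t u G z - cutoff_grad s 1 u G z)) =
      (LINT x|flat.R. flux p lm lp (v x) * (cutoff 0 s x * v (t *\<^sub>R x) - cutoff 0 s x * v (1 *\<^sub>R x)))"
    by (rule test[OF a2[OF \<phi> \<phi>] _ a2[OF \<psi>(1) \<psi>(1)] L2_tendsto_diff[OF tr[OF t] tr[OF order_refl s1(2)]]])
      (simp add: vanish)
  then show "integrable flat.R (\<lambda>x. flux p lm lp (v x) * (cutoff 0 s x * v (t *\<^sub>R x) - cutoff 0 s x * v x))"
    "(LINT z|bulk.R. G z \<bullet> (cutoff_grad s t u G z - cutoff_grad s 1 u G z)) =
      (LINT x|flat.R. flux p lm lp (v x) * (cutoff 0 s x * v (t *\<^sub>R x) - cutoff 0 s x * v x))"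
    by simp_all
qed

end

section \<open>Dilations\<close>

lemma L2_tendsto_const: "square_integrable M f \<Longrightarrow> L2_tendsto M (\<lambda>_. f) f"
  by (simp add: L2_tendsto_def)

lemma integrable_mult_square_integrable:
  fixes f g :: "'a \<Rightarrow> real"
  shows "square_integrable M f \<Longrightarrow> square_integrable M g \<Longrightarrow> integrable M (\<lambda>x. f x * g x)"
  using square_integrable_inner[of M f g] by simp

lemma DERIV_at_right:
  "(f has_real_derivative D) (at x) \<Longrightarrow> ((\<lambda>t. (f t - f x) / (t - x)) \<longlongrightarrow> D) (at_right x)"
  unfolding has_field_derivative_iff by (erule tendsto_mono[OF at_le[OF subset_UNIV]])

text \<open>Minus p times a primitive of \<open>flux\<close>. With this normalisation,
  \<open>flux\<close> times its argument is exactly minus the potential.\<close>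

definition potential :: "real \<Rightarrow> real \<Rightarrow> real \<Rightarrow> real \<Rightarrow> real"
  where "potential p lm lp t = lm * (max (- t) 0) powr p + lp * (max t 0) powr p"

lemma powr_pred_mult: "0 \<le> (t::real) \<Longrightarrow> t powr (p - 1) * t = t powr p"
  by (cases "t = 0") (auto simp: powr_diff)

lemma flux_mult_self: "flux p lm lp t * t = - potential p lm lp t"
proof (cases "0 \<le> t")
  case True
  then show ?thesis
    using powr_pred_mult[of t p] by (simp add: flux_def potential_def algebra_simps)
next
  case False
  then show ?thesis
    using arg_cong[OF powr_pred_mult[of "- t" p], of "(*) lm"] by (simp add: flux_def potential_def algebra_simps)
qed

lemma Young_powr:
  assumes "2 \<le> p" "0 \<le> (t::real)" "0 \<le> r"
  shows "t powr (p - 1) * r \<le> (1 - 1 / p) * t powr p + r powr p / p"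
proof -
  define q where "q = p / (p - 1)"
  have "r * t powr (p - 1) \<le> r powr p / p + (t powr (p - 1)) powr q / q"
    using assms by (intro Youngs_inequality) (auto simp: q_def field_simps)
  moreover have "(t powr (p - 1)) powr q / q = (1 - 1 / p) * t powr p"
  proof -
    have q1: "(p - 1) * q = p" and q2: "1 - 1 / p = 1 / q"
      using assms by (auto simp: q_def field_simps)
    show ?thesis unfolding q2 by (simp add: powr_powr q1)
  qed
  ultimately show ?thesis by (simp add: mult.commute)
qed

text \<open>The tangent line inequality for the convex function (t^+)^p / p, obtained from Young's
  inequality with the exponents p and p / (p - 1).\<close>

lemma pos_part_powr_convex:
  fixes t r :: real
  assumes "2 \<le> p"
  shows "(max t 0) powr (p - 1) * (r - t) \<le> ((max r 0) powr p - (max t 0) powr p) / p"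
proof -
  have "(max t 0) powr (p - 1) * t = (max t 0) powr p"
    using powr_pred_mult[of t p] by (auto simp: max_def)
  moreover have "(max t 0) powr (p - 1) * r \<le> (max t 0) powr (p - 1) * max r 0"
    by (intro mult_left_mono) auto
  moreover have "(max t 0) powr (p - 1) * max r 0 \<le> (1 - 1 / p) * (max t 0) powr p + (max r 0) powr p / p"
    using assms by (intro Young_powr) auto
  ultimately show ?thesis by (simp add: algebra_simps diff_divide_distrib)
qed

text \<open>Minus the flux is a subgradient of the potential over p: the positive part is estimated
  at t and r, the negative part at -t and -r.\<close>

lemma flux_subgradient:
  assumes "2 \<le> p" "0 \<le> lm" "0 \<le> lp"
  shows "- flux p lm lp t * (r - t) \<le> (potential p lm lp r - potential p lm lp t) / p"
  using add_mono[OF mult_left_mono[OF pos_part_powr_convex[OF assms(1), of t r] assms(3)]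
      mult_left_mono[OF pos_part_powr_convex[OF assms(1), of "- t" "- r"] assms(2)]]
  by (simp add: flux_def potential_def algebra_simps add_divide_distrib diff_divide_distrib)

lemma potential_nonneg: "0 \<le> lm \<Longrightarrow> 0 \<le> lp \<Longrightarrow> 0 \<le> potential p lm lp t"
  by (simp add: potential_def)

section \<open>Radial derivatives obtained from dilations\<close>

context degenerate_weight
begin

text \<open>Compares the derivatives at t = 1 of both sides of the scaling law for the integral of f
  (t z). It is the divergence theorem for y^a f z: the sphere contributes nothing because f vanishes
  near it, nor does the flat face because z is tangent to it.\<close>

lemma integral_grad_radial:
  assumes f: "smooth f" and s: "0 < s" "s < 1" and vanish: "\<And>z. s \<le> z \<bullet> z \<Longrightarrow> f z = 0"
  shows "(\<integral>z. grad f z \<bullet> z \<partial>bulk.R) = - (real CARD('n) + 1 + a) * (\<integral>z. f z \<partial>bulk.R)"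
proof -
  interpret R: finite_measure bulk.R by (rule bulk.finite_measure_R)
  \<comment> \<open>The radius 2 contains t z for all z in the unit ball and all t with |t - 1| <
    1.\<close>
  have "compact (grad f ` cball 0 2)"
    using f by (intro compact_continuous_image smooth_continuous_grad) auto
  then obtain C where C: "\<And>x. x \<in> cball 0 2 \<Longrightarrow> norm (grad f x) \<le> C"
    by (meson bounded_iff compact_imp_bounded imageI)
  have int: "integrable bulk.R (\<lambda>z. f (t *\<^sub>R z))" for t
  proof -
    have "square_integrable bulk.R (\<lambda>z. f (t *\<^sub>R z))"
      using square_integrable_smooth(1)[OF smooth_scale[OF f]] .
    from square_integrable_inner[OF this bulk.square_integrable_continuous[of "\<lambda>_. 1::real"]]
    show ?thesis by simp
  qed
  define L where "L t = (\<integral>z. f (t *\<^sub>R z) \<partial>bulk.R)" for t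
  have "((\<lambda>t. \<integral>z. f (t *\<^sub>R z) \<partial>bulk.R) has_real_derivative (\<integral>z. grad f (1 *\<^sub>R z) \<bullet> z \<partial>bulk.R)) (at 1)"
  proof (rule has_real_derivative_integral(1)[where e = 1 and g = "\<lambda>_. C"])
    show "((\<lambda>t. f (t *\<^sub>R z)) has_real_derivative grad f (t *\<^sub>R z) \<bullet> z) (at t)" for t z
      by (rule DERIV_ray[OF f])
    fix t :: real and z :: "(real ^ 'n) \<times> real"
    assume t: "\<bar>t - 1\<bar> < 1" and "z \<in> space bulk.R"
    then have z: "norm z \<le> 1" using bulk.norm_less_1[of z] by simp
    have "\<bar>t\<bar> * norm z \<le> 2 * 1" using t z by (intro mult_mono) auto
    then have "norm (grad f (t *\<^sub>R z)) \<le> C" by (intro C) simp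
    moreover have "\<bar>grad f (t *\<^sub>R z) \<bullet> z\<bar> \<le> norm (grad f (t *\<^sub>R z)) * 1"
      by (rule order_trans[OF Cauchy_Schwarz_ineq2]) (intro mult_left_mono z norm_ge_zero)
    ultimately show "\<bar>grad f (t *\<^sub>R z) \<bullet> z\<bar> \<le> C" by simp
  qed (use int in auto)
  then have "(L has_real_derivative (\<integral>z. grad f z \<bullet> z \<partial>bulk.R)) (at 1)"
    by (simp add: L_def[abs_def])
  moreover have "((\<lambda>t. t powr - (real CARD('n) + 1 + a) * L 1) has_real_derivative - (real CARD('n) + 1 + a) * L 1) (at 1)"
    by (auto intro!: derivative_eq_intros)
  ultimately have "((\<lambda>t. L t - t powr - (real CARD('n) + 1 + a) * L 1) has_real_derivative (\<integral>z. grad f z \<bullet> z \<partial>bulk.R) - (- (real CARD('n) + 1 + a) * L 1)) (at 1)"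
    by (rule DERIV_diff)
  then have lim: "((\<lambda>t. (L t - t powr - (real CARD('n) + 1 + a) * L 1) / (t - 1)) \<longlongrightarrow> (\<integral>z. grad f z \<bullet> z \<partial>bulk.R) - (- (real CARD('n) + 1 + a) * L 1)) (at_right 1)"
    by (drule_tac DERIV_at_right) simp
  \<comment> \<open>\<open>integral_scaled\<close> only covers \<open>t \<ge> 1\<close>, hence the one-sided derivatives.\<close>
  have Lt: "L t = t powr - (real CARD('n) + 1 + a) * L 1" if "1 \<le> t" for t
  proof -
    have "f z = 0" if "1 \<le> norm z" for z
      using that s one_le_power[OF that, of 2] by (intro vanish) (simp add: power2_norm_eq_inner)
    then show ?thesis
      using bulk.integral_scaled[OF _ _ that, of f] int[of 1] by (simp add: L_def)
  qed
  have "\<forall>\<^sub>F t in at_right 1. (L t - t powr - (real CARD('n) + 1 + a) * L 1) / (t - 1) = 0"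
  proof (rule eventually_at_rightI[of 1 2])
    show "(L t - t powr - (real CARD('n) + 1 + a) * L 1) / (t - 1) = 0" if "t \<in> {1<..<2}" for t
      using Lt[of t] that by simp
  qed simp
  then have "((\<lambda>t. (L t - t powr - (real CARD('n) + 1 + a) * L 1) / (t - 1)) \<longlongrightarrow> 0) (at_right 1)"
    by (rule tendsto_eventually)
  from tendsto_unique[OF _ lim this] show ?thesis
    by (simp add: L_def)
qed

lemma bounded_cutoffs:
  assumes s: "0 < s"
  shows "(\<lambda>z. cutoff m s z) \<in> borel_measurable bulk.R"
    "(\<lambda>z. cutoff' m s z * (z \<bullet> z)) \<in> borel_measurable bulk.R"
    "z \<in> space bulk.R \<Longrightarrow> \<bar>cutoff' m s z * (z \<bullet> z)\<bar> \<le> fact (m + 2) + real m * fact (m + 1)"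
proof -
  show "(\<lambda>z. cutoff m s z) \<in> borel_measurable bulk.R"
    "(\<lambda>z. cutoff' m s z * (z \<bullet> z)) \<in> borel_measurable bulk.R"
    by (rule bulk.borel_measurable_R; measurable)+
  assume "z \<in> space bulk.R"
  then have "z \<bullet> z \<le> 1" using bulk.norm_less_1[of z] by (simp add: norm_eq_sqrt_inner)
  then have "\<bar>cutoff' m s z\<bar> * (z \<bullet> z) \<le> (fact (m + 2) + real m * fact (m + 1)) * 1"
    by (intro mult_mono abs_cutoff'_le) auto
  then show "\<bar>cutoff' m s z * (z \<bullet> z)\<bar> \<le> fact (m + 2) + real m * fact (m + 1)"
    by (simp add: abs_mult)
qed

lemma L2_tendsto_radial:
  "L2_tendsto bulk.R fs f \<Longrightarrow> L2_tendsto bulk.R (\<lambda>k z. fs k z \<bullet> z) (\<lambda>z. f z \<bullet> z)"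
  by (rule L2_tendsto_inner[where C = 1]) (auto simp: borel_measurable_bulk_id dest: bulk.norm_less_1)

text \<open>Radial integration by parts for the cutoff times the square of a smooth approximant,
  followed by a passage to the limit; every term is the integral of a product of two sequences that
  converge in mean square.\<close>

lemma integral_square_cutoff_radial:
  assumes s: "0 < s" "s < 1" and ap: "approximates \<phi> u G"
  shows "2 * (\<integral>z. (cutoff m s z * u z) * (G z \<bullet> z) \<partial>bulk.R)
      - (2 / s) * (\<integral>z. (cutoff' m s z * (z \<bullet> z) * u z) * u z \<partial>bulk.R)
    = - (real CARD('n) + 1 + a) * (\<integral>z. (cutoff m s z * u z) * u z \<partial>bulk.R)"
proof -
  have sm: "smooth (\<phi> k)" for k using ap by (simp add: approximates_def)
  have L: "L2_tendsto bulk.R \<phi> u" "L2_tendsto bulk.R (\<lambda>k z. grad (\<phi> k) z \<bullet> z) (\<lambda>z. G z \<bullet> z)"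
    using ap by (auto simp: approximates_def intro: L2_tendsto_radial)
  have L1: "L2_tendsto bulk.R (\<lambda>k z. cutoff m s z * \<phi> k z) (\<lambda>z. cutoff m s z * u z)"
    using L2_tendsto_mult[OF L(1) bounded_cutoffs(1)[OF s(1)], of m "fact m"] by (simp add: cutoff_le_fact)
  have L2: "L2_tendsto bulk.R (\<lambda>k z. cutoff' m s z * (z \<bullet> z) * \<phi> k z) (\<lambda>z. cutoff' m s z * (z \<bullet> z) * u z)"
    using L2_tendsto_mult[OF L(1) bounded_cutoffs(2,3)[OF s(1)]] by simp
  have i: "integrable bulk.R (\<lambda>z. (cutoff m s z * \<phi> k z) * (grad (\<phi> k) z \<bullet> z))"
    "integrable bulk.R (\<lambda>z. (cutoff' m s z * (z \<bullet> z) * \<phi> k z) * \<phi> k z)" for k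
    using L L1 L2 unfolding L2_tendsto_def by (intro integrable_mult_square_integrable; blast)+
  have eq: "2 * (\<integral>z. (cutoff m s z * \<phi> k z) * (grad (\<phi> k) z \<bullet> z) \<partial>bulk.R)
      - (2 / s) * (\<integral>z. (cutoff' m s z * (z \<bullet> z) * \<phi> k z) * \<phi> k z \<partial>bulk.R)
    = - (real CARD('n) + 1 + a) * (\<integral>z. (cutoff m s z * \<phi> k z) * \<phi> k z \<partial>bulk.R)" for k
  proof -
    let ?f = "\<lambda>z. cutoff m s z * (\<phi> k z * \<phi> k z)"
    have gr: "grad ?f z = cutoff m s z *\<^sub>R (\<phi> k z *\<^sub>R grad (\<phi> k) z + \<phi> k z *\<^sub>R grad (\<phi> k) z) +
        (\<phi> k z * \<phi> k z) *\<^sub>R grad (cutoff m s) z" for z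
      by (intro GDERIV_imp_grad GDERIV_mult smooth_GDERIV smooth_cutoff sm)
    have g: "grad ?f z \<bullet> z = 2 * ((cutoff m s z * \<phi> k z) * (grad (\<phi> k) z \<bullet> z))
        - (2 / s) * ((cutoff' m s z * (z \<bullet> z) * \<phi> k z) * \<phi> k z)" for z
      unfolding gr using s by (simp add: grad_cutoff inner_add algebra_simps)
    have "(\<integral>z. grad ?f z \<bullet> z \<partial>bulk.R) = - (real CARD('n) + 1 + a) * (\<integral>z. ?f z \<partial>bulk.R)"
      using s by (intro integral_grad_radial smooth_mult smooth_cutoff sm) (auto simp: cutoff_eq_0)
    then show ?thesis
      using i[of k] unfolding g by (simp add: mult.assoc)
  qed
  have "(\<lambda>k. 2 * (\<integral>z. (cutoff m s z * \<phi> k z) * (grad (\<phi> k) z \<bullet> z) \<partial>bulk.R)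
      - (2 / s) * (\<integral>z. (cutoff' m s z * (z \<bullet> z) * \<phi> k z) * \<phi> k z \<partial>bulk.R)) \<longlonglongrightarrow>
    2 * (\<integral>z. (cutoff m s z * u z) * (G z \<bullet> z) \<partial>bulk.R)
      - (2 / s) * (\<integral>z. (cutoff' m s z * (z \<bullet> z) * u z) * u z \<partial>bulk.R)"
    using L2_tendsto_integral_inner[OF L1 L(2)] L2_tendsto_integral_inner[OF L2 L(1)]
    by (intro tendsto_intros) simp_all
  moreover have "(\<lambda>k. - (real CARD('n) + 1 + a) * (\<integral>z. (cutoff m s z * \<phi> k z) * \<phi> k z \<partial>bulk.R)) \<longlonglongrightarrow>
      - (real CARD('n) + 1 + a) * (\<integral>z. (cutoff m s z * u z) * u z \<partial>bulk.R)"
    using L2_tendsto_integral_inner[OF L1 L(1)] by (intro tendsto_intros) simp_all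
  ultimately show ?thesis
    unfolding eq by (rule LIMSEQ_unique)
qed

text \<open>By the mean value theorem the quotient is the integral of J against the radial
  derivative at an intermediate dilation r. Cauchy-Schwarz and the contraction property of dilations
  bound it independently of t; this uniformity is what the exchange of limits in
  \<open>dilation_quotient_tendsto\<close> rests on.\<close>

lemma dilation_quotient_bound:
  assumes f: "smooth f" and J: "square_integrable bulk.R J" and J0: "\<And>z. s \<le> z \<bullet> z \<Longrightarrow> J z = 0"
  shows "((\<lambda>t. \<integral>z. J z * f (t *\<^sub>R z) \<partial>bulk.R) has_real_derivative (\<integral>z. J z * (grad f (t *\<^sub>R z) \<bullet> z) \<partial>bulk.R)) (at t)"
    and "1 < t \<Longrightarrow> t\<^sup>2 * s \<le> 1 \<Longrightarrow>
      \<bar>((\<integral>z. J z * f (t *\<^sub>R z) \<partial>bulk.R) - (\<integral>z. J z * f z \<partial>bulk.R)) / (t - 1)\<bar> \<le>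
        sqrt ((\<integral>z. (J z)\<^sup>2 \<partial>bulk.R) * (\<integral>z. (norm (grad f z))\<^sup>2 \<partial>bulk.R))"
proof -
  have D: "((\<lambda>t. \<integral>z. J z * f (t *\<^sub>R z) \<partial>bulk.R) has_real_derivative (\<integral>z. J z * (grad f (t *\<^sub>R z) \<bullet> z) \<partial>bulk.R)) (at t)" for t
  proof -
    have "compact (grad f ` cball 0 (\<bar>t\<bar> + 1))"
      using f by (intro compact_continuous_image smooth_continuous_grad) auto
    then obtain C where C: "\<And>x. x \<in> cball 0 (\<bar>t\<bar> + 1) \<Longrightarrow> norm (grad f x) \<le> C"
      by (meson bounded_iff compact_imp_bounded imageI)
    show ?thesis
    proof (rule has_real_derivative_integral(1)[where e = 1 and g = "\<lambda>z. \<bar>J z\<bar> * C"])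
      show "integrable bulk.R (\<lambda>z. J z * f (r *\<^sub>R z))" for r
        by (intro integrable_mult_square_integrable J square_integrable_smooth(1) smooth_scale f)
      show "((\<lambda>t. J z * f (t *\<^sub>R z)) has_real_derivative J z * (grad f (r *\<^sub>R z) \<bullet> z)) (at r)" for r z
        by (intro DERIV_cmult DERIV_ray f)
      have "integrable bulk.R J"
        using square_integrable_inner[OF J bulk.square_integrable_continuous[of "\<lambda>_. 1::real"]] by simp
      then show "integrable bulk.R (\<lambda>z. \<bar>J z\<bar> * C)" by simp
      fix r :: real and z :: "(real ^ 'n) \<times> real"
      assume r: "\<bar>r - t\<bar> < 1" and "z \<in> space bulk.R"
      then have z: "norm z \<le> 1" using bulk.norm_less_1[of z] by simp
      have "\<bar>r\<bar> * norm z \<le> (\<bar>t\<bar> + 1) * 1" using r z by (intro mult_mono) auto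
      then have "norm (grad f (r *\<^sub>R z)) \<le> C" by (intro C) simp
      moreover have "\<bar>grad f (r *\<^sub>R z) \<bullet> z\<bar> \<le> norm (grad f (r *\<^sub>R z)) * 1"
        by (rule order_trans[OF Cauchy_Schwarz_ineq2]) (intro mult_left_mono z norm_ge_zero)
      ultimately show "\<bar>J z * (grad f (r *\<^sub>R z) \<bullet> z)\<bar> \<le> \<bar>J z\<bar> * C"
        by (simp add: abs_mult mult_left_mono)
    qed simp
  qed
  then show "((\<lambda>t. \<integral>z. J z * f (t *\<^sub>R z) \<partial>bulk.R) has_real_derivative (\<integral>z. J z * (grad f (t *\<^sub>R z) \<bullet> z) \<partial>bulk.R)) (at t)" .
  assume t: "1 < t" "t\<^sup>2 * s \<le> 1"
  obtain r where r: "1 < r" "r < t"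
    and mvt: "(\<integral>z. J z * f (t *\<^sub>R z) \<partial>bulk.R) - (\<integral>z. J z * f (1 *\<^sub>R z) \<partial>bulk.R) =
      (t - 1) * (\<integral>z. J z * (grad f (r *\<^sub>R z) \<bullet> z) \<partial>bulk.R)"
    using MVT2[OF t(1), of "\<lambda>t. \<integral>z. J z * f (t *\<^sub>R z) \<partial>bulk.R"
      "\<lambda>t. \<integral>z. J z * (grad f (t *\<^sub>R z) \<bullet> z) \<partial>bulk.R"] D by blast
  have rs: "r\<^sup>2 * s \<le> 1"
  proof (cases "0 \<le> s")
    case True
    then have "r\<^sup>2 * s \<le> t\<^sup>2 * s" using r by (intro mult_right_mono power_mono) auto
    then show ?thesis using t by simp
  next
    case False
    then show ?thesis by (smt (verit) mult_nonneg_nonpos zero_le_power2)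
  qed
  \<comment> \<open>J vanishes beyond s, so the gradient may be replaced by its truncated dilation,
    whose norm is controlled.\<close>
  define g where "g = dilate s r (grad f)"
  have g: "square_integrable bulk.R g" "(\<integral>z. (norm (g z))\<^sup>2 \<partial>bulk.R) \<le> (\<integral>z. (norm (grad f z))\<^sup>2 \<partial>bulk.R)"
    unfolding g_def
    by (rule bulk.square_integrable_dilate[OF square_integrable_smooth(2)[OF f]]; use r rs in simp)+
  have gm: "(\<lambda>z. g z \<bullet> z) \<in> borel_measurable bulk.R"
    using g(1) borel_measurable_bulk_id by (auto simp: square_integrable_def)
  have gb: "norm (v \<bullet> z) \<le> 1 * norm v" if "z \<in> space bulk.R" for v z :: "(real ^ 'n) \<times> real"
    using Cauchy_Schwarz_ineq2[of v z] bulk.norm_less_1[of z] that mult_left_mono[of "norm z" 1 "norm v"] by simp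
  have gz: "square_integrable bulk.R (\<lambda>z. g z \<bullet> z)"
    "(\<integral>z. (norm (g z \<bullet> z))\<^sup>2 \<partial>bulk.R) \<le> (\<integral>z. (norm (g z))\<^sup>2 \<partial>bulk.R)"
    using square_integrable_pointwise[OF g(1) gm gb] by simp_all
  have "(\<integral>z. J z * (grad f (r *\<^sub>R z) \<bullet> z) \<partial>bulk.R) = (\<integral>z. J z \<bullet> (g z \<bullet> z) \<partial>bulk.R)"
    by (intro Bochner_Integration.integral_cong) (use J0 in \<open>auto simp: g_def dilate_def\<close>)
  then have "(\<integral>z. J z * (grad f (r *\<^sub>R z) \<bullet> z) \<partial>bulk.R)\<^sup>2 \<le>
      (\<integral>z. (norm (J z))\<^sup>2 \<partial>bulk.R) * (\<integral>z. (norm (g z \<bullet> z))\<^sup>2 \<partial>bulk.R)"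
    using integral_inner_Cauchy_Schwarz[OF J gz(1)] by simp
  also have "\<dots> \<le> (\<integral>z. (norm (J z))\<^sup>2 \<partial>bulk.R) * (\<integral>z. (norm (grad f z))\<^sup>2 \<partial>bulk.R)"
    using gz(2) g(2) by (intro mult_left_mono) auto
  finally have "\<bar>\<integral>z. J z * (grad f (r *\<^sub>R z) \<bullet> z) \<partial>bulk.R\<bar> \<le>
      sqrt ((\<integral>z. (J z)\<^sup>2 \<partial>bulk.R) * (\<integral>z. (norm (grad f z))\<^sup>2 \<partial>bulk.R))"
    by (intro real_le_rsqrt) simp
  then show "\<bar>((\<integral>z. J z * f (t *\<^sub>R z) \<partial>bulk.R) - (\<integral>z. J z * f z \<partial>bulk.R)) / (t - 1)\<bar> \<le>
      sqrt ((\<integral>z. (J z)\<^sup>2 \<partial>bulk.R) * (\<integral>z. (norm (grad f z))\<^sup>2 \<partial>bulk.R))"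
    using mvt t(1) by simp
qed

text \<open>G is known only as a limit of gradients of approximants, so two limits have to be
  exchanged: in the index k, and in t decreasing to 1. The bound for smooth functions, applied to
  differences of approximants, makes the convergence in k uniform in t.\<close>

lemma dilation_quotient_tendsto:
  assumes ap: "approximates \<phi> u G" and J: "square_integrable bulk.R J"
    and J0: "\<And>z. s \<le> z \<bullet> z \<Longrightarrow> J z = 0" and s: "0 < s" "s < 1"
  shows "((\<lambda>t. ((\<integral>z. J z * u (t *\<^sub>R z) \<partial>bulk.R) - (\<integral>z. J z * u z \<partial>bulk.R)) / (t - 1)) \<longlongrightarrow>
    (\<integral>z. J z * (G z \<bullet> z) \<partial>bulk.R)) (at_right 1)"
proof -
  define S where "S = {t. 1 < t \<and> t\<^sup>2 * s \<le> 1}"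
  define X where "X h t = ((\<integral>z. J z * h (t *\<^sub>R z) \<partial>bulk.R) - (\<integral>z. J z * h z \<partial>bulk.R)) / (t - 1)" for h t
  define A where "A = (\<integral>z. (J z)\<^sup>2 \<partial>bulk.R)"
  have sm: "smooth (\<phi> k)" for k using ap by (simp add: approximates_def)
  have L: "L2_tendsto bulk.R \<phi> u" "L2_tendsto bulk.R (\<lambda>k. grad (\<phi> k)) G"
    using ap by (auto simp: approximates_def)
  have JL: "L2_tendsto bulk.R (\<lambda>_. J) J" using J by (rule L2_tendsto_const)
  have dil: "(\<integral>z. J z * h (t *\<^sub>R z) \<partial>bulk.R) = (\<integral>z. J z \<bullet> dilate s t h z \<partial>bulk.R)" for h t
    by (intro Bochner_Integration.integral_cong) (use J0 in \<open>auto simp: dilate_def\<close>)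
  have X_lim: "(\<lambda>k. X (\<phi> k) t) \<longlonglongrightarrow> X u t" if "t \<in> S" for t
  proof -
    have "(\<lambda>k. \<integral>z. J z * \<phi> k (t *\<^sub>R z) \<partial>bulk.R) \<longlonglongrightarrow> (\<integral>z. J z * u (t *\<^sub>R z) \<partial>bulk.R)"
      unfolding dil using that
      by (intro L2_tendsto_integral_inner[OF JL] bulk.L2_tendsto_dilate L) (auto simp: S_def)
    moreover have "(\<lambda>k. \<integral>z. J z * \<phi> k z \<partial>bulk.R) \<longlonglongrightarrow> (\<integral>z. J z * u z \<partial>bulk.R)"
      using L2_tendsto_integral_inner[OF JL L(1)] by simp
    ultimately show ?thesis
      unfolding X_def using that by (intro tendsto_intros) (auto simp: S_def)
  qed
  \<comment> \<open>The quotient is linear in its function, so the bound for \<phi>_j - \<phi>_k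
    measures the oscillation of the quotients in the index.\<close>
  have diff: "\<bar>X (\<phi> j) t - X (\<phi> k) t\<bar> \<le> sqrt (A * (\<integral>z. (norm (grad (\<phi> j) z - grad (\<phi> k) z))\<^sup>2 \<partial>bulk.R))" if "t \<in> S" for j k t
  proof -
    have i: "integrable bulk.R (\<lambda>z. J z * \<phi> k (r *\<^sub>R z))" for k r
      by (intro integrable_mult_square_integrable J square_integrable_smooth(1) smooth_scale sm)
    have "X (\<lambda>z. \<phi> j z - \<phi> k z) t = X (\<phi> j) t - X (\<phi> k) t"
      using i[of _ t] i[of _ 1] by (simp add: X_def right_diff_distrib diff_divide_distrib)
    moreover have "\<bar>X (\<lambda>z. \<phi> j z - \<phi> k z) t\<bar> \<le>
        sqrt (A * (\<integral>z. (norm (grad (\<lambda>z. \<phi> j z - \<phi> k z) z))\<^sup>2 \<partial>bulk.R))"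
      unfolding X_def A_def using that J0
      by (intro dilation_quotient_bound(2)[OF smooth_diff[OF sm sm] J]) (auto simp: S_def)
    ultimately show ?thesis by (simp add: grad_diff[OF sm sm])
  qed
  define d where "d k = (\<integral>z. (norm (grad (\<phi> k) z - G z))\<^sup>2 \<partial>bulk.R)" for k
  have bound: "\<bar>X (\<phi> k) t - X u t\<bar> \<le> sqrt (A * d k)" if "t \<in> S" for k t
  proof -
    have Lk: "L2_tendsto bulk.R (\<lambda>j z. grad (\<phi> j) z - grad (\<phi> k) z) (\<lambda>z. G z - grad (\<phi> k) z)"
      by (intro L2_tendsto_diff L L2_tendsto_const square_integrable_smooth sm)
    have "(\<lambda>j. \<integral>z. (norm (grad (\<phi> j) z - grad (\<phi> k) z))\<^sup>2 \<partial>bulk.R) \<longlonglongrightarrow> d k"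
      using L2_tendsto_integral_inner[OF Lk Lk]
      by (simp add: power2_norm_eq_inner[symmetric] d_def norm_minus_commute)
    then have "(\<lambda>j. sqrt (A * (\<integral>z. (norm (grad (\<phi> j) z - grad (\<phi> k) z))\<^sup>2 \<partial>bulk.R))) \<longlonglongrightarrow> sqrt (A * d k)"
      by (intro tendsto_intros)
    moreover have "(\<lambda>j. \<bar>X (\<phi> j) t - X (\<phi> k) t\<bar>) \<longlonglongrightarrow> \<bar>X u t - X (\<phi> k) t\<bar>"
      by (intro tendsto_intros X_lim that)
    ultimately have "\<bar>X u t - X (\<phi> k) t\<bar> \<le> sqrt (A * d k)"
      using diff[OF that] by (intro LIMSEQ_le[where X = "\<lambda>j. \<bar>X (\<phi> j) t - X (\<phi> k) t\<bar>"]) auto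
    then show ?thesis by (simp add: abs_minus_commute)
  qed
  have d0: "(\<lambda>k. sqrt (A * d k)) \<longlonglongrightarrow> 0"
    using tendsto_real_sqrt[OF tendsto_mult_right_zero[of d sequentially A]] L(2)
    by (simp add: L2_tendsto_def d_def[abs_def])
  have "uniform_limit S (\<lambda>k. X (\<phi> k)) (X u) sequentially"
  proof (rule uniform_limitI)
    fix e :: real assume "0 < e"
    from order_tendstoD(2)[OF d0 this]
    show "\<forall>\<^sub>F k in sequentially. \<forall>t\<in>S. dist (X (\<phi> k) t) (X u t) < e"
      by eventually_elim (auto simp: dist_real_def intro: order.strict_trans1[OF bound])
  qed
  moreover have "(X (\<phi> k) \<longlongrightarrow> (\<integral>z. J z * (grad (\<phi> k) z \<bullet> z) \<partial>bulk.R)) (at_right 1)" for k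
    using DERIV_at_right[OF dilation_quotient_bound(1)[OF sm[of k] J J0, where t = 1]] by (simp add: X_def[abs_def])
  moreover have "(\<lambda>k. \<integral>z. J z * (grad (\<phi> k) z \<bullet> z) \<partial>bulk.R) \<longlonglongrightarrow> (\<integral>z. J z * (G z \<bullet> z) \<partial>bulk.R)"
    using L2_tendsto_integral_inner[OF JL L2_tendsto_radial[OF L(2)]] by simp
  moreover have "\<forall>\<^sub>F t in at_right 1. t \<in> S"
  proof -
    have "((\<lambda>t::real. t\<^sup>2 * s) \<longlongrightarrow> 1\<^sup>2 * s) (at_right 1)" by (intro tendsto_intros)
    then have "\<forall>\<^sub>F t in at_right (1::real). t\<^sup>2 * s < 1" using s by (intro order_tendstoD(2)[of _ "1\<^sup>2 * s"]) auto
    moreover have "\<forall>\<^sub>F t in at_right (1::real). 1 < t" by (rule eventually_at_right_less)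
    ultimately show ?thesis by eventually_elim (simp add: S_def)
  qed
  ultimately have "(X u \<longlongrightarrow> (\<integral>z. J z * (G z \<bullet> z) \<partial>bulk.R)) (at_right 1)"
    by (intro swap_uniform_limit'[where f = "\<lambda>k. X (\<phi> k)" and F = sequentially and S = S]) auto
  then show ?thesis by (simp add: X_def[abs_def])
qed

end

section \<open>The frequency function\<close>

text \<open>A statement about functions of one real variable. The frequency s G / H is
  nondecreasing, hence bounded by its value at s1 for smaller s; this bounds the logarithmic
  derivative of H by K / s, and integrating towards 0 yields the power.\<close>

lemma frequency_lower_bound:
  fixes D B H T D' B' :: "real \<Rightarrow> real" and p N q :: real
  assumes p: "2 \<le> p" and q: "0 \<le> q" "q - 2 \<le> N"
    and D: "\<And>s. 0 < s \<Longrightarrow> s < 1 \<Longrightarrow> (D has_real_derivative D' s) (at s)"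
    and B: "\<And>s. 0 < s \<Longrightarrow> s < 1 \<Longrightarrow> (B has_real_derivative B' s) (at s)"
    and H: "\<And>s. 0 < s \<Longrightarrow> s < 1 \<Longrightarrow> (H has_real_derivative (D s + B s) / 2 + q / (2 * s) * H s) (at s)"
    and nonneg: "\<And>s. 0 \<le> D s" "\<And>s. 0 \<le> B s" "\<And>s. 0 \<le> H s"
    and pohozaev: "\<And>s. 0 < s \<Longrightarrow> s < 1 \<Longrightarrow>
      T s \<le> (2 - q) / 2 * D s + s * D' s - N / p * B s + 2 / p * s * B' s"
    and cauchy_schwarz: "\<And>s. 0 < s \<Longrightarrow> s < 1 \<Longrightarrow> (D s + B s)\<^sup>2 \<le> 2 / s * (H s * T s)"
    and s1: "0 < s1" "s1 < 1" "0 < H s1"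
  obtains c K where "0 < c" "\<And>s. 0 < s \<Longrightarrow> s \<le> s1 \<Longrightarrow> c * s powr K \<le> H s"
proof -
  define E where "E s = D s + B s" for s
  define G where "G s = D s + 2 / p * B s" for s
  \<comment> \<open>Since E \<le> p G / 2, the formula for H' gives s H' / H \<le> (p/4) (s G / H) +
    q/2, and K is the value of the right side at s1. The constant c makes the final bound an
    equality at s1.\<close>
  define K where "K = p / 4 * (s1 * G s1 / H s1) + q / 2"
  define c where "c = H s1 * s1 powr - K"
  have c: "0 < c" using s1 by (simp add: c_def)
  have GE: "0 \<le> G s" "G s \<le> E s" "E s \<le> p / 2 * G s" for s
  proof -
    have "2 / p * B s \<le> 1 * B s" using p nonneg by (intro mult_right_mono) auto
    then show "G s \<le> E s" by (simp add: G_def E_def)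
    show "0 \<le> G s" using p nonneg by (simp add: G_def)
    have "1 * D s \<le> p / 2 * D s" using p nonneg by (intro mult_right_mono) auto
    then show "E s \<le> p / 2 * G s" using p by (simp add: G_def E_def field_simps)
  qed
  \<comment> \<open>The quotient divides by H, so positivity on all of [s, s1] is a premise here and
    in \<open>lower\<close>; \<open>pos\<close> discharges it.\<close>
  have mono: "s * G s / H s \<le> s1 * G s1 / H s1" if s: "0 < s" "s \<le> s1" and pos: "\<And>x. s \<le> x \<Longrightarrow> x \<le> s1 \<Longrightarrow> 0 < H x" for s
  proof (rule DERIV_nonneg_imp_nondecreasing[OF s(2), of "\<lambda>s. s * G s / H s"])
    fix x assume x: "s \<le> x" "x \<le> s1"
    then have x': "0 < x" "x < 1" "0 < H x" using s s1 pos by auto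
    define G' where "G' = D' x + 2 / p * B' x"
    have dG: "(G has_real_derivative G') (at x)"
      unfolding G_def[abs_def] G'_def using D[OF x'(1,2)] B[OF x'(1,2)] by (intro DERIV_add DERIV_cmult)
    \<comment> \<open>Completing D to G costs the term (q - 2) B / p, which the Pohozaev term N B /
      p absorbs because q - 2 \<le> N.\<close>
    have "T x + (q - 2) / 2 * G x \<le> x * G'"
    proof -
      define b b' where "b = B x / p" "b' = B' x / p"
      then have eq: "B x = p * b" "B' x = p * b'" using p by auto
      have "(q - 2) * b \<le> N * b"
        using q p nonneg by (intro mult_right_mono) (auto simp: b_b'_def)
      moreover have "T x \<le> (2 - q) / 2 * D x + x * D' x - N * b + 2 * x * b'"
        using pohozaev[OF x'(1,2)] p by (simp add: eq)
      moreover have "G x = D x + 2 * b" "x * G' = x * D' x + 2 * x * b'"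
        using p by (simp_all add: G_def G'_def eq algebra_simps)
      ultimately show ?thesis by (simp add: field_simps)
    qed
    then have "T x + q / 2 * G x \<le> G x + x * G'" by (simp add: field_simps)
    then have 1: "H x * (T x + q / 2 * G x) \<le> H x * (G x + x * G')"
      using x' by (intro mult_left_mono) auto
    \<comment> \<open>The derivative of the quotient contains the product G E, whereas
      Cauchy-Schwarz controls E^2; G \<le> E, that is p >= 2, closes the gap.\<close>
    have "x / 2 * (G x * E x) \<le> x / 2 * (E x * E x)"
      using x' GE[of x] by (intro mult_left_mono mult_right_mono) auto
    also have "\<dots> \<le> H x * T x"
      using cauchy_schwarz[OF x'(1,2)] x' by (simp add: E_def power2_eq_square field_simps)
    finally have 2: "x / 2 * (G x * E x) \<le> H x * T x" .
    have "x * G x * (E x / 2 + q / (2 * x) * H x) = x / 2 * (G x * E x) + H x * (q / 2 * G x)"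
      using x' by (simp add: field_simps)
    with 1 2 have "0 \<le> (G x + x * G') * H x - x * G x * (E x / 2 + q / (2 * x) * H x)"
      by (simp add: algebra_simps)
    then have "0 \<le> ((G x + x * G') * H x - x * G x * (E x / 2 + q / (2 * x) * H x)) / (H x * H x)"
      using x' by simp
    moreover have "((\<lambda>s. s * G s / H s) has_real_derivative
        ((G x + x * G') * H x - x * G x * (E x / 2 + q / (2 * x) * H x)) / (H x * H x)) (at x)"
      unfolding E_def using dG H[OF x'(1,2)] x' by (auto intro!: derivative_eq_intros)
    ultimately show "\<exists>y. ((\<lambda>s. s * G s / H s) has_real_derivative y) (at x) \<and> 0 \<le> y" by blast
  qed
  have lower: "c * s powr K \<le> H s" if s: "0 < s" "s \<le> s1" and pos: "\<And>x. s \<le> x \<Longrightarrow> x \<le> s1 \<Longrightarrow> 0 < H x" for s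
  proof -
    have "H s1 * s1 powr - K \<le> H s * s powr - K"
    proof (rule DERIV_nonpos_imp_nonincreasing[OF s(2), of "\<lambda>s. H s * s powr - K"])
      fix x assume x: "s \<le> x" "x \<le> s1"
      then have x': "0 < x" "x < 1" "0 < H x" using s s1 pos by auto
      have "x * G x / H x \<le> s1 * G s1 / H s1"
        using mono[OF x'(1) x(2)] pos x by auto
      then have "p / 4 * (x * G x / H x) \<le> p / 4 * (s1 * G s1 / H s1)"
        using p by (intro mult_left_mono) auto
      then have "(p / 4 * (x * G x / H x) + q / 2) * (H x / x) \<le> K * (H x / x)"
        unfolding K_def using x' by (intro mult_right_mono) auto
      moreover have "(p / 4 * (x * G x / H x) + q / 2) * (H x / x) = p / 4 * G x + q / (2 * x) * H x"
        using x' by (simp add: field_simps)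
      ultimately have le: "E x / 2 + q / (2 * x) * H x \<le> K * (H x / x)"
        using GE(3)[of x] by linarith
      have "((\<lambda>s. H s * s powr - K) has_real_derivative
          ((E x / 2 + q / (2 * x) * H x) - K * (H x / x)) * x powr - K) (at x)"
        unfolding E_def using H[OF x'(1,2)] x'
        by (auto intro!: derivative_eq_intros simp: powr_diff field_simps)
      moreover have "((E x / 2 + q / (2 * x) * H x) - K * (H x / x)) * x powr - K \<le> 0"
        using le by (intro mult_nonpos_nonneg) auto
      ultimately show "\<exists>y. ((\<lambda>s. H s * s powr - K) has_real_derivative y) (at x) \<and> y \<le> 0" by blast
    qed
    then have "c * s powr K \<le> H s * s powr - K * s powr K"
      unfolding c_def by (intro mult_right_mono) auto
    also have "\<dots> = H s" using s by (simp add: mult.assoc flip: powr_add)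
    finally show ?thesis .
  qed
  \<comment> \<open>A zero of H in [s, s1] would give a largest one, s0. To its right H is positive,
    so the power bound holds there and passes to s0 by continuity, where it contradicts H s0 =
    0.\<close>
  have pos: "0 < H s" if s: "0 < s" "s \<le> s1" for s
  proof (rule ccontr)
    assume "\<not> 0 < H s"
    then have Hs: "H s = 0" using nonneg(3)[of s] by simp
    have cont: "continuous_on {s..s1} H"
      using s s1 H by (intro continuous_at_imp_continuous_on ballI DERIV_isCont[OF H]) auto
    define Z where "Z = {x \<in> {s..s1}. H x = 0}"
    have "closed Z"
      unfolding Z_def using continuous_closed_preimage[OF cont, of "{0}"] by (simp add: vimage_def Int_def)
    moreover have "bounded Z" by (rule bounded_subset[of "{s..s1}"]) (auto simp: Z_def)
    ultimately have "compact Z" by (simp add: compact_eq_bounded_closed)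
    moreover have "Z \<noteq> {}" using Hs s by (auto simp: Z_def)
    ultimately obtain s0 where s0: "s0 \<in> Z" "\<And>x. x \<in> Z \<Longrightarrow> x \<le> s0"
      by (meson compact_attains_sup)
    have s0': "0 < s0" "s0 < s1" "H s0 = 0" "s \<le> s0"
    proof -
      have *: "s \<le> s0" "s0 \<le> s1" "H s0 = 0" using s0(1) by (simp_all add: Z_def)
      moreover have "s0 \<noteq> s1" using * s1 by force
      ultimately show "0 < s0" "s0 < s1" "H s0 = 0" "s \<le> s0" using s by simp_all
    qed
    have Hpos: "0 < H x" if "s0 < x" "x \<le> s1" for x
    proof -
      have "x \<notin> Z" using s0(2)[of x] that by auto
      then have "H x \<noteq> 0" using that s0' by (simp add: Z_def)
      then show ?thesis using nonneg(3)[of x] by simp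
    qed
    have "\<forall>\<^sub>F x in at_right s0. c * x powr K \<le> H x"
    proof (rule eventually_at_rightI[OF _ s0'(2)])
      show "c * x powr K \<le> H x" if "x \<in> {s0<..<s1}" for x
        by (rule lower) (use that s0' Hpos in auto)
    qed
    moreover have "(H \<longlongrightarrow> H s0) (at_right s0)"
    proof (rule tendsto_mono[OF at_le[OF subset_UNIV]])
      show "(H \<longlongrightarrow> H s0) (at s0)"
        using DERIV_isCont[OF H[of s0]] s0' s1 by (simp add: isCont_def)
    qed
    moreover have "((\<lambda>x. c * x powr K) \<longlongrightarrow> c * s0 powr K) (at_right s0)"
      using s0' by (auto intro!: tendsto_intros)
    ultimately have "c * s0 powr K \<le> H s0"
      by (intro tendsto_le[of "at_right s0" H _ "\<lambda>x. c * x powr K"]) auto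
    moreover have "0 < c * s0 powr K" using c s0' by simp
    ultimately show False using s0' by simp
  qed
  show ?thesis
    by (rule that[OF c lower]) (use pos in auto)
qed

section \<open>Weak solutions\<close>

text \<open>Records what the frequency argument takes from the equation: the identities for the test
  functions \<theta>_s u and \<theta>_s (u(t z) - u), with one fixed choice of gradient G and trace
  v.\<close>

locale weak_solution = degenerate_weight a dim
  for a :: real and dim :: "'n::finite itself" +
  fixes p lm lp :: real and u :: "(real ^ 'n) \<times> real \<Rightarrow> real"
    and G :: "(real ^ 'n) \<times> real \<Rightarrow> (real ^ 'n) \<times> real" and v :: "real ^ 'n \<Rightarrow> real"
    and \<phi> :: "nat \<Rightarrow> (real ^ 'n) \<times> real \<Rightarrow> real"
  assumes p: "2 \<le> p" and lm: "0 \<le> lm" and lp: "0 \<le> lp"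
    and ap: "approximates \<phi> u G" and v: "v \<in> Lp p (flat_ball 1)"
    and test: "\<And>s. 0 < s \<Longrightarrow> s < 1 \<Longrightarrow>
      (\<integral>z. G z \<bullet> cutoff_grad s 1 u G z \<partial>bulk.R) = (\<integral>x. flux p lm lp (v x) * (cutoff 0 s x * v x) \<partial>flat.R)"
    and test_scaled_integrable: "\<And>s t. 0 < s \<Longrightarrow> 1 \<le> t \<Longrightarrow> t\<^sup>2 * s < 1 \<Longrightarrow>
      integrable flat.R (\<lambda>x. flux p lm lp (v x) * (cutoff 0 s x * v (t *\<^sub>R x) - cutoff 0 s x * v x))"
    and test_scaled: "\<And>s t. 0 < s \<Longrightarrow> 1 \<le> t \<Longrightarrow> t\<^sup>2 * s < 1 \<Longrightarrow>
      (\<integral>z. G z \<bullet> (cutoff_grad s t u G z - cutoff_grad s 1 u G z) \<partial>bulk.R) =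
      (\<integral>x. flux p lm lp (v x) * (cutoff 0 s x * v (t *\<^sub>R x) - cutoff 0 s x * v x) \<partial>flat.R)"
begin

definition D where "D s = (\<integral>z. (norm (G z))\<^sup>2 * cutoff 0 s z \<partial>bulk.R)"
definition B where "B s = (\<integral>x. potential p lm lp (v x) * cutoff 0 s x \<partial>flat.R)"
definition H where "H s = (\<integral>z. (u z)\<^sup>2 * cutoff 2 s z \<partial>bulk.R)"
text \<open>The smoothed counterpart of the spherical integral of the squared normal derivative; the
  factor 2/s comes from the gradient of the cutoff.\<close>

definition T where "T s = 2 / s * (\<integral>z. (G z \<bullet> z)\<^sup>2 * cutoff 2 s z \<partial>bulk.R)"

section \<open>Integral identities and derivatives for the frequency\<close>

lemma square_integrable_u: "square_integrable bulk.R u"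
  and square_integrable_G: "square_integrable bulk.R G"
  using ap by (auto simp: approximates_def L2_tendsto_def)

lemma square_integrable_radial: "square_integrable bulk.R (\<lambda>z. G z \<bullet> z)"
  using L2_tendsto_radial[OF L2_tendsto_const[OF square_integrable_G]] by (simp add: L2_tendsto_def)

lemma square_integrable_cutoff:
  assumes "square_integrable bulk.R f" "0 < s" "1 \<le> t" "t\<^sup>2 * s < 1"
  shows "square_integrable bulk.R (\<lambda>z. cutoff m s z *\<^sub>R f (t *\<^sub>R z))"
  using L2_tendsto_cutoff_scale(1)[OF assms(2-4) L2_tendsto_const[OF assms(1)]] by (simp add: L2_tendsto_def)

lemma integrable_potential: "integrable flat.R (\<lambda>x. potential p lm lp (v x))"
proof (rule Bochner_Integration.integrable_bound)
  show "integrable flat.R (\<lambda>x. (lm + lp) * \<bar>v x\<bar> powr p)"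
    using v by (simp add: Lp_def)
  have [measurable]: "v \<in> borel_measurable flat.R" using v by (simp add: Lp_def)
  show "(\<lambda>x. potential p lm lp (v x)) \<in> borel_measurable flat.R"
    unfolding potential_def by measurable
  have "potential p lm lp t \<le> (lm + lp) * \<bar>t\<bar> powr p" for t
    unfolding potential_def distrib_right using p lm lp
    by (intro add_mono mult_left_mono powr_mono2) auto
  then show "AE x in flat.R. norm (potential p lm lp (v x)) \<le> norm ((lm + lp) * \<bar>v x\<bar> powr p)"
    using lm lp by (simp add: potential_nonneg)
qed

lemma nonneg: "0 \<le> D s" "0 \<le> B s" "0 \<le> H s"
  using lm lp by (auto simp: D_def B_def H_def potential_nonneg)

lemma DERIV_D: "0 < s \<Longrightarrow> (D has_real_derivative
    (\<integral>z. (norm (G z))\<^sup>2 * (cutoff' 0 s z * ((z \<bullet> z) / s\<^sup>2)) \<partial>bulk.R)) (at s)"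
  unfolding D_def[abs_def] using square_integrable_G
  by (intro bulk.DERIV_integral_cutoff) (auto simp: square_integrable_def)

lemma DERIV_B: "0 < s \<Longrightarrow> (B has_real_derivative
    (\<integral>x. potential p lm lp (v x) * (cutoff' 0 s x * ((x \<bullet> x) / s\<^sup>2)) \<partial>flat.R)) (at s)"
  unfolding B_def[abs_def] by (intro flat.DERIV_integral_cutoff integrable_potential)

text \<open>The gradient of \<theta>_s is -(2/s) k_s z, so the term of the tested equation in which
  the cutoff is differentiated pairs u with its radial derivative; on the flat ball, flux times v
  gives -B.\<close>

lemma energy_identity:
  assumes s: "0 < s" "s < 1"
  shows "D s + B s = 2 / s * (\<integral>z. (cutoff 2 s z * u z) * (G z \<bullet> z) \<partial>bulk.R)"
proof -
  have s': "(1::real)\<^sup>2 * s < 1" using s by simp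
  note sq = square_integrable_cutoff[OF _ s(1) order_refl s']
  have i1: "integrable bulk.R (\<lambda>z. G z \<bullet> (cutoff 0 s z *\<^sub>R G z))"
    using sq[OF square_integrable_G] by (intro square_integrable_inner square_integrable_G) simp
  have i2: "integrable bulk.R (\<lambda>z. (cutoff 2 s z * u z) * (G z \<bullet> z))"
    using sq[OF square_integrable_u] by (intro integrable_mult_square_integrable square_integrable_radial) simp
  have "G z \<bullet> cutoff_grad s 1 u G z = G z \<bullet> (cutoff 0 s z *\<^sub>R G z) - 2 / s * ((cutoff 2 s z * u z) * (G z \<bullet> z))" for z
    by (simp add: cutoff_grad_def inner_add inner_diff algebra_simps)
  then have "(\<integral>z. G z \<bullet> cutoff_grad s 1 u G z \<partial>bulk.R) =
      D s - 2 / s * (\<integral>z. (cutoff 2 s z * u z) * (G z \<bullet> z) \<partial>bulk.R)"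
    using i1 i2 by (simp add: D_def power2_norm_eq_inner mult.commute)
  moreover have "flux p lm lp (v x) * (cutoff 0 s x * v x) = - (potential p lm lp (v x) * cutoff 0 s x)" for x
    unfolding mult.left_commute[of "flux p lm lp (v x)"] flux_mult_self by simp
  ultimately show ?thesis
    using test[OF s] by (simp add: B_def)
qed

text \<open>Differentiating k_s in s and integrating k_s u^2 by parts radially both differentiate
  the profile once and produce the same integral \<open>I\<close>. Eliminating it leaves H and the
  integral P, which \<open>energy_identity\<close> evaluates.\<close>

lemma DERIV_H:
  assumes s: "0 < s" "s < 1"
  shows "(H has_real_derivative (D s + B s) / 2 + (real CARD('n) + 1 + a) / (2 * s) * H s) (at s)"
proof -
  define I where "I = (\<integral>z. (cutoff' 2 s z * (z \<bullet> z) * u z) * u z \<partial>bulk.R)"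
  define P where "P = (\<integral>z. (cutoff 2 s z * u z) * (G z \<bullet> z) \<partial>bulk.R)"
  have "(H has_real_derivative (\<integral>z. (u z)\<^sup>2 * (cutoff' 2 s z * ((z \<bullet> z) / s\<^sup>2)) \<partial>bulk.R)) (at s)"
    unfolding H_def[abs_def] using square_integrable_u s
    by (intro bulk.DERIV_integral_cutoff) (auto simp: square_integrable_def)
  moreover have "(\<integral>z. (u z)\<^sup>2 * (cutoff' 2 s z * ((z \<bullet> z) / s\<^sup>2)) \<partial>bulk.R) = I / s\<^sup>2"
    unfolding I_def by (subst integral_divide_zero[symmetric]) (simp add: power2_eq_square mult_ac)
  moreover have "2 * P - 2 / s * I = - (real CARD('n) + 1 + a) * H s"
    using integral_square_cutoff_radial[OF s ap, of 2]
    by (simp add: I_def P_def H_def power2_eq_square mult_ac)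
  then have "I / s\<^sup>2 = P / s + (real CARD('n) + 1 + a) / (2 * s) * H s"
    using s by (simp add: field_simps power2_eq_square)
  moreover have "P / s = (D s + B s) / 2"
    using energy_identity[OF s] by (simp add: P_def)
  ultimately show ?thesis by simp
qed

lemma energy_Cauchy_Schwarz:
  assumes s: "0 < s" "s < 1"
  shows "(D s + B s)\<^sup>2 \<le> 2 / s * (H s * T s)"
proof -
  \<comment> \<open>The square root distributes the weight evenly, so that both squared factors
    carry k_s, the weight of H and of T.\<close>
  define r where "r z = sqrt (cutoff 2 s z)" for z :: "(real ^ 'n) \<times> real"
  have r: "continuous_on UNIV r" "r z * r z = cutoff 2 s z" for z
    by (auto simp: r_def[abs_def] intro!: continuous_intros)
  have rb: "r \<in> borel_measurable bulk.R" "\<bar>r z\<bar> \<le> sqrt (fact 2)" for z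
  proof -
    show "r \<in> borel_measurable bulk.R"
      using r(1) by (intro bulk.borel_measurable_R borel_measurable_continuous_onI)
    show "\<bar>r z\<bar> \<le> sqrt (fact 2)" using cutoff_le_fact[of 2 s z] by (simp add: r_def)
  qed
  have "square_integrable bulk.R (\<lambda>z. r z *\<^sub>R u z)" "square_integrable bulk.R (\<lambda>z. r z *\<^sub>R (G z \<bullet> z))"
    by (rule square_integrable_mult[OF _ rb]; fact square_integrable_u square_integrable_radial)+
  from integral_inner_Cauchy_Schwarz[OF this]
  have "(\<integral>z. (cutoff 2 s z * u z) * (G z \<bullet> z) \<partial>bulk.R)\<^sup>2 \<le> H s * (\<integral>z. (G z \<bullet> z)\<^sup>2 * cutoff 2 s z \<partial>bulk.R)"
    by (simp add: H_def r(2)[symmetric] power2_eq_square mult_ac)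
  then have "(2 / s)\<^sup>2 * (\<integral>z. (cutoff 2 s z * u z) * (G z \<bullet> z) \<partial>bulk.R)\<^sup>2 \<le>
      (2 / s)\<^sup>2 * (H s * (\<integral>z. (G z \<bullet> z)\<^sup>2 * cutoff 2 s z \<partial>bulk.R))"
    by (intro mult_left_mono) auto
  then show ?thesis
    unfolding energy_identity[OF s] power_mult_distrib T_def by (simp add: power2_eq_square mult_ac)
qed

text \<open>Dilating moves the cutoff from s to t^2 s, and the homogeneity of the two measures
  contributes the powers of t.\<close>

lemma scaled_energy:
  assumes s: "0 < s" and t: "1 \<le> t" "t\<^sup>2 * s < 1"
  shows "(\<integral>z. cutoff 0 s z * (norm (G (t *\<^sub>R z)))\<^sup>2 \<partial>bulk.R) = t powr - (real CARD('n) + 1 + a) * D (t\<^sup>2 * s)"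
    and "integrable bulk.R (\<lambda>z. cutoff 0 s z * (norm (G (t *\<^sub>R z)))\<^sup>2)"
    and "(\<integral>x. cutoff 0 s x * potential p lm lp (v (t *\<^sub>R x)) \<partial>flat.R) = t powr - real CARD('n) * B (t\<^sup>2 * s)"
    and "integrable flat.R (\<lambda>x. cutoff 0 s x * potential p lm lp (v (t *\<^sub>R x)))"
proof -
  have ts: "0 < t\<^sup>2 * s" using s t by simp
  have 1: "1 \<le> z \<bullet> z" if "1 \<le> norm z" for z :: "'b::real_inner"
    using one_le_power[OF that, of 2] by (simp add: power2_norm_eq_inner)
  have c: "cutoff 0 (t\<^sup>2 * s) (t *\<^sub>R z) = cutoff 0 s z" for z :: "'b::real_inner"
    using cutoff_rescale[of t 0 s z] t by simp
  define f where "f z = (norm (G z))\<^sup>2 * cutoff 0 (t\<^sup>2 * s) z" for z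
  have f: "integrable bulk.R f"
    unfolding f_def using square_integrable_G
    by (intro bulk.integrable_mult_cutoff) (auto simp: square_integrable_def)
  have f0: "1 \<le> norm z \<Longrightarrow> f z = 0" for z
    using cutoff_eq_0[OF ts, of z 0] 1[of z] t by (simp add: f_def)
  have ft: "f (t *\<^sub>R z) = cutoff 0 s z * (norm (G (t *\<^sub>R z)))\<^sup>2" for z
    using c[of z] by (simp add: f_def)
  show "(\<integral>z. cutoff 0 s z * (norm (G (t *\<^sub>R z)))\<^sup>2 \<partial>bulk.R) = t powr - (real CARD('n) + 1 + a) * D (t\<^sup>2 * s)"
    using bulk.integral_scaled[OF f f0 t(1)] by (simp add: ft) (simp add: f_def[abs_def] D_def)
  show "integrable bulk.R (\<lambda>z. cutoff 0 s z * (norm (G (t *\<^sub>R z)))\<^sup>2)"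
    using bulk.integrable_scaled[OF f f0 t(1)] by (simp add: ft)
  define g where "g x = potential p lm lp (v x) * cutoff 0 (t\<^sup>2 * s) x" for x
  have g: "integrable flat.R g"
    unfolding g_def by (intro flat.integrable_mult_cutoff integrable_potential)
  have g0: "1 \<le> norm x \<Longrightarrow> g x = 0" for x
    using cutoff_eq_0[OF ts, of x 0] 1[of x] t by (simp add: g_def)
  have gt: "g (t *\<^sub>R x) = cutoff 0 s x * potential p lm lp (v (t *\<^sub>R x))" for x
    using c[of x] by (simp add: g_def)
  show "(\<integral>x. cutoff 0 s x * potential p lm lp (v (t *\<^sub>R x)) \<partial>flat.R) = t powr - real CARD('n) * B (t\<^sup>2 * s)"
    using flat.integral_scaled[OF g g0 t(1)] by (simp add: gt) (simp add: g_def[abs_def] B_def)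
  show "integrable flat.R (\<lambda>x. cutoff 0 s x * potential p lm lp (v (t *\<^sub>R x)))"
    using flat.integrable_scaled[OF g g0 t(1)] by (simp add: gt)
qed

text \<open>In the identity tested with \<theta>_s (u(t z) - u), the mixed term t G(z) . G(t z) is
  at most half the sum of the two squares, and the subgradient inequality bounds the boundary term
  from below. Both estimates bound the remaining part, which comes from the gradient of the cutoff,
  from above.\<close>

lemma scaled_comparison:
  assumes s: "0 < s" and t: "1 < t" "t\<^sup>2 * s < 1"
  defines "J \<equiv> \<lambda>z. cutoff 2 s z * (G z \<bullet> z)"
  shows "2 / s * ((\<integral>z. J z * u (t *\<^sub>R z) \<partial>bulk.R) - (\<integral>z. J z * u z \<partial>bulk.R)) \<le>
    (t\<^sup>2 * (t powr - (real CARD('n) + 1 + a) * D (t\<^sup>2 * s)) - D s) / 2 +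
    (t powr - real CARD('n) * B (t\<^sup>2 * s) - B s) / p"
proof -
  have t1: "1 \<le> t" using t by simp
  have "1\<^sup>2 * s \<le> t\<^sup>2 * s" using s t1 by (intro mult_right_mono power_mono) auto
  then have s1: "(1::real)\<^sup>2 * s < 1" using t by simp
  note sq = square_integrable_cutoff[OF _ s]
  have i1: "integrable bulk.R (\<lambda>z. t * (G z \<bullet> (cutoff 0 s z *\<^sub>R G (t *\<^sub>R z))))"
    by (intro integrable_mult_right square_integrable_inner square_integrable_G sq t1 t)
  have i2: "integrable bulk.R (\<lambda>z. (norm (G z))\<^sup>2 * cutoff 0 s z)"
    using square_integrable_G by (intro bulk.integrable_mult_cutoff) (auto simp: square_integrable_def)
  have i3: "integrable bulk.R (\<lambda>z. J z * u (r *\<^sub>R z))" if "1 \<le> r" "r\<^sup>2 * s < 1" for r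
    using integrable_mult_square_integrable[OF square_integrable_radial sq[OF square_integrable_u that, of 2]]
    by (simp add: J_def mult_ac)
  note i4 = scaled_energy(2)[OF s t1 t(2)]
  have eq: "G z \<bullet> (cutoff_grad s t u G z - cutoff_grad s 1 u G z) =
      (t * (G z \<bullet> (cutoff 0 s z *\<^sub>R G (t *\<^sub>R z))) - (norm (G z))\<^sup>2 * cutoff 0 s z)
      - (2 / s * (J z * u (t *\<^sub>R z)) - 2 / s * (J z * u (1 *\<^sub>R z)))" for z
    unfolding cutoff_grad_def J_def power2_norm_eq_inner
    by (simp add: inner_add inner_diff algebra_simps)
  have "(\<integral>z. G z \<bullet> (cutoff_grad s t u G z - cutoff_grad s 1 u G z) \<partial>bulk.R) =
      (\<integral>z. t * (G z \<bullet> (cutoff 0 s z *\<^sub>R G (t *\<^sub>R z))) \<partial>bulk.R) - D s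
      - 2 / s * ((\<integral>z. J z * u (t *\<^sub>R z) \<partial>bulk.R) - (\<integral>z. J z * u z \<partial>bulk.R))"
  proof -
    have "integrable bulk.R (\<lambda>z. 2 / s * (J z * u (t *\<^sub>R z)))" "integrable bulk.R (\<lambda>z. 2 / s * (J z * u (1 *\<^sub>R z)))"
      using i3[OF t1 t(2)] i3[OF order_refl s1] by simp_all
    then show ?thesis
      unfolding eq D_def using i1 i2 by (simp only: Bochner_Integration.integral_diff
          Bochner_Integration.integrable_diff integral_mult_right_zero right_diff_distrib scaleR_one)
  qed
  moreover have "(\<integral>z. t * (G z \<bullet> (cutoff 0 s z *\<^sub>R G (t *\<^sub>R z))) \<partial>bulk.R) \<le>
      (\<integral>z. t\<^sup>2 / 2 * (cutoff 0 s z * (norm (G (t *\<^sub>R z)))\<^sup>2) + 1 / 2 * ((norm (G z))\<^sup>2 * cutoff 0 s z) \<partial>bulk.R)"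
  proof (intro integral_mono i1 Bochner_Integration.integrable_add integrable_mult_right i2 i4)
    fix z
    have "t * (G z \<bullet> G (t *\<^sub>R z)) \<le> norm (G z) * (t * norm (G (t *\<^sub>R z)))"
      using t1 mult_left_mono[OF norm_cauchy_schwarz[of "G z" "G (t *\<^sub>R z)"], of t] by (simp add: mult_ac)
    also have "\<dots> \<le> t\<^sup>2 / 2 * (norm (G (t *\<^sub>R z)))\<^sup>2 + 1 / 2 * (norm (G z))\<^sup>2"
      using sum_squares_bound[of "norm (G z)" "t * norm (G (t *\<^sub>R z))"] by (simp add: power_mult_distrib)
    finally have "cutoff 0 s z * (t * (G z \<bullet> G (t *\<^sub>R z))) \<le>
        cutoff 0 s z * (t\<^sup>2 / 2 * (norm (G (t *\<^sub>R z)))\<^sup>2 + 1 / 2 * (norm (G z))\<^sup>2)"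
      by (intro mult_left_mono) auto
    then show "t * (G z \<bullet> (cutoff 0 s z *\<^sub>R G (t *\<^sub>R z))) \<le>
        t\<^sup>2 / 2 * (cutoff 0 s z * (norm (G (t *\<^sub>R z)))\<^sup>2) + 1 / 2 * ((norm (G z))\<^sup>2 * cutoff 0 s z)"
      by (simp add: algebra_simps)
  qed
  moreover have "\<dots> = (t\<^sup>2 * (t powr - (real CARD('n) + 1 + a) * D (t\<^sup>2 * s)) + D s) / 2"
    using i2 i4 scaled_energy(1)[OF s t1 t(2)] by (simp add: D_def add_divide_distrib)
  moreover have "- ((t powr - real CARD('n) * B (t\<^sup>2 * s) - B s) / p) \<le>
      (\<integral>x. flux p lm lp (v x) * (cutoff 0 s x * v (t *\<^sub>R x) - cutoff 0 s x * v x) \<partial>flat.R)"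
  proof -
    have j: "integrable flat.R (\<lambda>x. potential p lm lp (v x) * cutoff 0 s x)"
      by (intro flat.integrable_mult_cutoff integrable_potential)
    note k = scaled_energy(4)[OF s t1 t(2)]
    have "- ((t powr - real CARD('n) * B (t\<^sup>2 * s) - B s) / p) =
        (\<integral>x. - ((cutoff 0 s x * potential p lm lp (v (t *\<^sub>R x)) - potential p lm lp (v x) * cutoff 0 s x) / p) \<partial>flat.R)"
      using j k scaled_energy(3)[OF s t1 t(2)] by (simp add: B_def)
    also have "\<dots> \<le> (\<integral>x. flux p lm lp (v x) * (cutoff 0 s x * v (t *\<^sub>R x) - cutoff 0 s x * v x) \<partial>flat.R)"
    proof (rule integral_mono)
      show "integrable flat.R (\<lambda>x. - ((cutoff 0 s x * potential p lm lp (v (t *\<^sub>R x)) - potential p lm lp (v x) * cutoff 0 s x) / p))"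
        using j k by simp
      show "integrable flat.R (\<lambda>x. flux p lm lp (v x) * (cutoff 0 s x * v (t *\<^sub>R x) - cutoff 0 s x * v x))"
        by (rule test_scaled_integrable[OF s t1 t(2)])
      fix x
      have "cutoff 0 s x * (- flux p lm lp (v x) * (v (t *\<^sub>R x) - v x)) \<le>
          cutoff 0 s x * ((potential p lm lp (v (t *\<^sub>R x)) - potential p lm lp (v x)) / p)"
        using flux_subgradient[OF p lm lp] by (intro mult_left_mono) auto
      then show "- ((cutoff 0 s x * potential p lm lp (v (t *\<^sub>R x)) - potential p lm lp (v x) * cutoff 0 s x) / p)
          \<le> flux p lm lp (v x) * (cutoff 0 s x * v (t *\<^sub>R x) - cutoff 0 s x * v x)"
        by (simp add: algebra_simps)
    qed
    finally show ?thesis .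
  qed
  \<comment> \<open>The bookkeeping in isolation: the tested identity says X = I - d - R, and the
    bounds on I and R are inserted.\<close>
  moreover have "X \<le> (A - d) / 2 + Y"
    if "L = I - d - X" "I \<le> I'" "I' = (A + d) / 2" "- Y \<le> R" "L = R" for L I I' A d X Y R :: real
    using that by argo
  ultimately show ?thesis
    using test_scaled[OF s t1 t(2)] by blast
qed

text \<open>Both sides of \<open>scaled_comparison\<close> vanish at t = 1. After division by t - 1
  > 0, the left side tends to T as t decreases to 1 and the right side to its derivative at 1; the
  powers of t produce the multiples of D and B, and the parameter t^2 s produces D' and B'.\<close>

lemma pohozaev:
  assumes s: "0 < s" "s < 1" and D': "(D has_real_derivative D') (at s)" and B': "(B has_real_derivative B') (at s)"
  shows "T s \<le> (2 - (real CARD('n) + 1 + a)) / 2 * D s + s * D' - real CARD('n) / p * B s + 2 / p * s * B'"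
proof -
  define Q where "Q = real CARD('n) + 1 + a"
  define J where "J z = cutoff 2 s z * (G z \<bullet> z)" for z
  define X where "X t = ((\<integral>z. J z * u (t *\<^sub>R z) \<partial>bulk.R) - (\<integral>z. J z * u z \<partial>bulk.R))" for t
  define Y where "Y t = (t\<^sup>2 * (t powr - Q * D (t\<^sup>2 * s)) - D s) / 2 + (t powr - real CARD('n) * B (t\<^sup>2 * s) - B s) / p" for t
  have J0: "J z = 0" if "s \<le> z \<bullet> z" for z
    using cutoff_eq_0[OF s(1) that] by (simp add: J_def)
  have J: "square_integrable bulk.R J"
    using square_integrable_cutoff[OF square_integrable_radial s(1), of 1 2] s by (simp add: J_def[abs_def])
  have "((\<lambda>t. 2 / s * (X t / (t - 1))) \<longlongrightarrow> 2 / s * (\<integral>z. J z * (G z \<bullet> z) \<partial>bulk.R)) (at_right 1)"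
    unfolding X_def by (intro tendsto_mult_left dilation_quotient_tendsto[OF ap J J0 s])
  moreover have "2 / s * (\<integral>z. J z * (G z \<bullet> z) \<partial>bulk.R) = T s"
    by (simp add: T_def J_def power2_eq_square mult_ac)
  ultimately have X: "((\<lambda>t. 2 / s * (X t / (t - 1))) \<longlongrightarrow> T s) (at_right 1)" by simp
  have sq: "((\<lambda>t. t\<^sup>2 * s) has_real_derivative 2 * s) (at 1)"
    by (auto intro!: derivative_eq_intros)
  have dD: "((\<lambda>t. D (t\<^sup>2 * s)) has_real_derivative D' * (2 * s)) (at 1)"
    by (rule DERIV_chain2[OF _ sq]) (simp add: D')
  have dB: "((\<lambda>t. B (t\<^sup>2 * s)) has_real_derivative B' * (2 * s)) (at 1)"
    by (rule DERIV_chain2[OF _ sq]) (simp add: B')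
  have "(Y has_real_derivative ((2 - Q) * D s + 2 * s * D') / 2 + (- real CARD('n) * B s + 2 * s * B') / p) (at 1)"
  proof -
    have pw: "((\<lambda>t. t powr r) has_real_derivative r) (at 1)" for r :: real
      by (auto intro!: derivative_eq_intros)
    have sq': "((\<lambda>t. t\<^sup>2) has_real_derivative (2 :: real)) (at 1)"
      by (auto intro!: derivative_eq_intros)
    show ?thesis
      unfolding Y_def[abs_def]
      by (rule DERIV_cong[OF DERIV_add[OF
            DERIV_cdivide[OF DERIV_diff[OF DERIV_mult[OF sq' DERIV_mult[OF pw dD]] DERIV_const]]
            DERIV_cdivide[OF DERIV_diff[OF DERIV_mult[OF pw dB] DERIV_const]]]])
        (simp add: algebra_simps)
  qed
  from DERIV_at_right[OF this]
  have Y: "((\<lambda>t. Y t / (t - 1)) \<longlongrightarrow> ((2 - Q) * D s + 2 * s * D') / 2 + (- real CARD('n) * B s + 2 * s * B') / p) (at_right 1)"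
    by (simp add: Y_def)
  have "((\<lambda>t::real. t\<^sup>2 * s) \<longlongrightarrow> 1\<^sup>2 * s) (at_right 1)" by (intro tendsto_intros)
  then have "\<forall>\<^sub>F t in at_right (1::real). t\<^sup>2 * s < 1" using s by (intro order_tendstoD(2)[of _ "1\<^sup>2 * s"]) auto
  moreover have "\<forall>\<^sub>F t in at_right (1::real). 1 < t" by (rule eventually_at_right_less)
  ultimately have "\<forall>\<^sub>F t in at_right 1. 2 / s * (X t / (t - 1)) \<le> Y t / (t - 1)"
  proof eventually_elim
    case (elim t)
    then have "2 / s * X t \<le> Y t"
      using scaled_comparison[OF s(1), of t] by (simp add: X_def J_def Y_def Q_def)
    then have "2 / s * X t / (t - 1) \<le> Y t / (t - 1)"
      using elim by (intro divide_right_mono) auto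
    then show ?case by simp
  qed
  with Y X have "T s \<le> ((2 - Q) * D s + 2 * s * D') / 2 + (- real CARD('n) * B s + 2 * s * B') / p"
    by (intro tendsto_le[of "at_right 1"]) auto
  then show ?thesis
    unfolding Q_def by (simp add: add_divide_distrib diff_divide_distrib algebra_simps)
qed

text \<open>A positive value of H at s1 forces H to be at least c s^K for small s, while vanishing
  of an order n > K bounds it by a multiple of s^n.\<close>

lemma H_eq_0:
  assumes a1: "a < 1" and vanish: "\<And>n::nat. u \<in> o[at 0 within closure (half_ball 1)](\<lambda>z. norm z ^ n)"
    and s1: "0 < s1" "s1 < 1"
  shows "H s1 = 0"
proof (rule ccontr)
  assume "H s1 \<noteq> 0"
  then have "0 < H s1" using nonneg(3)[of s1] by simp
  have q: "0 \<le> real CARD('n) + 1 + a" "real CARD('n) + 1 + a - 2 \<le> real CARD('n)"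
    using a a1 by auto
  obtain c K where c: "0 < c" and lower: "\<And>s. 0 < s \<Longrightarrow> s \<le> s1 \<Longrightarrow> c * s powr K \<le> H s"
    by (rule frequency_lower_bound[OF p q DERIV_D DERIV_B DERIV_H nonneg
          pohozaev[OF _ _ DERIV_D DERIV_B] energy_Cauchy_Schwarz s1 \<open>0 < H s1\<close>]) auto
  obtain n :: nat where n: "K < real n" using reals_Archimedean2 by blast
  have "\<forall>\<^sub>F z in at 0 within closure (half_ball 1). norm (u z) \<le> 1 * norm (norm z ^ n)"
    using vanish[of n] by (rule landau_o.smallD) simp
  then obtain d where d: "0 < d"
    and small: "\<And>z. z \<in> closure (half_ball 1) \<Longrightarrow> z \<noteq> 0 \<Longrightarrow> norm z < d \<Longrightarrow> \<bar>u z\<bar> \<le> norm z ^ n"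
    unfolding eventually_at by (auto simp: norm_power)
  \<comment> \<open>The factor 2 is \<open>fact 2\<close>, the bound for \<open>cutoff 2\<close>. As
    s is a squared radius, u^2 \<le> |z|^(2n) turns into s^n on the support of the cutoff.\<close>
  define C where "C = 2 * measure bulk.R (space bulk.R)"
  have upper: "H s \<le> C * s ^ n" if s: "0 < s" "s < d\<^sup>2" for s
  proof -
    interpret R: finite_measure bulk.R by (rule bulk.finite_measure_R)
    have "H s \<le> (\<integral>z. 2 * s ^ n \<partial>bulk.R)"
      unfolding H_def
    proof (rule integral_mono)
      show "integrable bulk.R (\<lambda>z. (u z)\<^sup>2 * cutoff 2 s z)"
        using square_integrable_u by (intro bulk.integrable_mult_cutoff) (auto simp: square_integrable_def)
      show "(u z)\<^sup>2 * cutoff 2 s z \<le> 2 * s ^ n" if z: "z \<in> space bulk.R" for z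
      proof (cases "z \<bullet> z < s")
        case True
        have "(norm z)\<^sup>2 < d\<^sup>2" using True s by (simp add: power2_norm_eq_inner)
        then have "norm z < d" using d by (simp add: power_less_imp_less_base)
        moreover have "z \<in> half_ball 1" using z by simp
        then have "z \<in> closure (half_ball 1)" "z \<noteq> 0"
          using closure_subset[of "half_ball 1"] by (auto simp: half_ball_def)
        ultimately have "\<bar>u z\<bar> \<le> norm z ^ n" by (intro small)
        then have "(u z)\<^sup>2 \<le> (norm z ^ n)\<^sup>2" by (rule abs_le_square_iff[THEN iffD1, OF order_trans]) simp
        also have "\<dots> = (z \<bullet> z) ^ n"
          by (simp add: power2_norm_eq_inner[symmetric] power_mult[symmetric] mult.commute)
        also have "\<dots> \<le> s ^ n" using True by (intro power_mono) auto
        finally have "(u z)\<^sup>2 * cutoff 2 s z \<le> s ^ n * fact 2"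
          using s by (intro mult_mono cutoff_le_fact) auto
        then show ?thesis by simp
      qed (use s in \<open>simp add: cutoff_eq_0\<close>)
    qed simp
    then show ?thesis by (simp add: C_def mult_ac)
  qed
  have "((\<lambda>s. C * s powr (real n - K)) \<longlongrightarrow> 0) (at_right 0)"
    using n by (intro tendsto_mult_right_zero tendsto_zero_powrI[where b = "real n - K"] tendsto_ident_at tendsto_const)
      (auto simp: eventually_at_filter)
  moreover have "\<forall>\<^sub>F s in at_right 0. c \<le> C * s powr (real n - K)"
  proof (rule eventually_at_rightI)
    show "0 < min (d\<^sup>2) s1" using d s1 by simp
    fix s assume s: "s \<in> {0<..<min (d\<^sup>2) s1}"
    then have "c * s powr K \<le> C * s ^ n"
      using lower[of s] upper[of s] by simp
    also have "\<dots> = C * s powr (real n - K) * s powr K"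
      using s by (simp add: powr_realpow[symmetric] mult.assoc flip: powr_add)
    finally show "c \<le> C * s powr (real n - K)"
      using s by simp
  qed
  ultimately have "c \<le> 0"
    by (intro tendsto_lowerbound[where F = "at_right 0"]) auto
  with c show False by simp
qed

text \<open>H s = 0 makes u vanish almost everywhere where \<open>cutoff 2 s\<close> is positive; by
  continuity a nonzero value would spread to an open set, which is not negligible. Every z0 is
  reached by choosing s between z0 . z0 and 1.\<close>

lemma vanishes:
  assumes H: "\<And>s. 0 < s \<Longrightarrow> s < 1 \<Longrightarrow> H s = 0" and cont: "continuous_on (half_ball 1) u"
    and z0: "z0 \<in> half_ball 1"
  shows "u z0 = 0"
proof (rule ccontr)
  assume nz: "u z0 \<noteq> 0"
  have "z0 \<bullet> z0 < 1"
    using z0 by (simp add: half_ball_def norm_eq_sqrt_inner)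
  then obtain s where s: "z0 \<bullet> z0 < s" "s < 1" using dense by blast
  then have s0: "0 < s" using inner_ge_zero[of z0] by linarith
  have "integrable bulk.R (\<lambda>z. (u z)\<^sup>2 * cutoff 2 s z)"
    using square_integrable_u by (intro bulk.integrable_mult_cutoff) (auto simp: square_integrable_def)
  then have ae: "AE z in bulk.R. (u z)\<^sup>2 * cutoff 2 s z = 0"
    using H[OF s0 s(2)] by (simp add: H_def integral_nonneg_eq_0_iff_AE)
  define U where "U = {z \<in> half_ball 1. u z \<noteq> 0} \<inter> {z. z \<bullet> z < s}"
  have op: "open (half_ball 1 :: ((real ^ 'n) \<times> real) set)"
    unfolding half_ball_def by (intro open_Collect_conj open_Collect_less continuous_intros)
  have "open {z \<in> half_ball 1. u z \<noteq> 0}"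
    using continuous_open_preimage[OF cont op, of "- {0}"] by (simp add: vimage_def Int_def open_Compl)
  moreover have "open {z :: (real ^ 'n) \<times> real. z \<bullet> z < s}"
    by (intro open_Collect_less continuous_intros)
  ultimately have "open U" unfolding U_def by (rule open_Int)
  have "z \<notin> U" if "(u z)\<^sup>2 * cutoff 2 s z = 0" for z
    using that cutoff_pos[OF s0, of z 2] by (auto simp: U_def)
  with ae have "AE z in bulk.R. z \<notin> U" by auto
  then have "AE z in half_space_measure a. z \<in> half_ball 1 \<longrightarrow> z \<notin> U"
    using bulk.S by (subst (asm) AE_restrict_space_iff) (auto simp: bulk.sets_M)
  \<comment> \<open>The weight is positive on the half-ball, so sets that are null for it there are
    Lebesgue null.\<close>
  then have "AE z in lebesgue. 0 < ennreal (if 0 < snd z then snd z powr a else 0) \<longrightarrow> (z \<in> half_ball 1 \<longrightarrow> z \<notin> U)"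
    unfolding half_space_measure_def
    by (subst (asm) AE_density) (intro measurable_compose[OF _ measurable_ennreal] measurable_completion, simp add: half_space_weight_measurable)
  then have "AE z in lebesgue. z \<notin> U"
    by eventually_elim (auto simp: U_def half_ball_def)
  then have "negligible U"
    using \<open>open U\<close> by (simp add: negligible_iff_null_sets AE_iff_null_sets[symmetric])
  moreover have "z0 \<in> U" using z0 nz s by (simp add: U_def)
  ultimately show False
    using open_not_negligible[OF \<open>open U\<close>] by blast
qed

end

theorem corollary1p2:
  fixes a p lm lp :: real and g u :: "(real ^ 'n) \<times> real \<Rightarrow> real"
  assumes "-1 < a" and "a < 1" and "2 \<le> p" and "0 \<le> lm" and "0 \<le> lp"
    and "g \<in> H1a a 1" and "continuous_on (closure (half_ball 1)) g"
    and "solution a p lm lp g u"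
    and "continuous_on (half_ball 1 \<union> flat_ball 1 \<times> {0}) u"
    and "\<And>n::nat. u \<in> o[at 0 within closure (half_ball 1)](\<lambda>z. norm z ^ n)"
  shows "\<forall>z\<in>half_ball 1. u z = 0"
proof -
  interpret degenerate_weight a "TYPE('n)" by unfold_locales fact
  obtain G v where G: "has_gradient a 1 u G" and tr: "has_trace a 1 u v" and v: "v \<in> Lp p (flat_ball 1)"
    and weak: "\<forall>\<phi>\<in>H1a_0 a 1. \<forall>H w. has_gradient a 1 \<phi> H \<longrightarrow> has_trace a 1 \<phi> w \<longrightarrow>
        integrable (lebesgue_on (flat_ball 1)) (\<lambda>x. flux p lm lp (v x) * w x) \<and>
        (LINT z|weighted a 1. G z \<bullet> H z) =
          (LINT x|lebesgue_on (flat_ball 1). flux p lm lp (v x) * w x)"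
    using assms(8) unfolding solution_def by blast
  obtain \<phi> where \<phi>: "approximates \<phi> u G"
    using G unfolding has_gradient_def approximates_def by (auto simp: completion_grad_iff)
  note tests = weak_formulation_test[OF G tr weak]
  \<comment> \<open>The identity tested with \<theta>_s u does not mention t; it is taken at the
    admissible value t = 1, where t^2 s < 1 reduces to s < 1.\<close>
  interpret weak_solution a "TYPE('n)" p lm lp u G v \<phi>
    by unfold_locales (use assms(3-5) \<phi> v tests(2)[where t = 1] tests(3,4) in simp_all)
  show ?thesis
    using vanishes[OF H_eq_0[OF assms(2,10)]] continuous_on_subset[OF assms(9)] by blast
qed

end
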